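(* The following subsumptions between query languages over data graphs hold: (i) RDPQ is subsumed by FO(RDPQ), and FO(RDPQ) is subsumed by FO(ERDPQ); (ii) GPC is subsumed by FO(ERDPQ); (iii) WL is subsumed by FO(ERDPQ); (iv) RDPQ is subsumed by FO$^*(\equiv_{\mathrm{data}})$; (v) GXPath$_{\mathrm{reg}}(\equiv_{\mathrm{data}})$ is subsumed by FO$^*(\equiv_{\mathrm{data}})$.
   Context: Data graphs. Fix a finite alphabet $\Sigma$ and infinite data domains $\mathcal D_{\mathrm{id}}$ and $\mathcal D_{\mathrm{prop}}$. A data graph is $G=(V,E,\mathrm{id},\mathrm{dataof})$ with $V$ a finite nonempty set of nodes, $E\subseteq V\times\Sigma\times V$, $\mathrm{id}:V\to\mathcal D_{\mathrm{id}}$ injective and $\mathrm{dataof}:V\to\mathcal D_{\mathrm{prop}}$. A path is a sequence $\rho=v_0a_1v_1\cdots a_nv_n$ ($n\ge 0$) with $(v_{i-1},a_i,v_i)\in E$ for all $i$; its length is $n$, its positions are $0,\dots,n$, and it is simple if $v_0,\dots,v_n$ are pairwise distinct. Its data path is $d_0a_1d_1\cdots a_nd_n$ with $d_i=(\mathrm{id}(v_i),\mathrm{dataof}(v_i))$. Queries and subsumption. A query of a language is the function assigning to each data graph and each assignment of its free variables a truth value. Language $L$ is subsumed by $L'$ if every query expressible in $L$ is expressible in $L'$ (for query languages returning paths, such as GPC, also the Boolean query "the answer set is nonempty" is considered). RDPA. An $n$-ary register data path automaton (RDPA) has finitely many states partitioned into word states and data states, an initial data state, a set of final word states, and finitely many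 registers, each an id-register (values in $\mathcal D_{\mathrm{id}}\cup\{\sharp\}$) or a data-register (values in $\mathcal D_{\mathrm{prop}}\cup\{\sharp\}$), all initially $\sharp$. It reads words alternating between data letters and word letters, starting and ending with a data letter. From a word state it reads a letter of $(\Sigma\cup\{\sharp\})^n$ via a transition $p\xrightarrow{a}q$ to a data state, leaving registers unchanged. From a data state it reads a data letter (an $n$-tuple of ids and an $n$-tuple of property values, each possibly $\sharp$) via a transition whose guard is a conjunction of (well-typed) equalities/disequalities between registers, input components and constants, and whose update assigns to some registers an input component, a register value or a constant; it then moves to a word state. It accepts nondeterministically if some run ends in a final state. A tuple $(u_1,\dots,u_n)$ of data paths is accepted if their convolution (position-wise tuple, shorter ones padded with $\sharp$ to the length of the longest) is accepted. FO(ERDPQ). Formulas use node variables (ranging over $V$) and path variables (ranging over paths of $G$). Atoms: $\pi=\omega$; $x=y$; $(x,\pi,y)$ ("$\pi$ is a path from $x$ to $y$"); $(\pi_1,\dots,\pi_n)\in A$ for an $n$-ary RDPA $A$ ("the tuple of data paths of $\pi_1,\dots,\pi_n$ is accepted by $A$"). Formulas are closed under $\neg,\wedge,\exists x,\exists\pi$ with standard semantics. FO(RDPQ) is the fragment where all RDPAs are unary. RDPQ consists of the formulas $\exists\pi.\,(x,\pi,y)\wedge \pi\in A$ with $A$ unary. FO$^*(\equiv_{\mathrm{data}})$. First-order logic over node variables with binary relations $E_a=\{(v,v'):(v,a,v')\in E\}$ for $a\in\Sigma$, $\equiv_{\mathrm{data}}=\{(v,v'):\mathrm{dataof}(v)=\mathrm{dataof}(v')\}$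 and equality, closed additionally under the operator: if $\phi(\bar x,\bar y)$ is a formula with $\bar x,\bar y$ tuples of node variables of equal arity, then $\phi^*(\bar x,\bar y)$ is a formula, true at $(\bar u,\bar u')$ iff there are tuples $\bar u_1=\bar u,\dots,\bar u_k=\bar u'$ ($k\ge1$) with $\phi(\bar u_i,\bar u_{i+1})$ for all $i<k$ (other free variables fixed). FO$^*_3(\equiv_{\mathrm{data}})$ is the fragment in which every subformula has at most three free variables. GXPath$_{\mathrm{reg}}(\equiv_{\mathrm{data}})$ is the graph XPath language of Libkin, Martens and Vrgoč, known to have exactly the expressive power of FO$^*_3(\equiv_{\mathrm{data}})$. WL (walk logic). Path variables $\pi,\omega,\dots$ range over paths; each position variable $\ell^\pi$ has a sort $\pi$ and ranges over positions of the path assigned to $\pi$. Atoms: $E_a(\ell^\pi,m^\pi)$ ($m=\ell+1$ and the $m$-th label of the path is $a$); $\ell^\pi<m^\pi$ (same sort only); $\ell^\pi\equiv_{\mathrm{id}} n^\omega$ (the nodes at these positions are equal); $\ell^\pi\equiv_{\mathrm{data}} n^\omega$ (these nodes have equal $\mathrm{dataof}$). Closed under $\neg,\vee,\exists\ell^\pi,\exists\pi$. GPC (graph pattern calculus, forward edges only). Patterns: $()$, $(x)$ ($x$ a node variable), $\rightarrow$, $\xrightarrow{a}$ ($a\in\Sigma$); if $\mathfrak p,\mathfrak p'$ are patterns then so are $\mathfrak p+\mathfrak p'$, $\mathfrak p\mathfrak p'$, $\mathfrak p^{n..m}$ ($n\in\mathbb N$, $m\in\mathbb N\cup\{\infty\}$)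 and $\mathfrak p_{\langle\theta\rangle}$, where conditions are $\theta::=x\equiv_{\mathrm{data}}y\mid\neg\theta\mid\theta\wedge\theta$. A variable occurring in a repetition subpattern $\mathfrak q$ of $\mathfrak p$ may not occur in $\mathfrak p$ outside $\mathfrak q$; variables not inside any repetition are free ($\mathrm{fv}(\mathfrak p)$). The semantics $[\![\mathfrak p]\!]_G$ is a set of pairs $(\rho,\mu)$, $\rho$ a path, $\mu:\mathrm{fv}(\mathfrak p)\to V\cup\{\sharp\}$: $[\![()]\!]=\{(v,\emptyset)\}$; $[\![(x)]\!]=\{(v,\{x\mapsto v\})\}$; $[\![\rightarrow]\!]=\{(vav',\emptyset):(v,a,v')\in E\}$; $[\![\xrightarrow{a}]\!]$ likewise with fixed $a$; $[\![\mathfrak p+\mathfrak p']\!]$ contains $(\rho,\hat\mu)$ for $(\rho,\mu)\in[\![\mathfrak p]\!]\cup[\![\mathfrak p']\!]$, $\hat\mu$ extending $\mu$ by $\sharp$; $[\![\mathfrak p\mathfrak p']\!]=\{(\rho\cdot\rho',\mu\cup\mu')\}$ over $(\rho,\mu)\in[\![\mathfrak p]\!]$, $(\rho',\mu')\in[\![\mathfrak p']\!]$ where $\rho$ ends where $\rho'$ starts and $\mu,\mu'$ agree on common variables where both are non-$\sharp$ (the union takes the non-$\sharp$ value when present); $[\![\mathfrak p^{n..m}]\!]=\bigcup_{i=n}^m\{(\rho_1\cdots\rho_i,\emptyset): \text{each }\rho_j\text{ satisfies }\mathfrak p\}$ (for $i=0$ this is $[\![()]\!]$); $[\![\mathfrak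 p_{\langle\theta\rangle}]\!]=\{(\rho,\mu)\in[\![\mathfrak p]\!]:\mu\models\theta\}$ with $\mu\models x\equiv_{\mathrm{data}}y$ iff $\mathrm{dataof}(\mu(x))=\mathrm{dataof}(\mu(y))$. A GPC query is $\mathfrak t\,\mathfrak p$ with restrictor $\mathfrak t$: SIMPLE keeps pairs with $\rho$ simple; SHORTEST keeps pairs whose $\rho$ has minimal length among paths in $[\![\mathfrak p]\!]$ with the same endpoints; SHORTESTSIMPLE keeps simple $\rho$ of minimal length among simple paths in $[\![\mathfrak p]\!]$ with the same endpoints. A path $\rho$ is in $[\![Q]\!]_G$ if $(\rho,\mu)\in[\![Q]\!]_G$ for some $\mu$; $G$ satisfies $Q$ if $[\![Q]\!]_G\neq\emptyset$.
   Formalization: The only constant allowed in RDPA guards and updates is ♯: with data constants (iv) fails, since FO*(≡data) cannot name a data value; (i) is likewise stated for such RDPAs. Nodes come from one arbitrary fixed type, which if infinite covers all finite data graphs up to isomorphism. *)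

theory Defs
  imports Main "HOL-Library.Extended_Nat"
begin

record ('a, 'v, 'i, 'd) dgraph =
  nodes  :: "'v set"
  edges  :: "('v \<times> 'a \<times> 'v) set"
  ident  :: "'v \<Rightarrow> 'i"
  dataof :: "'v \<Rightarrow> 'd"

definition dgraph_wf :: "('a, 'v, 'i, 'd) dgraph \<Rightarrow> bool" where
  "dgraph_wf G \<longleftrightarrow> finite (nodes G) \<and> nodes G \<noteq> {} \<and>
     (\<forall>(v, a, v') \<in> edges G. v \<in> nodes G \<and> v' \<in> nodes G) \<and>
     inj_on (ident G) (nodes G)"

text \<open>A path v0 a1 v1 ... an vn is represented as (v0, [(a1,v1),...,(an,vn)]).\<close>
type_synonym ('a, 'v) path = "'v \<times> ('a \<times> 'v) list"

definition plen :: "('a, 'v) path \<Rightarrow> nat" where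
  "plen \<rho> = length (snd \<rho>)"

definition pnode :: "('a, 'v) path \<Rightarrow> nat \<Rightarrow> 'v" where
  "pnode \<rho> i = (if i = 0 then fst \<rho> else snd (snd \<rho> ! (i - 1)))"

definition plabel :: "('a, 'v) path \<Rightarrow> nat \<Rightarrow> 'a" where
  "plabel \<rho> i = fst (snd \<rho> ! (i - 1))"

definition pfirst :: "('a, 'v) path \<Rightarrow> 'v" where
  "pfirst \<rho> = fst \<rho>"

definition plast :: "('a, 'v) path \<Rightarrow> 'v" where
  "plast \<rho> = pnode \<rho> (plen \<rho>)"

definition is_path :: "('a, 'v, 'i, 'd) dgraph \<Rightarrow> ('a, 'v) path \<Rightarrow> bool" where
  "is_path G \<rho> \<longleftrightarrow> fst \<rho> \<in> nodes G \<and>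
     (\<forall>i < plen \<rho>. (pnode \<rho> i, plabel \<rho> (Suc i), pnode \<rho> (Suc i)) \<in> edges G)"

definition simple_path :: "('a, 'v) path \<Rightarrow> bool" where
  "simple_path \<rho> \<longleftrightarrow> distinct (map (pnode \<rho>) [0..<Suc (plen \<rho>)])"

definition pcat :: "('a, 'v) path \<Rightarrow> ('a, 'v) path \<Rightarrow> ('a, 'v) path" where
  "pcat \<rho> \<rho>' = (fst \<rho>, snd \<rho> @ snd \<rho>')"

type_synonym ('a, 'i, 'd) dpath = "('i \<times> 'd) \<times> ('a \<times> ('i \<times> 'd)) list"

definition dletter :: "('a, 'v, 'i, 'd) dgraph \<Rightarrow> 'v \<Rightarrow> 'i \<times> 'd" where
  "dletter G v = (ident G v, dataof G v)"

definition dpath_of :: "('a, 'v, 'i, 'd) dgraph \<Rightarrow> ('a, 'v) path \<Rightarrow> ('a, 'i, 'd) dpath" where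
  "dpath_of G \<rho> = (dletter G (fst \<rho>), map (\<lambda>(a, v). (a, dletter G v)) (snd \<rho>))"

definition dlen :: "('a, 'i, 'd) dpath \<Rightarrow> nat" where
  "dlen u = length (snd u)"

definition ddata :: "('a, 'i, 'd) dpath \<Rightarrow> nat \<Rightarrow> 'i \<times> 'd" where
  "ddata u i = (if i = 0 then fst u else snd (snd u ! (i - 1)))"

definition dlab :: "('a, 'i, 'd) dpath \<Rightarrow> nat \<Rightarrow> 'a" where
  "dlab u i = fst (snd u ! (i - 1))"

definition valid_asg :: "('a, 'v, 'i, 'd) dgraph \<Rightarrow> (nat \<Rightarrow> 'v) \<Rightarrow> (nat \<Rightarrow> ('a, 'v) path) \<Rightarrow> bool" where
  "valid_asg G \<nu> \<pi> \<longleftrightarrow> (\<forall>x. \<nu> x \<in> nodes G) \<and> (\<forall>p. is_path G (\<pi> p))"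

text \<open>Terms in guards/updates: a register, an input component, or the constant \<sharp>
  (represented by None). Id-terms and data-terms are separated (well-typedness).\<close>
datatype iterm = IReg nat | IIn nat | ISharp
datatype dterm = DReg nat | DIn nat | DSharp

datatype gatom = IEq iterm iterm | INeq iterm iterm | DEq dterm dterm | DNeq dterm dterm

text \<open>States are natural numbers; word states are wstates, data states are states - wstates.
  A data transition (q, guard, id-update, data-update, p): the guard is a conjunction (list) of
  atoms, the updates say which registers get which term (None = unchanged).\<close>
record 'a rdpa =
  arity  :: nat
  states :: "nat set"
  wstates :: "nat set"
  init   :: nat
  final  :: "nat set"
  nireg  :: nat
  ndreg  :: nat
  wtrans :: "(nat \<times> 'a option list \<times> nat) set"
  dtrans :: "(nat \<times> gatom list \<times> (nat \<Rightarrow> iterm option) \<times> (nat \<Rightarrow> dterm option) \<times> nat) set"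

fun iterm_ok :: "'a rdpa \<Rightarrow> iterm \<Rightarrow> bool" where
  "iterm_ok A (IReg k) = (k < nireg A)"
| "iterm_ok A (IIn j) = (j < arity A)"
| "iterm_ok A ISharp = True"

fun dterm_ok :: "'a rdpa \<Rightarrow> dterm \<Rightarrow> bool" where
  "dterm_ok A (DReg k) = (k < ndreg A)"
| "dterm_ok A (DIn j) = (j < arity A)"
| "dterm_ok A DSharp = True"

fun gatom_ok :: "'a rdpa \<Rightarrow> gatom \<Rightarrow> bool" where
  "gatom_ok A (IEq s t) = (iterm_ok A s \<and> iterm_ok A t)"
| "gatom_ok A (INeq s t) = (iterm_ok A s \<and> iterm_ok A t)"
| "gatom_ok A (DEq s t) = (dterm_ok A s \<and> dterm_ok A t)"
| "gatom_ok A (DNeq s t) = (dterm_ok A s \<and> dterm_ok A t)"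

definition rdpa_wf :: "'a rdpa \<Rightarrow> bool" where
  "rdpa_wf A \<longleftrightarrow> arity A \<ge> 1 \<and> finite (states A) \<and> wstates A \<subseteq> states A \<and>
     init A \<in> states A - wstates A \<and> final A \<subseteq> wstates A \<and>
     finite (wtrans A) \<and> finite (dtrans A) \<and>
     (\<forall>(p, a, q) \<in> wtrans A. p \<in> wstates A \<and> q \<in> states A - wstates A \<and> length a = arity A) \<and>
     (\<forall>(q, g, iu, du, p) \<in> dtrans A. q \<in> states A - wstates A \<and> p \<in> wstates A \<and>
        (\<forall>c \<in> set g. gatom_ok A c) \<and>
        (\<forall>k. iu k \<noteq> None \<longrightarrow> k < nireg A \<and> iterm_ok A (the (iu k))) \<and>
        (\<forall>k. du k \<noteq> None \<longrightarrow> k < ndreg A \<and> dterm_ok A (the (du k))))"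

text \<open>A data letter of an n-ary RDPA: an n-tuple of ids and an n-tuple of property values
  (None = \<sharp>); a word letter: an n-tuple over Sigma \<union> {\<sharp>}.\<close>
type_synonym ('i, 'd) dlet = "'i option list \<times> 'd option list"

fun ieval :: "(nat \<Rightarrow> 'i option) \<Rightarrow> ('i, 'd) dlet \<Rightarrow> iterm \<Rightarrow> 'i option" where
  "ieval r d (IReg k) = r k"
| "ieval r d (IIn j) = fst d ! j"
| "ieval r d ISharp = None"

fun deval :: "(nat \<Rightarrow> 'd option) \<Rightarrow> ('i, 'd) dlet \<Rightarrow> dterm \<Rightarrow> 'd option" where
  "deval r d (DReg k) = r k"
| "deval r d (DIn j) = snd d ! j"
| "deval r d DSharp = None"

fun gatom_sat :: "(nat \<Rightarrow> 'i option) \<Rightarrow> (nat \<Rightarrow> 'd option) \<Rightarrow> ('i, 'd) dlet \<Rightarrow> gatom \<Rightarrow> bool" where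
  "gatom_sat ri rd d (IEq s t) = (ieval ri d s = ieval ri d t)"
| "gatom_sat ri rd d (INeq s t) = (ieval ri d s \<noteq> ieval ri d t)"
| "gatom_sat ri rd d (DEq s t) = (deval rd d s = deval rd d t)"
| "gatom_sat ri rd d (DNeq s t) = (deval rd d s \<noteq> deval rd d t)"

definition iupdate :: "(nat \<Rightarrow> 'i option) \<Rightarrow> ('i, 'd) dlet \<Rightarrow> (nat \<Rightarrow> iterm option) \<Rightarrow> nat \<Rightarrow> 'i option" where
  "iupdate ri d u k = (case u k of None \<Rightarrow> ri k | Some t \<Rightarrow> ieval ri d t)"

definition dupdate :: "(nat \<Rightarrow> 'd option) \<Rightarrow> ('i, 'd) dlet \<Rightarrow> (nat \<Rightarrow> dterm option) \<Rightarrow> nat \<Rightarrow> 'd option" where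
  "dupdate rd d u k = (case u k of None \<Rightarrow> rd k | Some t \<Rightarrow> deval rd d t)"

fun rdpa_run :: "'a rdpa \<Rightarrow> nat \<Rightarrow> (nat \<Rightarrow> 'i option) \<Rightarrow> (nat \<Rightarrow> 'd option) \<Rightarrow> ('i, 'd) dlet
     \<Rightarrow> ('a option list \<times> ('i, 'd) dlet) list \<Rightarrow> bool" where
  "rdpa_run A q ri rd d [] =
     (\<exists>g iu du p. (q, g, iu, du, p) \<in> dtrans A \<and> (\<forall>c \<in> set g. gatom_sat ri rd d c) \<and> p \<in> final A)"
| "rdpa_run A q ri rd d ((a, d') # w) =
     (\<exists>g iu du p q'. (q, g, iu, du, p) \<in> dtrans A \<and> (\<forall>c \<in> set g. gatom_sat ri rd d c) \<and>
        (p, a, q') \<in> wtrans A \<and>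
        rdpa_run A q' (iupdate ri d iu) (dupdate rd d du) d' w)"

definition rdpa_accepts :: "'a rdpa \<Rightarrow> ('i, 'd) dlet \<times> ('a option list \<times> ('i, 'd) dlet) list \<Rightarrow> bool" where
  "rdpa_accepts A w \<longleftrightarrow> rdpa_run A (init A) (\<lambda>_. None) (\<lambda>_. None) (fst w) (snd w)"

definition conv :: "('a, 'i, 'd) dpath list \<Rightarrow> ('i, 'd) dlet \<times> ('a option list \<times> ('i, 'd) dlet) list" where
  "conv us =
    (let L = fold max (map dlen us) 0;
         dl = (\<lambda>i. (map (\<lambda>u. if i \<le> dlen u then Some (fst (ddata u i)) else None) us,
                    map (\<lambda>u. if i \<le> dlen u then Some (snd (ddata u i)) else None) us));
         wl = (\<lambda>i. map (\<lambda>u. if i \<le> dlen u then Some (dlab u i) else None) us)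
     in (dl 0, map (\<lambda>i. (wl i, dl i)) [1..<Suc L]))"

text \<open>Node variables and path variables are natural numbers (two separate name spaces).\<close>
datatype 'a fo =
    FPEq nat nat
  | FNEq nat nat
  | FReach nat nat nat
  | FIn "nat list" "'a rdpa"
  | FNot "'a fo"
  | FAnd "'a fo" "'a fo"
  | FExN nat "'a fo"
  | FExP nat "'a fo"

fun fo_sat :: "('a, 'v, 'i, 'd) dgraph \<Rightarrow> (nat \<Rightarrow> 'v) \<Rightarrow> (nat \<Rightarrow> ('a, 'v) path) \<Rightarrow> 'a fo \<Rightarrow> bool" where
  "fo_sat G \<nu> \<pi> (FPEq p q) = (\<pi> p = \<pi> q)"
| "fo_sat G \<nu> \<pi> (FNEq x y) = (\<nu> x = \<nu> y)"
| "fo_sat G \<nu> \<pi> (FReach x p y) = (pfirst (\<pi> p) = \<nu> x \<and> plast (\<pi> p) = \<nu> y)"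
| "fo_sat G \<nu> \<pi> (FIn ps A) = rdpa_accepts A (conv (map (\<lambda>p. dpath_of G (\<pi> p)) ps))"
| "fo_sat G \<nu> \<pi> (FNot \<phi>) = (\<not> fo_sat G \<nu> \<pi> \<phi>)"
| "fo_sat G \<nu> \<pi> (FAnd \<phi> \<psi>) = (fo_sat G \<nu> \<pi> \<phi> \<and> fo_sat G \<nu> \<pi> \<psi>)"
| "fo_sat G \<nu> \<pi> (FExN x \<phi>) = (\<exists>v \<in> nodes G. fo_sat G (\<nu>(x := v)) \<pi> \<phi>)"
| "fo_sat G \<nu> \<pi> (FExP p \<phi>) = (\<exists>\<rho>. is_path G \<rho> \<and> fo_sat G \<nu> (\<pi>(p := \<rho>)) \<phi>)"

fun fo_wf :: "'a fo \<Rightarrow> bool" where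
  "fo_wf (FIn ps A) = (rdpa_wf A \<and> arity A = length ps)"
| "fo_wf (FNot \<phi>) = fo_wf \<phi>"
| "fo_wf (FAnd \<phi> \<psi>) = (fo_wf \<phi> \<and> fo_wf \<psi>)"
| "fo_wf (FExN x \<phi>) = fo_wf \<phi>"
| "fo_wf (FExP p \<phi>) = fo_wf \<phi>"
| "fo_wf _ = True"

fun fo_unary :: "'a fo \<Rightarrow> bool" where
  "fo_unary (FIn ps A) = (arity A = 1)"
| "fo_unary (FNot \<phi>) = fo_unary \<phi>"
| "fo_unary (FAnd \<phi> \<psi>) = (fo_unary \<phi> \<and> fo_unary \<psi>)"
| "fo_unary (FExN x \<phi>) = fo_unary \<phi>"
| "fo_unary (FExP p \<phi>) = fo_unary \<phi>"
| "fo_unary _ = True"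

definition ERDPQ :: "'a fo set" where
  "ERDPQ = {\<phi>. fo_wf \<phi>}"

definition FO_RDPQ :: "'a fo set" where
  "FO_RDPQ = {\<phi>. fo_wf \<phi> \<and> fo_unary \<phi>}"

definition RDPQ :: "'a fo set" where
  "RDPQ = {FExP p (FAnd (FReach x p y) (FIn [p] A)) | x p y A. rdpa_wf A \<and> arity A = 1}"

datatype 'a fs =
    SE 'a nat nat | SData nat nat | SEq nat nat
  | SNot "'a fs" | SAnd "'a fs" "'a fs" | SEx nat "'a fs"
  | SStar "nat list" "nat list" "'a fs"

fun updl :: "(nat \<Rightarrow> 'v) \<Rightarrow> nat list \<Rightarrow> 'v list \<Rightarrow> nat \<Rightarrow> 'v" where
  "updl \<nu> (x # xs) (u # us) = updl (\<nu>(x := u)) xs us"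
| "updl \<nu> _ _ = \<nu>"

primrec fs_sat :: "('a, 'v, 'i, 'd) dgraph \<Rightarrow> (nat \<Rightarrow> 'v) \<Rightarrow> (nat \<Rightarrow> ('a, 'v) path) \<Rightarrow> 'a fs \<Rightarrow> bool" where
  "fs_sat G \<nu> \<pi> (SE a x y) = ((\<nu> x, a, \<nu> y) \<in> edges G)"
| "fs_sat G \<nu> \<pi> (SData x y) = (dataof G (\<nu> x) = dataof G (\<nu> y))"
| "fs_sat G \<nu> \<pi> (SEq x y) = (\<nu> x = \<nu> y)"
| "fs_sat G \<nu> \<pi> (SNot \<phi>) = (\<not> fs_sat G \<nu> \<pi> \<phi>)"
| "fs_sat G \<nu> \<pi> (SAnd \<phi> \<psi>) = (fs_sat G \<nu> \<pi> \<phi> \<and> fs_sat G \<nu> \<pi> \<psi>)"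
| "fs_sat G \<nu> \<pi> (SEx x \<phi>) = (\<exists>v \<in> nodes G. fs_sat G (\<nu>(x := v)) \<pi> \<phi>)"
| "fs_sat G \<nu> \<pi> (SStar xs ys \<phi>) =
     (\<lambda>us us'. length us = length xs \<and> length us' = length ys \<and>
        set us \<subseteq> nodes G \<and> set us' \<subseteq> nodes G \<and>
        fs_sat G (updl (updl \<nu> xs us) ys us') \<pi> \<phi>)\<^sup>*\<^sup>* (map \<nu> xs) (map \<nu> ys)"

fun fs_wf :: "'a fs \<Rightarrow> bool" where
  "fs_wf (SNot \<phi>) = fs_wf \<phi>"
| "fs_wf (SAnd \<phi> \<psi>) = (fs_wf \<phi> \<and> fs_wf \<psi>)"
| "fs_wf (SEx x \<phi>) = fs_wf \<phi>"
| "fs_wf (SStar xs ys \<phi>) = (length xs = length ys \<and> distinct (xs @ ys) \<and> fs_wf \<phi>)"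
| "fs_wf _ = True"

definition FOstar :: "'a fs set" where
  "FOstar = {\<phi>. fs_wf \<phi>}"

section \<open>GXPath_reg(\<equiv>data) (Libkin, Martens, Vrgoc)\<close>

datatype 'a gxn =
    GTop | GNot "'a gxn" | GAnd "'a gxn" "'a gxn" | GDia "'a gxp"
  | GDEq "'a gxp" "'a gxp" | GDNeq "'a gxp" "'a gxp"
and 'a gxp =
    GEps | GAny | GLab 'a | GInv 'a | GTest "'a gxn"
  | GComp "'a gxp" "'a gxp" | GUn "'a gxp" "'a gxp" | GCompl "'a gxp" | GStar "'a gxp"
  | GPEq "'a gxp" | GPNeq "'a gxp"

fun gx_node :: "('a, 'v, 'i, 'd) dgraph \<Rightarrow> 'a gxn \<Rightarrow> 'v set"
and gx_path :: "('a, 'v, 'i, 'd) dgraph \<Rightarrow> 'a gxp \<Rightarrow> ('v \<times> 'v) set" where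
  "gx_node G GTop = nodes G"
| "gx_node G (GNot \<phi>) = nodes G - gx_node G \<phi>"
| "gx_node G (GAnd \<phi> \<psi>) = gx_node G \<phi> \<inter> gx_node G \<psi>"
| "gx_node G (GDia \<alpha>) = {v. \<exists>v'. (v, v') \<in> gx_path G \<alpha>}"
| "gx_node G (GDEq \<alpha> \<beta>) = {v. \<exists>v1 v2. (v, v1) \<in> gx_path G \<alpha> \<and> (v, v2) \<in> gx_path G \<beta> \<and>
                                dataof G v1 = dataof G v2}"
| "gx_node G (GDNeq \<alpha> \<beta>) = {v. \<exists>v1 v2. (v, v1) \<in> gx_path G \<alpha> \<and> (v, v2) \<in> gx_path G \<beta> \<and>
                                dataof G v1 \<noteq> dataof G v2}"
| "gx_path G GEps = Id_on (nodes G)"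
| "gx_path G GAny = {(v, v'). \<exists>a. (v, a, v') \<in> edges G}"
| "gx_path G (GLab a) = {(v, v'). (v, a, v') \<in> edges G}"
| "gx_path G (GInv a) = {(v', v). (v, a, v') \<in> edges G}"
| "gx_path G (GTest \<phi>) = Id_on (gx_node G \<phi>)"
| "gx_path G (GComp \<alpha> \<beta>) = gx_path G \<alpha> O gx_path G \<beta>"
| "gx_path G (GUn \<alpha> \<beta>) = gx_path G \<alpha> \<union> gx_path G \<beta>"
| "gx_path G (GCompl \<alpha>) = (nodes G \<times> nodes G) - gx_path G \<alpha>"
| "gx_path G (GStar \<alpha>) = Id_on (nodes G) \<union> (gx_path G \<alpha>)\<^sup>+"
| "gx_path G (GPEq \<alpha>) = {(v, v') \<in> gx_path G \<alpha>. dataof G v = dataof G v'}"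
| "gx_path G (GPNeq \<alpha>) = {(v, v') \<in> gx_path G \<alpha>. dataof G v \<noteq> dataof G v'}"

text \<open>Node formulas are unary queries (free node variable 0), path formulas are binary
  queries (free node variables 0 and 1).\<close>
definition gx_node_query :: "('a, 'v, 'i, 'd) dgraph \<Rightarrow> (nat \<Rightarrow> 'v) \<Rightarrow> (nat \<Rightarrow> ('a, 'v) path) \<Rightarrow> 'a gxn \<Rightarrow> bool" where
  "gx_node_query G \<nu> \<pi> \<phi> \<longleftrightarrow> \<nu> 0 \<in> gx_node G \<phi>"

definition gx_path_query :: "('a, 'v, 'i, 'd) dgraph \<Rightarrow> (nat \<Rightarrow> 'v) \<Rightarrow> (nat \<Rightarrow> ('a, 'v) path) \<Rightarrow> 'a gxp \<Rightarrow> bool" where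
  "gx_path_query G \<nu> \<pi> \<alpha> \<longleftrightarrow> (\<nu> 0, \<nu> 1) \<in> gx_path G \<alpha>"

text \<open>A position variable is a pair (name, sort) where the sort is a path variable.\<close>
type_synonym posvar = "nat \<times> nat"

datatype 'a wl =
    WE 'a posvar posvar | WLess posvar posvar | WId posvar posvar | WData posvar posvar
  | WNot "'a wl" | WOr "'a wl" "'a wl" | WExPos posvar "'a wl" | WExP nat "'a wl"

fun wl_sat :: "('a, 'v, 'i, 'd) dgraph \<Rightarrow> (nat \<Rightarrow> ('a, 'v) path) \<Rightarrow> (posvar \<Rightarrow> nat) \<Rightarrow> 'a wl \<Rightarrow> bool" where
  "wl_sat G \<pi> pos (WE a l m) = (pos m = Suc (pos l) \<and> plabel (\<pi> (snd m)) (pos m) = a)"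
| "wl_sat G \<pi> pos (WLess l m) = (pos l < pos m)"
| "wl_sat G \<pi> pos (WId l m) = (pnode (\<pi> (snd l)) (pos l) = pnode (\<pi> (snd m)) (pos m))"
| "wl_sat G \<pi> pos (WData l m) =
     (dataof G (pnode (\<pi> (snd l)) (pos l)) = dataof G (pnode (\<pi> (snd m)) (pos m)))"
| "wl_sat G \<pi> pos (WNot \<phi>) = (\<not> wl_sat G \<pi> pos \<phi>)"
| "wl_sat G \<pi> pos (WOr \<phi> \<psi>) = (wl_sat G \<pi> pos \<phi> \<or> wl_sat G \<pi> pos \<psi>)"
| "wl_sat G \<pi> pos (WExPos l \<phi>) = (\<exists>i \<le> plen (\<pi> (snd l)). wl_sat G \<pi> (pos(l := i)) \<phi>)"
| "wl_sat G \<pi> pos (WExP p \<phi>) = (\<exists>\<rho>. is_path G \<rho> \<and> wl_sat G (\<pi>(p := \<rho>)) pos \<phi>)"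

fun wl_fpos :: "'a wl \<Rightarrow> posvar set" where
  "wl_fpos (WE a l m) = {l, m}"
| "wl_fpos (WLess l m) = {l, m}"
| "wl_fpos (WId l m) = {l, m}"
| "wl_fpos (WData l m) = {l, m}"
| "wl_fpos (WNot \<phi>) = wl_fpos \<phi>"
| "wl_fpos (WOr \<phi> \<psi>) = wl_fpos \<phi> \<union> wl_fpos \<psi>"
| "wl_fpos (WExPos l \<phi>) = wl_fpos \<phi> - {l}"
| "wl_fpos (WExP p \<phi>) = wl_fpos \<phi>"

fun wl_wf :: "'a wl \<Rightarrow> bool" where
  "wl_wf (WE a l m) = (snd l = snd m)"
| "wl_wf (WLess l m) = (snd l = snd m)"
| "wl_wf (WId l m) = True"
| "wl_wf (WData l m) = True"
| "wl_wf (WNot \<phi>) = wl_wf \<phi>"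
| "wl_wf (WOr \<phi> \<psi>) = (wl_wf \<phi> \<and> wl_wf \<psi>)"
| "wl_wf (WExPos l \<phi>) = wl_wf \<phi>"
| "wl_wf (WExP p \<phi>) = (wl_wf \<phi> \<and> (\<forall>l \<in> wl_fpos \<phi>. snd l \<noteq> p))"

definition WL :: "'a wl set" where
  "WL = {\<phi>. wl_wf \<phi> \<and> wl_fpos \<phi> = {}}"

definition wl_query :: "('a, 'v, 'i, 'd) dgraph \<Rightarrow> (nat \<Rightarrow> 'v) \<Rightarrow> (nat \<Rightarrow> ('a, 'v) path) \<Rightarrow> 'a wl \<Rightarrow> bool" where
  "wl_query G \<nu> \<pi> \<phi> \<longleftrightarrow> wl_sat G \<pi> (\<lambda>_. 0) \<phi>"

section \<open>GPC (forward edges only)\<close>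

datatype cond = CData nat nat | CNot cond | CAnd cond cond

datatype 'a pat =
    PEmpty | PVar nat | PAny | PLab 'a
  | PUnion "'a pat" "'a pat" | PConcat "'a pat" "'a pat"
  | PRep "'a pat" nat enat | PCond "'a pat" cond

fun cvars :: "cond \<Rightarrow> nat set" where
  "cvars (CData x y) = {x, y}"
| "cvars (CNot \<theta>) = cvars \<theta>"
| "cvars (CAnd \<theta> \<theta>') = cvars \<theta> \<union> cvars \<theta>'"

fun pvars :: "'a pat \<Rightarrow> nat set" where
  "pvars (PVar x) = {x}"
| "pvars (PUnion p q) = pvars p \<union> pvars q"
| "pvars (PConcat p q) = pvars p \<union> pvars q"
| "pvars (PRep p n m) = pvars p"
| "pvars (PCond p \<theta>) = pvars p \<union> cvars \<theta>"
| "pvars _ = {}"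

fun pbv :: "'a pat \<Rightarrow> nat set" where
  "pbv (PUnion p q) = pbv p \<union> pbv q"
| "pbv (PConcat p q) = pbv p \<union> pbv q"
| "pbv (PRep p n m) = pvars p"
| "pbv (PCond p \<theta>) = pbv p"
| "pbv _ = {}"

fun pfv :: "'a pat \<Rightarrow> nat set" where
  "pfv (PVar x) = {x}"
| "pfv (PUnion p q) = pfv p \<union> pfv q"
| "pfv (PConcat p q) = pfv p \<union> pfv q"
| "pfv (PRep p n m) = {}"
| "pfv (PCond p \<theta>) = pfv p"
| "pfv _ = {}"

fun pat_wf :: "'a pat \<Rightarrow> bool" where
  "pat_wf (PUnion p q) = (pat_wf p \<and> pat_wf q \<and> pbv p \<inter> pvars q = {} \<and> pbv q \<inter> pvars p = {})"
| "pat_wf (PConcat p q) = (pat_wf p \<and> pat_wf q \<and> pbv p \<inter> pvars q = {} \<and> pbv q \<inter> pvars p = {})"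
| "pat_wf (PRep p n m) = pat_wf p"
| "pat_wf (PCond p \<theta>) = (pat_wf p \<and> cvars \<theta> \<subseteq> pfv p)"
| "pat_wf _ = True"

text \<open>mu: partial map on variables; Some None is \<sharp>, Some (Some v) is node v.\<close>
type_synonym 'v gasg = "nat \<Rightarrow> 'v option option"

fun csat :: "('a, 'v, 'i, 'd) dgraph \<Rightarrow> 'v gasg \<Rightarrow> cond \<Rightarrow> bool" where
  "csat G \<mu> (CData x y) = (\<exists>u w. \<mu> x = Some (Some u) \<and> \<mu> y = Some (Some w) \<and> dataof G u = dataof G w)"
| "csat G \<mu> (CNot \<theta>) = (\<not> csat G \<mu> \<theta>)"
| "csat G \<mu> (CAnd \<theta> \<theta>') = (csat G \<mu> \<theta> \<and> csat G \<mu> \<theta>')"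

definition ext_sharp :: "'v gasg \<Rightarrow> nat set \<Rightarrow> 'v gasg" where
  "ext_sharp \<mu> X = (\<lambda>x. if x \<in> X \<and> \<mu> x = None then Some None else \<mu> x)"

definition compat :: "'v gasg \<Rightarrow> 'v gasg \<Rightarrow> bool" where
  "compat \<mu> \<mu>' \<longleftrightarrow> (\<forall>x u u'. \<mu> x = Some (Some u) \<and> \<mu>' x = Some (Some u') \<longrightarrow> u = u')"

definition gunion :: "'v gasg \<Rightarrow> 'v gasg \<Rightarrow> 'v gasg" where
  "gunion \<mu> \<mu>' = (\<lambda>x. case \<mu> x of Some (Some v) \<Rightarrow> Some (Some v)
                              | _ \<Rightarrow> (case \<mu>' x of None \<Rightarrow> \<mu> x | Some r \<Rightarrow> Some r))"

primrec pat_sem :: "('a, 'v, 'i, 'd) dgraph \<Rightarrow> 'a pat \<Rightarrow> (('a, 'v) path \<times> 'v gasg) set" where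
  "pat_sem G PEmpty = {((v, []), Map.empty) | v. v \<in> nodes G}"
| "pat_sem G (PVar x) = {((v, []), [x \<mapsto> Some v]) | v. v \<in> nodes G}"
| "pat_sem G PAny = {((v, [(a, v')]), Map.empty) | v a v'. (v, a, v') \<in> edges G}"
| "pat_sem G (PLab b) = {((v, [(b, v')]), Map.empty) | v v'. (v, b, v') \<in> edges G}"
| "pat_sem G (PUnion p q) =
     {(\<rho>, ext_sharp \<mu> (pfv p \<union> pfv q)) | \<rho> \<mu>. (\<rho>, \<mu>) \<in> pat_sem G p \<union> pat_sem G q}"
| "pat_sem G (PConcat p q) =
     {(pcat \<rho> \<rho>', gunion \<mu> \<mu>') | \<rho> \<mu> \<rho>' \<mu>'. (\<rho>, \<mu>) \<in> pat_sem G p \<and> (\<rho>', \<mu>') \<in> pat_sem G q \<and>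
        plast \<rho> = pfirst \<rho>' \<and> compat \<mu> \<mu>'}"
| "pat_sem G (PRep p n m) =
     {((v, []), Map.empty) | v. v \<in> nodes G \<and> n = 0} \<union>
     {(foldl pcat (hd \<rho>s) (tl \<rho>s), Map.empty) | \<rho>s.
        \<rho>s \<noteq> [] \<and> n \<le> length \<rho>s \<and> enat (length \<rho>s) \<le> m \<and>
        (\<forall>\<rho> \<in> set \<rho>s. \<exists>\<mu>. (\<rho>, \<mu>) \<in> pat_sem G p) \<and>
        (\<forall>j. Suc j < length \<rho>s \<longrightarrow> plast (\<rho>s ! j) = pfirst (\<rho>s ! Suc j))}"
| "pat_sem G (PCond p \<theta>) = {(\<rho>, \<mu>) \<in> pat_sem G p. csat G \<mu> \<theta>}"

datatype restrictor = SIMPLE | SHORTEST | SHORTESTSIMPLE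

fun restr_sem :: "('a, 'v, 'i, 'd) dgraph \<Rightarrow> restrictor \<Rightarrow> 'a pat \<Rightarrow> (('a, 'v) path \<times> 'v gasg) set" where
  "restr_sem G SIMPLE p = {(\<rho>, \<mu>) \<in> pat_sem G p. simple_path \<rho>}"
| "restr_sem G SHORTEST p = {(\<rho>, \<mu>) \<in> pat_sem G p.
     \<forall>(\<rho>', \<mu>') \<in> pat_sem G p. pfirst \<rho>' = pfirst \<rho> \<and> plast \<rho>' = plast \<rho> \<longrightarrow> plen \<rho> \<le> plen \<rho>'}"
| "restr_sem G SHORTESTSIMPLE p = {(\<rho>, \<mu>) \<in> pat_sem G p. simple_path \<rho> \<and>
     (\<forall>(\<rho>', \<mu>') \<in> pat_sem G p. simple_path \<rho>' \<and> pfirst \<rho>' = pfirst \<rho> \<and> plast \<rho>' = plast \<rho>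
        \<longrightarrow> plen \<rho> \<le> plen \<rho>')}"

definition gpc_ans :: "('a, 'v, 'i, 'd) dgraph \<Rightarrow> restrictor \<times> 'a pat \<Rightarrow> ('a, 'v) path set" where
  "gpc_ans G Q = {\<rho>. \<exists>\<mu>. (\<rho>, \<mu>) \<in> restr_sem G (fst Q) (snd Q)}"

definition GPC :: "(restrictor \<times> 'a pat) set" where
  "GPC = {Q. pat_wf (snd Q)}"

text \<open>GPC as a path query (the output path is path variable 0) and as a Boolean query.\<close>
definition gpc_path_query :: "('a, 'v, 'i, 'd) dgraph \<Rightarrow> (nat \<Rightarrow> 'v) \<Rightarrow> (nat \<Rightarrow> ('a, 'v) path) \<Rightarrow> restrictor \<times> 'a pat \<Rightarrow> bool" where
  "gpc_path_query G \<nu> \<pi> Q \<longleftrightarrow> \<pi> 0 \<in> gpc_ans G Q"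

definition gpc_bool_query :: "('a, 'v, 'i, 'd) dgraph \<Rightarrow> (nat \<Rightarrow> 'v) \<Rightarrow> (nat \<Rightarrow> ('a, 'v) path) \<Rightarrow> restrictor \<times> 'a pat \<Rightarrow> bool" where
  "gpc_bool_query G \<nu> \<pi> Q \<longleftrightarrow> gpc_ans G Q \<noteq> {}"

definition subsumed ::
  "('a, 'v, 'i, 'd) dgraph itself \<Rightarrow>
   'f set \<Rightarrow> (('a, 'v, 'i, 'd) dgraph \<Rightarrow> (nat \<Rightarrow> 'v) \<Rightarrow> (nat \<Rightarrow> ('a, 'v) path) \<Rightarrow> 'f \<Rightarrow> bool) \<Rightarrow>
   'g set \<Rightarrow> (('a, 'v, 'i, 'd) dgraph \<Rightarrow> (nat \<Rightarrow> 'v) \<Rightarrow> (nat \<Rightarrow> ('a, 'v) path) \<Rightarrow> 'g \<Rightarrow> bool) \<Rightarrow> bool" where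
  "subsumed T L1 S1 L2 S2 \<longleftrightarrow>
     (\<forall>\<phi> \<in> L1. \<exists>\<psi> \<in> L2. \<forall>G \<nu> \<pi>. dgraph_wf G \<longrightarrow> valid_asg G \<nu> \<pi> \<longrightarrow> S1 G \<nu> \<pi> \<phi> = S2 G \<nu> \<pi> \<psi>)"

end

theory Submission
  imports Defs
begin

text \<open>Relations definable in \<open>FO\<^sup>*\<close> are closed under Boolean operations, quantification, composition and
  transitive closure, which gives Graph XPath directly. For a unary register automaton, registers are replaced by
  nodes carrying their values; the finite control (state and set of non-empty registers) cannot be coded
  by nodes when the graph has a single node, so it is removed by Kleene's state elimination.

  In walk logic a position is represented by the prefix of the path that ends there, and the atoms become binary
  automata comparing two prefixes.

  A graph pattern is turned into a regular expression over register operations, with one register per variable,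
  which is cleared after each iteration of an enclosing repetition. Such an expression is run by a stack machine with finitely
  many reachable stacks. Between two letters the machine may perform unboundedly many operations, but guards and
  updates compose by substitution and only finitely many of them exist over a fixed set of registers, so all of
  them fit into the single data transition that a register automaton makes per letter.\<close>


section \<open>Relations definable in first-order logic with transitive closure\<close>

text \<open>First-order logic with transitive closure ranges over nodes only, so register values
  need node representatives. An id in a register comes from a visited node, and \<open>ident\<close>
  is injective on nodes, so the node itself can stand for it. A data value is represented by any
  node carrying it; representatives are not unique, which is why updates of configurations are
  stated as relations. Emptiness of a register has no node to stand for it and therefore belongs to
  the control.

  For graph patterns the obstacle is negation in conditions. A condition sees only the bindings of
  its own subpattern, an unbound variable makes an atom false and its negation true, and regular
  expressions offer no complement. Fixing in advance the set \<open>D\<close> of bound variables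
  settles definedness statically; negations can then be pushed down to the atoms. Clearing registers
  after an iteration is sound because \<open>pat_wf\<close> keeps repeated variables out of the rest
  of the pattern, so their registers are empty on entry. The restrictors are the place where a
  pattern needs binary automata: minimality and simplicity compare one path with others.\<close>

definition expresses :: "'a fs \<Rightarrow> nat list \<Rightarrow> (('a, 'v, 'i, 'd) dgraph \<Rightarrow> 'v list \<Rightarrow> bool) \<Rightarrow> bool" where
  "expresses \<phi> xs R \<longleftrightarrow> fs_wf \<phi> \<and> (\<forall>G \<nu> \<pi>. dgraph_wf G \<longrightarrow> range \<nu> \<subseteq> nodes G \<longrightarrow>
     fs_sat G \<nu> \<pi> \<phi> = R G (map \<nu> xs))"

text \<open>Quantifying over all variable lists, repetitions included, lets variables be renamed and
  identified without a substitution operation on formulas.\<close>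

definition definable :: "nat \<Rightarrow> (('a, 'v, 'i, 'd) dgraph \<Rightarrow> 'v list \<Rightarrow> bool) \<Rightarrow> bool" where
  "definable k R \<longleftrightarrow> (\<forall>xs. length xs = k \<longrightarrow> (\<exists>\<phi>. expresses \<phi> xs R))"

lemma definableI: "(\<And>xs. length xs = k \<Longrightarrow> \<exists>\<phi>. expresses \<phi> xs R) \<Longrightarrow> definable k R"
  unfolding definable_def by blast

lemma definableE:
  assumes "definable k R" "length xs = k"
  obtains \<phi> where "fs_wf \<phi>"
    "\<And>G \<nu> \<pi>. dgraph_wf G \<Longrightarrow> range \<nu> \<subseteq> nodes G \<Longrightarrow> fs_sat G \<nu> \<pi> \<phi> = R G (map \<nu> xs)"
  using assms unfolding definable_def expresses_def by blast

text \<open>Only lists of nodes of the right length matter, so a relation may be rewritten between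
  list form and coordinate form under these assumptions.\<close>

lemma definable_cong:
  assumes "definable k R"
    and "\<And>G us. dgraph_wf G \<Longrightarrow> length us = k \<Longrightarrow> set us \<subseteq> nodes G \<Longrightarrow> R G us = R' G us"
  shows "definable k R'"
proof (rule definableI)
  fix xs :: "nat list" assume l: "length xs = k"
  obtain \<phi> where w: "fs_wf \<phi>" and s: "\<And>G \<nu> \<pi>. dgraph_wf G \<Longrightarrow> range \<nu> \<subseteq> nodes G \<Longrightarrow>
      fs_sat G \<nu> \<pi> \<phi> = R G (map \<nu> xs)"
    by (rule definableE[OF assms(1) l]) blast
  have "fs_sat G \<nu> \<pi> \<phi> = R' G (map \<nu> xs)" if "dgraph_wf G" "range \<nu> \<subseteq> nodes G" for G \<nu> \<pi>
    using s[OF that] assms(2)[OF that(1), of "map \<nu> xs"] l that(2) by auto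
  with w show "\<exists>\<phi>. expresses \<phi> xs R'" unfolding expresses_def by blast
qed

lemma definable_not: "definable k R \<Longrightarrow> definable k (\<lambda>G us. \<not> R G us)"
  by (rule definableI, erule definableE, assumption, rule_tac x="SNot \<phi>" in exI) (simp add: expresses_def)

lemma definable_and:
  "definable k R \<Longrightarrow> definable k R' \<Longrightarrow> definable k (\<lambda>G us. R G us \<and> R' G us)"
  by (rule definableI, erule definableE, assumption, erule definableE, assumption,
      rule_tac x="SAnd \<phi> \<phi>'" in exI) (simp add: expresses_def)

lemma definable_or:
  assumes "definable k R" "definable k R'"
  shows "definable k (\<lambda>G us. R G us \<or> R' G us)"
  using definable_not[OF definable_and[OF assms[THEN definable_not]]] by simp

lemma definable_True: "definable k (\<lambda>G us. True)"
  by (rule definableI, rule exI[of _ "SEq 0 0"]) (simp add: expresses_def)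

lemma definable_const: "definable k (\<lambda>G us. b)"
  using definable_True definable_not[OF definable_True] by (cases b) auto

lemma definable_ball:
  assumes "finite A" "\<And>a. a \<in> A \<Longrightarrow> definable k (R a)"
  shows "definable k (\<lambda>G us. \<forall>a\<in>A. R a G us)"
  using assms
  by (induction A rule: finite_induct) (auto intro: definable_True definable_and)

lemma definable_bex:
  assumes "finite A" "\<And>a. a \<in> A \<Longrightarrow> definable k (R a)"
  shows "definable k (\<lambda>G us. \<exists>a\<in>A. R a G us)"
  using definable_not[OF definable_ball[OF assms(1) definable_not[OF assms(2)]]] by simp

text \<open>\<open>f\<close> rearranges variables and \<open>g\<close> rearranges their values in
  the same way, so the formula obtained for \<open>R\<close> at the variables \<open>f xs\<close>
  already serves.\<close>

lemma definable_subst: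
  assumes "definable m R" "\<And>xs :: nat list. length xs = k \<Longrightarrow> length (f xs) = m"
    and "\<And>\<nu> xs. length xs = k \<Longrightarrow> map \<nu> (f xs) = g (map \<nu> xs)"
  shows "definable k (\<lambda>G us. R G (g us))"
proof (rule definableI)
  fix xs :: "nat list" assume l: "length xs = k"
  show "\<exists>\<phi>. expresses \<phi> xs (\<lambda>G us. R G (g us))"
    by (rule definableE[OF assms(1) assms(2)[OF l]], rule_tac x="\<phi>" in exI)
      (simp add: assms(3)[OF l] expresses_def)
qed

lemma definable_nths:
  assumes "definable m R" "length is = m" "\<forall>i\<in>set is. i < k"
  shows "definable k (\<lambda>G us. R G (map (nth us) is))"
  by (rule definable_subst[OF assms(1), of k "\<lambda>us. map (nth us) is"]) (use assms in auto)

lemma definable_edge: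
  assumes "i < k" "j < k" shows "definable k (\<lambda>G us. (us ! i, a, us ! j) \<in> edges G)"
  using assms by (intro definableI, rule_tac x="SE a (xs ! i) (xs ! j)" in exI) (simp add: expresses_def)

lemma definable_eq:
  assumes "i < k" "j < k" shows "definable k (\<lambda>G us. us ! i = us ! j)"
  using assms by (intro definableI, rule_tac x="SEq (xs ! i) (xs ! j)" in exI) (simp add: expresses_def)

lemma definable_data:
  assumes "i < k" "j < k" shows "definable k (\<lambda>G us. dataof G (us ! i) = dataof G (us ! j))"
  using assms by (intro definableI, rule_tac x="SData (xs ! i) (xs ! j)" in exI) (simp add: expresses_def)

text \<open>The quantified node is put at the head: in later uses the witnesses occupy the low
  indices and the parameters are shifted up.\<close>

lemma definable_ex:
  assumes "definable (Suc k) R"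
  shows "definable k (\<lambda>G us. \<exists>v\<in>nodes G. R G (v # us))"
proof (rule definableI)
  fix xs :: "nat list" assume l: "length xs = k"
  obtain x where x: "x \<notin> set xs" using ex_new_if_finite[OF infinite_UNIV_nat] by blast
  have "length (x # xs) = Suc k" using l by simp
  from assms this obtain \<phi> where w: "fs_wf \<phi>" and s: "\<And>G \<nu> \<pi>. dgraph_wf G \<Longrightarrow> range \<nu> \<subseteq> nodes G \<Longrightarrow>
      fs_sat G \<nu> \<pi> \<phi> = R G (map \<nu> (x # xs))"
    by (rule definableE) blast
  have "fs_sat G \<nu> \<pi> (SEx x \<phi>) = (\<exists>v\<in>nodes G. R G (v # map \<nu> xs))"
    if G: "dgraph_wf G" and n: "range \<nu> \<subseteq> nodes G" for G \<nu> \<pi>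
  proof -
    have "fs_sat G (\<nu>(x := v)) \<pi> \<phi> = R G (v # map \<nu> xs)" if "v \<in> nodes G" for v
    proof -
      have "range (\<nu>(x := v)) \<subseteq> nodes G" using n that by auto
      moreover have "map (\<nu>(x := v)) (x # xs) = v # map \<nu> xs" using x by auto
      ultimately show ?thesis using s[OF G] by metis
    qed
    then show ?thesis by auto
  qed
  with w show "\<exists>\<phi>. expresses \<phi> xs (\<lambda>G us. \<exists>v\<in>nodes G. R G (v # us))"
    by (intro exI[of _ "SEx x \<phi>"]) (simp add: expresses_def)
qed

lemma definable_exs:
  assumes "definable (m + k) R"
  shows "definable k (\<lambda>G us. \<exists>vs. length vs = m \<and> set vs \<subseteq> nodes G \<and> R G (vs @ us))"
  using assms
proof (induction m arbitrary: R)
  case 0 then show ?case by simp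
next
  case (Suc m)
  have "definable (m + k) (\<lambda>G us. \<exists>v\<in>nodes G. R G (v # us))"
    using Suc.prems by (intro definable_ex) simp
  from Suc.IH[OF this] show ?case
  proof (rule definable_cong, goal_cases)
    case (1 G us)
    show ?case (is "?l = ?r")
    proof
      assume ?l
      then obtain vs v where "length vs = m" "set vs \<subseteq> nodes G" "v \<in> nodes G" "R G (v # vs @ us)"
        by blast
      then show ?r by (intro exI[of _ "v # vs"]) auto
    next
      assume ?r
      then obtain v vs where "length vs = m" "set (v # vs) \<subseteq> nodes G" "R G ((v # vs) @ us)"
        by (metis length_Suc_conv)
      then show ?l by (intro exI[of _ "vs"]) auto
    qed
  qed
qed

lemma map_updl:
  "distinct xs \<Longrightarrow> length us = length xs \<Longrightarrow> map (updl \<nu> xs us) xs = us"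
  "x \<notin> set xs \<Longrightarrow> updl \<nu> xs us x = \<nu> x"
  "range \<nu> \<subseteq> S \<Longrightarrow> set us \<subseteq> S \<Longrightarrow> range (updl \<nu> xs us) \<subseteq> S"
proof -
  show o: "x \<notin> set xs \<Longrightarrow> updl \<nu> xs us x = \<nu> x" for \<nu> :: "nat \<Rightarrow> 'b" and xs us x
    by (induction \<nu> xs us rule: updl.induct) auto
  show "distinct xs \<Longrightarrow> length us = length xs \<Longrightarrow> map (updl \<nu> xs us) xs = us"
    by (induction \<nu> xs us rule: updl.induct) (auto simp: o)
  show "range \<nu> \<subseteq> S \<Longrightarrow> set us \<subseteq> S \<Longrightarrow> range (updl \<nu> xs us) \<subseteq> S"
  proof (induction \<nu> xs us rule: updl.induct)
    case (1 \<nu> x xs u us)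
    have "range (\<nu>(x := u)) \<subseteq> S" "set us \<subseteq> S" using 1(2,3) by auto
    from 1(1)[OF this] show ?case by (simp only: updl.simps)
  qed auto
qed

section \<open>Binary relations between node tuples and their closure\<close>

definition tuples :: "nat \<Rightarrow> ('a, 'v, 'i, 'd) dgraph \<Rightarrow> 'v list set" where
  "tuples k G = {us. length us = k \<and> set us \<subseteq> nodes G}"

text \<open>Pairs of tuples are coded as one tuple of double length. Containment in node tuples is
  demanded because quantifiers range over nodes: a composition can then quantify over the middle
  tuple, and a closure stays among tuples that \<open>SStar\<close> can visit.\<close>

definition definable2 :: "nat \<Rightarrow> (('a, 'v, 'i, 'd) dgraph \<Rightarrow> ('v list \<times> 'v list) set) \<Rightarrow> bool" where
  "definable2 k X \<longleftrightarrow> (\<forall>G. dgraph_wf G \<longrightarrow> X G \<subseteq> tuples k G \<times> tuples k G) \<and>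
     definable (k + k) (\<lambda>G us. (take k us, drop k us) \<in> X G)"

lemma definable2_Un:
  assumes "definable2 k X" "definable2 k Y"
  shows "definable2 k (\<lambda>G. X G \<union> Y G)"
  using assms unfolding definable2_def by (auto intro: definable_or)

lemma definable2_comp:
  assumes X: "definable2 k X" and Y: "definable2 k Y"
  shows "definable2 k (\<lambda>G. X G O Y G)"
proof -
  \<comment> \<open>The middle tuple will be quantified by \<open>definable_exs\<close>, which puts
    it in front, so the combined list is middle, left, right. The two rearrangements extract
    left-middle and middle-right.\<close>
  have "definable (k + (k + k)) (\<lambda>G us. (\<lambda>G us. (take k us, drop k us) \<in> X G) G
      ((\<lambda>us. take k (drop k us) @ take k us) us))"
    using X unfolding definable2_def
    by (intro definable_subst[where f = "\<lambda>us. take k (drop k us) @ take k us" and m = "k + k"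
        and R = "\<lambda>G us. (take k us, drop k us) \<in> X G" and g = "\<lambda>us. take k (drop k us) @ take k us"])
      (simp_all add: take_map drop_map)
  moreover have "definable (k + (k + k)) (\<lambda>G us. (\<lambda>G us. (take k us, drop k us) \<in> Y G) G
      ((\<lambda>us. take k us @ drop k (drop k us)) us))"
    using Y unfolding definable2_def
    by (intro definable_subst[where f = "\<lambda>us. take k us @ drop k (drop k us)" and m = "k + k"
        and R = "\<lambda>G us. (take k us, drop k us) \<in> Y G" and g = "\<lambda>us. take k us @ drop k (drop k us)"])
      (simp_all add: take_map drop_map del: drop_drop)
  ultimately have "definable (k + k) (\<lambda>G us. \<exists>vs. length vs = k \<and> set vs \<subseteq> nodes G \<and>
      (\<lambda>G us. (take k (take k (drop k us) @ take k us), drop k (take k (drop k us) @ take k us)) \<in> X G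
        \<and> (take k (take k us @ drop k (drop k us)), drop k (take k us @ drop k (drop k us))) \<in> Y G) G (vs @ us))"
    by (intro definable_exs definable_and) auto
  then have "definable (k + k) (\<lambda>G us. (take k us, drop k us) \<in> X G O Y G)"
  proof (rule definable_cong, goal_cases)
    case (1 G us)
    with X show ?case
      unfolding definable2_def tuples_def by fastforce
  qed
  then show ?thesis using X Y unfolding definable2_def by blast
qed

text \<open>\<open>SStar\<close> binds pairwise distinct variables of its own, whereas
  \<open>xs\<close> may contain repetitions. The closure is therefore formed on fresh variables
  \<open>zs\<close> and \<open>ys\<close>, which are equated with \<open>xs\<close> and then
  quantified away.\<close>

lemma definable_rtrancl:
  assumes X: "definable2 k X"
  shows "definable (k + k) (\<lambda>G us. (take k us, drop k us) \<in> (X G)\<^sup>*)"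
proof (rule definableI)
  fix xs :: "nat list" assume l: "length xs = k + k"
  obtain N where N: "\<forall>x\<in>set xs. x < N" using finite_nat_set_iff_bounded by blast
  define zs where "zs = [N..<N + k]"
  define ys where "ys = [N + k..<N + k + k]"
  have len: "length zs = k" "length ys = k" "distinct (zs @ ys)" "set xs \<inter> set (zs @ ys) = {}"
    unfolding zs_def ys_def using N by auto
  from X have "definable (k + k) (\<lambda>G us. (take k us, drop k us) \<in> X G)"
    by (simp add: definable2_def)
  then obtain \<phi> where w: "fs_wf \<phi>" and s: "\<And>G \<nu> \<pi>. dgraph_wf G \<Longrightarrow> range \<nu> \<subseteq> nodes G \<Longrightarrow>
      fs_sat G \<nu> \<pi> \<phi> = ((take k (map \<nu> (zs @ ys)), drop k (map \<nu> (zs @ ys))) \<in> X G)"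
    using len by (elim definableE[of _ _ "zs @ ys"]) auto
  have star: "fs_sat G \<nu> \<pi> (SStar zs ys \<phi>) = ((map \<nu> zs, map \<nu> ys) \<in> (X G)\<^sup>*)"
    if G: "dgraph_wf G" and n: "range \<nu> \<subseteq> nodes G" for G \<nu> \<pi>
  proof -
    \<comment> \<open>The step relation of \<open>SStar\<close> equals \<open>X G\<close> on all
      pairs of lists: outside the node tuples both fail, by the containment in
      \<open>definable2\<close>. Hence the closures agree as well.\<close>
    have "(length us = k \<and> length us' = k \<and> set us \<subseteq> nodes G \<and> set us' \<subseteq> nodes G \<and>
        fs_sat G (updl (updl \<nu> zs us) ys us') \<pi> \<phi>) = ((us, us') \<in> X G)" for us us'
    proof (cases "us \<in> tuples k G \<and> us' \<in> tuples k G")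
      case True
      have "map (updl (updl \<nu> zs us) ys us') zs = map (updl \<nu> zs us) zs"
        using len by (intro map_cong refl map_updl(2)) auto
      also have "\<dots> = us" using True len by (intro map_updl(1)) (auto simp: tuples_def)
      finally have m: "map (updl (updl \<nu> zs us) ys us') (zs @ ys) = us @ us'"
        using True len by (auto simp: map_updl tuples_def)
      have "range (updl (updl \<nu> zs us) ys us') \<subseteq> nodes G"
        using True n by (intro map_updl) (auto simp: tuples_def)
      from s[OF G this, unfolded m] show ?thesis using True by (auto simp: tuples_def)
    next
      case False
      then have "(us, us') \<notin> X G" using X G unfolding definable2_def by blast
      then show ?thesis using False by (auto simp: tuples_def)
    qed
    then show ?thesis using len by (simp add: Enum.rtranclp_rtrancl_eq)
  qed
  define E where "E = foldr (\<lambda>(x, z) \<phi>. SAnd (SEq x z) \<phi>) (zip xs (zs @ ys)) (SStar zs ys \<phi>)"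
  define \<Psi> where "\<Psi> = foldr SEx (zs @ ys) E"
  have wE: "fs_wf (foldr (\<lambda>(x, z) \<phi>. SAnd (SEq x z) \<phi>) ps \<psi>) = fs_wf \<psi>" for ps and \<psi> :: "'a fs"
    by (induction ps) auto
  have wX: "fs_wf (foldr SEx ps \<psi>) = fs_wf \<psi>" for ps and \<psi> :: "'a fs"
    by (induction ps) auto
  have sE: "fs_sat G \<nu> \<pi> (foldr (\<lambda>(x, z) \<phi>. SAnd (SEq x z) \<phi>) ps \<psi>)
      = ((\<forall>(x,z)\<in>set ps. \<nu> x = \<nu> z) \<and> fs_sat G \<nu> \<pi> \<psi>)" for ps \<psi> and G :: "('a, 'b, 'c, 'd) dgraph" and \<nu> \<pi>
    by (induction ps) auto
  have sX: "fs_sat G \<nu> \<pi> (foldr SEx ps \<psi>) = (\<exists>us. length us = length ps \<and> set us \<subseteq> nodes G \<and>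
      fs_sat G (updl \<nu> ps us) \<pi> \<psi>)" for ps \<psi> and G :: "('a, 'b, 'c, 'd) dgraph" and \<nu> \<pi>
  proof (induction ps arbitrary: \<nu>)
    case Nil then show ?case by simp
  next
    case (Cons p ps)
    show ?case (is "?l = ?r")
    proof
      assume ?l
      then obtain v us where "v \<in> nodes G" "length us = length ps" "set us \<subseteq> nodes G"
        "fs_sat G (updl (\<nu>(p := v)) ps us) \<pi> \<psi>"
        using Cons by (auto simp del: fun_upd_apply)
      then show ?r by (intro exI[of _ "v # us"]) (auto simp del: fun_upd_apply)
    next
      assume ?r
      then obtain v us where "v \<in> nodes G" "length us = length ps" "set us \<subseteq> nodes G"
        "fs_sat G (updl (\<nu>(p := v)) ps us) \<pi> \<psi>"
        by (fastforce simp: length_Suc_conv simp del: fun_upd_apply)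
      then show ?l using Cons by (auto simp del: fun_upd_apply)
    qed
  qed
  have zip_eq: "(\<forall>(x,z)\<in>set (zip as bs). f x = f z) \<longleftrightarrow> map f as = map f bs"
    if "length as = length bs" for as bs :: "nat list" and f :: "nat \<Rightarrow> 'b"
    using that by (induction as bs rule: list_induct2) auto
  have "fs_wf \<Psi>" unfolding \<Psi>_def E_def wE wX using w len by simp
  moreover have "fs_sat G \<nu> \<pi> \<Psi> = ((take k (map \<nu> xs), drop k (map \<nu> xs)) \<in> (X G)\<^sup>*)"
    if G: "dgraph_wf G" and n: "range \<nu> \<subseteq> nodes G" for G \<nu> \<pi>
  proof -
    have "fs_sat G (updl \<nu> (zs @ ys) us) \<pi> E \<longleftrightarrow> us = map \<nu> xs \<and> (take k us, drop k us) \<in> (X G)\<^sup>*"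
      if us: "length us = k + k" "set us \<subseteq> nodes G" for us
    proof -
      let ?n = "updl \<nu> (zs @ ys) us"
      have m: "map ?n (zs @ ys) = us" using len us by (intro map_updl) auto
      have m1: "map ?n xs = map \<nu> xs" using len by (intro map_cong refl map_updl(2)) auto
      have "(\<forall>(x,z)\<in>set (zip xs (zs @ ys)). ?n x = ?n z) \<longleftrightarrow> map ?n xs = map ?n (zs @ ys)"
        using l len by (intro zip_eq) simp
      then have e: "(\<forall>(x,z)\<in>set (zip xs (zs @ ys)). ?n x = ?n z) \<longleftrightarrow> us = map \<nu> xs"
        unfolding m m1 by auto
      have m2: "map ?n zs = take k us" "map ?n ys = drop k us"
        using arg_cong[OF m, of "take k"] arg_cong[OF m, of "drop k"] len us by simp_all
      have "range ?n \<subseteq> nodes G" using n us by (intro map_updl) auto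
      from star[OF G this] show ?thesis unfolding E_def sE e m2 by simp
    qed
    moreover have "set (map \<nu> xs) \<subseteq> nodes G" "length (map \<nu> xs) = k + k" using n l by auto
    moreover have "length (zs @ ys) = k + k" using len by simp
    ultimately show ?thesis unfolding \<Psi>_def sX by (simp only:) blast
  qed
  ultimately show "\<exists>\<phi>. expresses \<phi> xs (\<lambda>G us. (take k us, drop k us) \<in> (X G)\<^sup>*)"
    unfolding expresses_def by blast
qed

text \<open>The plain reflexive transitive closure relates every list to itself and so leaves the
  node tuples; the identity is cut down to them to stay within \<open>definable2\<close>.\<close>

lemma definable2_rtrancl:
  assumes X: "definable2 k X"
  shows "definable2 k (\<lambda>G. Id_on (tuples k G) \<union> (X G)\<^sup>+)"
proof -
  have *: "(X G)\<^sup>+ \<subseteq> tuples k G \<times> tuples k G" if "dgraph_wf G" for G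
    using X that unfolding definable2_def by (intro trancl_subset_Sigma) auto
  have "definable (k + k) (\<lambda>G us. (take k us, drop k us) \<in> Id_on (tuples k G) \<union> (X G)\<^sup>+)"
    using definable_rtrancl[OF X]
  proof (rule definable_cong, goal_cases)
    case (1 G us)
    then have "take k us \<in> tuples k G"
      by (auto simp: tuples_def dest: in_set_takeD)
    then show ?case
      by (auto simp: rtrancl_eq_or_trancl)
  qed
  then show ?thesis using * unfolding definable2_def by auto
qed

section \<open>Graph XPath\<close>

lemma gx_within_nodes:
  assumes "dgraph_wf G"
  shows "gx_node G \<phi> \<subseteq> nodes G" "gx_path G \<alpha> \<subseteq> nodes G \<times> nodes G"
proof (induction \<phi> and \<alpha>)
  case (GStar \<alpha>)
  then have "(gx_path G \<alpha>)\<^sup>+ \<subseteq> nodes G \<times> nodes G" by (intro trancl_subset_Sigma)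
  then show ?case by auto
qed (use assms in \<open>auto simp: dgraph_wf_def\<close>)

lemma gx_path_target: "dgraph_wf G \<Longrightarrow> (u, v) \<in> gx_path G \<alpha> \<Longrightarrow> v \<in> nodes G"
  using gx_within_nodes(2) by fast

text \<open>Closures are definable on tuples, while \<open>GStar\<close> iterates a relation on
  nodes; \<open>f\<close> will send a node to its singleton list. Everything reached from
  \<open>f a\<close> lies in the range of \<open>f\<close>, so \<open>inv f\<close> pulls a chain
  back.\<close>

lemma trancl_map_prod_inj:
  assumes "inj f"
  shows "(f a, f b) \<in> (map_prod f f ` P)\<^sup>+ \<longleftrightarrow> (a, b) \<in> P\<^sup>+"
proof
  have "y \<in> range f \<and> (a, inv f y) \<in> P\<^sup>+" if "(f a, y) \<in> (map_prod f f ` P)\<^sup>+" for y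
    using that
  proof (induction rule: trancl_induct)
    case (base y) then show ?case by (auto simp: inv_f_f[OF assms] dest: injD[OF assms])
  next
    case (step y z) then show ?case by (auto simp: inv_f_f[OF assms] intro: trancl_into_trancl)
  qed
  from this[of "f b"] show "(f a, f b) \<in> (map_prod f f ` P)\<^sup>+ \<Longrightarrow> (a, b) \<in> P\<^sup>+"
    by (simp add: inv_f_f[OF assms])
  show "(a, b) \<in> P\<^sup>+ \<Longrightarrow> (f a, f b) \<in> (map_prod f f ` P)\<^sup>+"
    by (induction rule: trancl_induct) (force intro: trancl_into_trancl)+
qed

lemma definable_pair:
  assumes "definable 2 (\<lambda>G us. (us ! 0, us ! 1) \<in> P G)" "i < k" "j < k"
  shows "definable k (\<lambda>G us. (us ! i, us ! j) \<in> P G)"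
  using definable_nths[OF assms(1), of "[i, j]" k] assms by simp

text \<open>Mutual induction along the syntax. Finiteness of the alphabet turns the unlabelled step
  \<open>GAny\<close> into a finite disjunction over labels.\<close>

lemma definable_gx:
  assumes fin: "finite (UNIV :: 'a set)"
  shows "definable 1 (\<lambda>(G :: ('a, 'v, 'i, 'd) dgraph) us. us ! 0 \<in> gx_node G \<phi>)"
    and "definable 2 (\<lambda>(G :: ('a, 'v, 'i, 'd) dgraph) us. (us ! 0, us ! 1) \<in> gx_path G \<alpha>)"
proof (induction \<phi> and \<alpha>)
  case GTop
  show ?case by (rule definable_cong[OF definable_True]) auto
next
  case (GNot \<phi>)
  show ?case by (rule definable_cong[OF definable_not[OF GNot]]) auto
next
  case (GAnd \<phi> \<psi>)
  show ?case by (rule definable_cong[OF definable_and[OF GAnd]]) auto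
next
  case (GDia \<alpha>)
  \<comment> \<open>Indices count from the head, where the quantified end node will stand: 0 is the
    witness, 1 the node tested.\<close>
  have "definable (Suc 1) (\<lambda>(G :: ('a, 'v, 'i, 'd) dgraph) us. (us ! 1, us ! 0) \<in> gx_path G \<alpha>)"
    by (intro definable_pair[OF GDia]) auto
  from definable_ex[OF this] show ?case
    by (rule definable_cong) (auto dest: gx_path_target)
next
  case (GDEq \<alpha> \<beta>)
  \<comment> \<open>With two quantifiers, 2 is the source, and 1 and 0 are the ends reached by
    \<open>\<alpha>\<close> and \<open>\<beta>\<close>.\<close>
  have "definable (Suc (Suc 1)) (\<lambda>(G :: ('a, 'v, 'i, 'd) dgraph) us. (us ! 2, us ! 1) \<in> gx_path G \<alpha> \<and>
      (us ! 2, us ! 0) \<in> gx_path G \<beta> \<and> dataof G (us ! 1) = dataof G (us ! 0))"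
    by (intro definable_and definable_data definable_pair[OF GDEq(1)] definable_pair[OF GDEq(2)]) auto
  from definable_ex[OF definable_ex[OF this]] show ?case
    by (rule definable_cong) (auto dest: gx_path_target)
next
  case (GDNeq \<alpha> \<beta>)
  have "definable (Suc (Suc 1)) (\<lambda>(G :: ('a, 'v, 'i, 'd) dgraph) us. (us ! 2, us ! 1) \<in> gx_path G \<alpha> \<and>
      (us ! 2, us ! 0) \<in> gx_path G \<beta> \<and> dataof G (us ! 1) \<noteq> dataof G (us ! 0))"
    by (intro definable_and definable_not definable_data
        definable_pair[OF GDNeq(1)] definable_pair[OF GDNeq(2)]) auto
  from definable_ex[OF definable_ex[OF this]] show ?case
    by (rule definable_cong) (auto dest: gx_path_target)
next
  case GEps
  have "definable 2 (\<lambda>(G :: ('a, 'v, 'i, 'd) dgraph) us. us ! 0 = us ! 1)"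
    by (rule definable_eq) auto
  then show ?case by (rule definable_cong) (auto simp: numeral_2_eq_2 length_Suc_conv)
next
  case GAny
  have "definable 2 (\<lambda>(G :: ('a, 'v, 'i, 'd) dgraph) us. \<exists>a\<in>UNIV. (us ! 0, a, us ! 1) \<in> edges G)"
    by (intro definable_bex fin definable_edge) auto
  then show ?case by simp
next
  case (GLab a)
  have "definable 2 (\<lambda>(G :: ('a, 'v, 'i, 'd) dgraph) us. (us ! 0, a, us ! 1) \<in> edges G)"
    by (rule definable_edge) auto
  then show ?case by simp
next
  case (GInv a)
  have "definable 2 (\<lambda>(G :: ('a, 'v, 'i, 'd) dgraph) us. (us ! 1, a, us ! 0) \<in> edges G)"
    by (rule definable_edge) auto
  then show ?case by simp
next
  case (GTest \<phi>)
  from definable_nths[OF GTest, of "[0]" 2]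
  have "definable 2 (\<lambda>(G :: ('a, 'v, 'i, 'd) dgraph) us. us ! 0 = us ! 1 \<and> us ! 0 \<in> gx_node G \<phi>)"
    by (intro definable_and definable_eq) auto
  then show ?case by (rule definable_cong) (auto simp: numeral_2_eq_2 length_Suc_conv)
next
  case (GComp \<alpha> \<beta>)
  have "definable (Suc 2) (\<lambda>(G :: ('a, 'v, 'i, 'd) dgraph) us. (us ! 1, us ! 0) \<in> gx_path G \<alpha> \<and>
      (us ! 0, us ! 2) \<in> gx_path G \<beta>)"
    by (intro definable_and definable_pair[OF GComp(1)] definable_pair[OF GComp(2)]) auto
  from definable_ex[OF this] show ?case
    by (rule definable_cong) (auto simp: numeral_eq_Suc dest: gx_path_target)
next
  case (GUn \<alpha> \<beta>)
  from definable_or[OF this] show ?case by simp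
next
  case (GCompl \<alpha>)
  show ?case by (rule definable_cong[OF definable_not[OF GCompl]]) (auto simp: numeral_2_eq_2 length_Suc_conv)
next
  case (GStar \<alpha>)
  \<comment> \<open>Nodes become singleton lists, so that the closure of a binary relation is the
    case \<open>k = 1\<close> of \<open>definable_rtrancl\<close>.\<close>
  define X where "X = (\<lambda>G :: ('a, 'v, 'i, 'd) dgraph. map_prod (\<lambda>x. [x]) (\<lambda>x. [x]) ` gx_path G \<alpha>)"
  have X: "([a], [b]) \<in> X G \<longleftrightarrow> (a, b) \<in> gx_path G \<alpha>"
     "([a], [b]) \<in> (X G)\<^sup>* \<longleftrightarrow> a = b \<or> (a, b) \<in> (gx_path G \<alpha>)\<^sup>+" for a b G
    using trancl_map_prod_inj[of "\<lambda>x. [x]" a b "gx_path G \<alpha>"]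
    by (auto simp: X_def inj_def rtrancl_eq_or_trancl)
  have s: "take 1 us = [us ! 0]" "drop 1 us = [us ! 1]" if "length us = 1 + 1" for us :: "'v list"
    using that by (auto simp: length_Suc_conv numeral_eq_Suc)
  have "definable2 1 X" unfolding definable2_def
  proof
    show "\<forall>G. dgraph_wf G \<longrightarrow> X G \<subseteq> tuples 1 G \<times> tuples 1 G"
      using gx_within_nodes(2) unfolding X_def tuples_def by fastforce
    show "definable (1 + 1) (\<lambda>G us. (take 1 us, drop 1 us) \<in> X G)"
      by (rule definable_cong[of "1 + 1", OF GStar[unfolded one_add_one[symmetric]]]) (simp only: s X)
  qed
  from definable_rtrancl[OF this] show ?case unfolding one_add_one[symmetric]
  proof (rule definable_cong)
    fix G :: "('a, 'v, 'i, 'd) dgraph" and us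
    assume "length us = 1 + 1" "set us \<subseteq> nodes G"
    then show "((take 1 us, drop 1 us) \<in> (X G)\<^sup>*) = ((us ! 0, us ! 1) \<in> gx_path G (GStar \<alpha>))"
      unfolding s[OF \<open>length us = 1 + 1\<close>] X by (auto simp: Id_on_def length_Suc_conv)
  qed
next
  case (GPEq \<alpha>)
  have "definable 2 (\<lambda>(G :: ('a, 'v, 'i, 'd) dgraph) us. (us ! 0, us ! 1) \<in> gx_path G \<alpha> \<and> dataof G (us ! 0) = dataof G (us ! 1))"
    by (intro definable_and GPEq definable_data) auto
  then show ?case by simp
next
  case (GPNeq \<alpha>)
  have "definable 2 (\<lambda>(G :: ('a, 'v, 'i, 'd) dgraph) us. (us ! 0, us ! 1) \<in> gx_path G \<alpha> \<and> dataof G (us ! 0) \<noteq> dataof G (us ! 1))"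
    by (intro definable_and definable_not GPNeq definable_data) auto
  then show ?case by simp
qed

lemma subsumed_FOstarI:
  assumes "\<And>\<phi>. \<phi> \<in> L \<Longrightarrow> \<exists>k R xs. length xs = k \<and> definable k R \<and>
     (\<forall>G \<nu> \<pi>. dgraph_wf G \<longrightarrow> valid_asg G \<nu> \<pi> \<longrightarrow> S G \<nu> \<pi> \<phi> = R G (map \<nu> xs))"
  shows "subsumed TYPE(('a, 'v, 'i, 'd) dgraph) L S FOstar fs_sat"
  unfolding subsumed_def FOstar_def
proof
  fix \<phi> assume "\<phi> \<in> L"
  from assms[OF this] obtain k R xs where l: "length xs = k" and d: "definable k R" and
    s: "\<And>G \<nu> \<pi>. dgraph_wf G \<Longrightarrow> valid_asg G \<nu> \<pi> \<Longrightarrow> S G \<nu> \<pi> \<phi> = R G (map \<nu> xs)" by blast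
  obtain \<psi> where "fs_wf \<psi>" "\<And>G \<nu> \<pi>. dgraph_wf G \<Longrightarrow> range \<nu> \<subseteq> nodes G \<Longrightarrow> fs_sat G \<nu> \<pi> \<psi> = R G (map \<nu> xs)"
    by (rule definableE[OF d l]) blast
  with s show "\<exists>\<psi>\<in>{\<phi>. fs_wf \<phi>}. \<forall>G \<nu> \<pi>. dgraph_wf G \<longrightarrow> valid_asg G \<nu> \<pi> \<longrightarrow> S G \<nu> \<pi> \<phi> = fs_sat G \<nu> \<pi> \<psi>"
    by (intro bexI[of _ \<psi>]) (auto simp: valid_asg_def image_subset_iff)
qed

lemma gx_subsumed_FOstar:
  assumes "finite (UNIV :: 'a set)"
  shows "subsumed TYPE(('a, 'v, 'i, 'd) dgraph) UNIV gx_node_query FOstar fs_sat"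
    "subsumed TYPE(('a, 'v, 'i, 'd) dgraph) UNIV gx_path_query FOstar fs_sat"
proof -
  show "subsumed TYPE(('a, 'v, 'i, 'd) dgraph) UNIV gx_node_query FOstar fs_sat"
  proof (rule subsumed_FOstarI)
    fix \<phi> :: "'a gxn"
    show "\<exists>k R xs. length xs = k \<and> definable k R \<and> (\<forall>(G :: ('a, 'v, 'i, 'd) dgraph) \<nu> \<pi>.
        dgraph_wf G \<longrightarrow> valid_asg G \<nu> \<pi> \<longrightarrow> gx_node_query G \<nu> \<pi> \<phi> = R G (map \<nu> xs))"
      using definable_gx(1)[OF assms]
      by (intro exI[of _ 1] exI[of _ "\<lambda>G us. us ! 0 \<in> gx_node G \<phi>"] exI[of _ "[0]"])
        (simp add: gx_node_query_def)
  qed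
  show "subsumed TYPE(('a, 'v, 'i, 'd) dgraph) UNIV gx_path_query FOstar fs_sat"
  proof (rule subsumed_FOstarI)
    fix \<alpha> :: "'a gxp"
    show "\<exists>k R xs. length xs = k \<and> definable k R \<and> (\<forall>(G :: ('a, 'v, 'i, 'd) dgraph) \<nu> \<pi>.
        dgraph_wf G \<longrightarrow> valid_asg G \<nu> \<pi> \<longrightarrow> gx_path_query G \<nu> \<pi> \<alpha> = R G (map \<nu> xs))"
      using definable_gx(2)[OF assms]
      by (intro exI[of _ 2] exI[of _ "\<lambda>G us. (us ! 0, us ! 1) \<in> gx_path G \<alpha>"] exI[of _ "[0, 1]"])
        (simp add: gx_path_query_def)
  qed
qed

section \<open>Eliminating control states\<close>

text \<open>Kleene's recursion: \<open>via R S c c'\<close> relates data of runs from control \<open>c\<close> to control \<open>c'\<close>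
  whose intermediate controls lie in \<open>S\<close>.\<close>

fun via :: "('c \<Rightarrow> 'c \<Rightarrow> ('x \<times> 'x) set) \<Rightarrow> 'c list \<Rightarrow> 'c \<Rightarrow> 'c \<Rightarrow> ('x \<times> 'x) set" where
  "via R [] c c' = R c c'"
| "via R (s # S) c c' = via R S c c' \<union> via R S c s O (via R S s s)\<^sup>* O via R S s c'"

lemma via_base: "R c c' \<subseteq> via R S c c'"
  by (induction S) auto

lemma via_comp: "s \<in> set S \<Longrightarrow> via R S c s O via R S s c' \<subseteq> via R S c c'"
proof (induction S arbitrary: c c' s)
  case Nil then show ?case by simp
next
  case (Cons z S)
  let ?v = "via R S"
  have star: "x \<in> (?v z z)\<^sup>* O ?v z z O (?v z z)\<^sup>* \<Longrightarrow> x \<in> (?v z z)\<^sup>*" for x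
    by (auto intro: rtrancl_trans rtrancl_into_rtrancl)
  show ?case
  proof (cases "s = z")
    case True
    have "via R (z # S) c z \<subseteq> ?v c z O (?v z z)\<^sup>*" "via R (z # S) z c' \<subseteq> (?v z z)\<^sup>* O ?v z c'"
      by (auto intro: rtrancl_into_rtrancl r_into_rtrancl converse_rtrancl_into_rtrancl)
    then have "via R (z # S) c z O via R (z # S) z c' \<subseteq> (?v c z O (?v z z)\<^sup>*) O (?v z z)\<^sup>* O ?v z c'"
      by (rule relcomp_mono)
    also have "\<dots> = ?v c z O ((?v z z)\<^sup>* O (?v z z)\<^sup>*) O ?v z c'" by (simp only: O_assoc)
    also have "\<dots> = ?v c z O (?v z z)\<^sup>* O ?v z c'" by (simp only: rtrancl_idemp_self_comp)
    also have "\<dots> \<subseteq> via R (z # S) c c'" by simp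
    finally show ?thesis unfolding True .
  next
    case False
    with Cons.prems have s: "s \<in> set S" by simp
    note IH = Cons.IH[OF s]
    have 1: "?v c s O ?v s c' \<subseteq> ?v c c'" by (rule IH)
    have 2: "?v c s O (?v s z O (?v z z)\<^sup>* O ?v z c') \<subseteq> ?v c z O (?v z z)\<^sup>* O ?v z c'"
      using IH[of c z] by blast
    have 3: "(?v c z O (?v z z)\<^sup>* O ?v z s) O ?v s c' \<subseteq> ?v c z O (?v z z)\<^sup>* O ?v z c'"
      using IH[of z c'] by blast
    have 4: "(?v c z O (?v z z)\<^sup>* O ?v z s) O (?v s z O (?v z z)\<^sup>* O ?v z c') \<subseteq> ?v c z O (?v z z)\<^sup>* O ?v z c'"
    proof -
      have "(?v c z O (?v z z)\<^sup>* O ?v z s) O (?v s z O (?v z z)\<^sup>* O ?v z c')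
        \<subseteq> ?v c z O ((?v z z)\<^sup>* O ?v z z O (?v z z)\<^sup>*) O ?v z c'"
        using IH[of z z] by blast
      also have "\<dots> \<subseteq> ?v c z O (?v z z)\<^sup>* O ?v z c'" using star by blast
      finally show ?thesis .
    qed
    from 1 2 3 4 show ?thesis unfolding via.simps by (simp only: relcomp_distrib relcomp_distrib2) blast
  qed
qed

definition control_graph :: "('c \<Rightarrow> 'c \<Rightarrow> ('x \<times> 'x) set) \<Rightarrow> (('c \<times> 'x) \<times> ('c \<times> 'x)) set" where
  "control_graph R = {((c, x), (c', y)). (x, y) \<in> R c c'}"

lemma via_sound: "(x, y) \<in> via R S c c' \<Longrightarrow> ((c, x), (c', y)) \<in> (control_graph R)\<^sup>+"
proof (induction S arbitrary: c c' x y)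
  case Nil then show ?case by (auto simp: control_graph_def)
next
  case (Cons s S)
  have star: "((s, x), (s, y)) \<in> (control_graph R)\<^sup>*" if "(x, y) \<in> (via R S s s)\<^sup>*" for x y
    using that by (induction rule: rtrancl_induct) (auto dest: Cons.IH intro: rtrancl_trans trancl_into_rtrancl)
  show ?case using Cons.prems
    by (auto intro: Cons.IH dest!: star Cons.IH dest: rtrancl_trancl_trancl trancl_trans)
qed

text \<open>Every control entered by a step lies in \<open>S\<close>, so a run can be extended one
  step at a time: the control reached so far is a legitimate intermediate one, and
  \<open>via_comp\<close> composes through it.\<close>

lemma via_complete:
  assumes "((c, x), (c', y)) \<in> (control_graph R)\<^sup>+" and "\<And>c c'. R c c' \<noteq> {} \<Longrightarrow> c' \<in> set S"
  shows "(x, y) \<in> via R S c c'"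
proof -
  have "(x, snd z) \<in> via R S c (fst z) \<and> fst z \<in> set S" if "((c, x), z) \<in> (control_graph R)\<^sup>+" for z
    using that
  proof (induction rule: trancl_induct)
    case (base z)
    then have "(x, snd z) \<in> R c (fst z)" by (auto simp: control_graph_def)
    then show ?case using via_base[of R c "fst z" S] assms(2)[of c "fst z"] by blast
  next
    case (step z z')
    then have "(snd z, snd z') \<in> R (fst z) (fst z')" by (auto simp: control_graph_def)
    then show ?case using step.IH via_base[of R "fst z" "fst z'" S] assms(2)[of "fst z" "fst z'"]
        via_comp[of "fst z" S R c "fst z'"] by blast
  qed
  from this[OF assms(1)] show ?thesis by simp
qed

lemma definable2_cong:
  assumes "definable2 k X" "\<And>G. dgraph_wf G \<Longrightarrow> X G = Y G"
  shows "definable2 k Y"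
  using assms unfolding definable2_def by (auto elim!: definable_cong)

lemma definable2_via:
  assumes R: "\<And>c c'. definable2 k (\<lambda>G. R G c c')"
  shows "definable2 k (\<lambda>G. via (R G) S c c')"
proof (induction S arbitrary: c c')
  case Nil then show ?case by (simp add: R)
next
  case (Cons s S)
  have "definable2 k (\<lambda>G. via (R G) S c c' \<union> via (R G) S c s O (Id_on (tuples k G) \<union> (via (R G) S s s)\<^sup>+) O via (R G) S s c')"
    by (intro definable2_Un definable2_comp Cons.IH definable2_rtrancl)
  then show ?case
  proof (rule definable2_cong, goal_cases)
    case (1 G)
    \<comment> \<open>After a relation that ends in node tuples, the full identity and its
      restriction to \<open>tuples k G\<close> have the same effect.\<close>
    then have "via (R G) S c s \<subseteq> tuples k G \<times> tuples k G" using Cons.IH unfolding definable2_def by blast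
    then have "via (R G) S c s O Id_on (tuples k G) = via (R G) S c s" by auto
    then have "via (R G) S c s O (via (R G) S s s)\<^sup>* = via (R G) S c s O (Id_on (tuples k G) \<union> (via (R G) S s s)\<^sup>+)"
      by (simp add: relcomp_distrib rtrancl_trancl_reflcl Un_commute)
    then show ?case by (simp flip: O_assoc)
  qed
qed

lemma definable2I:
  assumes "definable (k + k) (\<lambda>G zs. P G (take k zs) (drop k zs))"
  shows "definable2 k (\<lambda>G. {(us, vs). us \<in> tuples k G \<and> vs \<in> tuples k G \<and> P G us vs})"
proof -
  have "definable (k + k) (\<lambda>G zs. (take k zs, drop k zs) \<in> {(us, vs). us \<in> tuples k G \<and> vs \<in> tuples k G \<and> P G us vs})"
    using assms by (rule definable_cong) (auto simp: tuples_def dest: in_set_takeD in_set_dropD)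
  then show ?thesis unfolding definable2_def by auto
qed

section \<open>Unary automata reading nodes\<close>

lemma is_path_Nil [simp]: "is_path G (v, []) \<longleftrightarrow> v \<in> nodes G"
  by (simp add: is_path_def plen_def)

lemma is_path_Cons [simp]:
  assumes "dgraph_wf G"
  shows "is_path G (v, (a, v') # w) \<longleftrightarrow> (v, a, v') \<in> edges G \<and> is_path G (v', w)"
proof -
  have "v \<in> nodes G \<and> v' \<in> nodes G" if "(v, a, v') \<in> edges G" using assms that by (auto simp: dgraph_wf_def)
  moreover have "(\<forall>i < Suc (length w). (pnode (v, (a, v') # w) i, plabel (v, (a, v') # w) (Suc i), pnode (v, (a, v') # w) (Suc i)) \<in> edges G)
    \<longleftrightarrow> (v, a, v') \<in> edges G \<and> (\<forall>i < length w. (pnode (v', w) i, plabel (v', w) (Suc i), pnode (v', w) (Suc i)) \<in> edges G)"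
    unfolding All_less_Suc2 by (auto simp: pnode_def plabel_def nth_Cons' split: if_splits)
  ultimately show ?thesis by (auto simp: is_path_def plen_def)
qed

lemma plast_Nil [simp]: "plast (v, []) = v"
  by (simp add: plast_def plen_def pnode_def)

lemma plast_Cons [simp]: "plast (v, (a, v') # w) = plast (v', w)"
  by (simp add: plast_def plen_def pnode_def nth_Cons')

lemma is_path_nodes:
  assumes "dgraph_wf G" "is_path G (v, w)"
  shows "v \<in> nodes G" "snd ` set w \<subseteq> nodes G"
proof -
  have e: "v \<in> nodes G" if "(v, a, v') \<in> edges G" for v a v' using assms(1) that by (auto simp: dgraph_wf_def)
  have "v \<in> nodes G \<and> snd ` set w \<subseteq> nodes G"
    using assms(2) by (induction w arbitrary: v) (fastforce simp: is_path_Cons[OF assms(1)] dest: e)+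
  then show "v \<in> nodes G" "snd ` set w \<subseteq> nodes G" by auto
qed

text \<open>The node itself takes the place of its id; \<open>rdpa_run_nodes\<close> justifies the
  exchange.\<close>

definition node_letter :: "('a, 'v, 'i, 'd) dgraph \<Rightarrow> 'v \<Rightarrow> ('v, 'd) dlet" where
  "node_letter G v = ([Some v], [Some (dataof G v)])"

definition node_word :: "('a, 'v, 'i, 'd) dgraph \<Rightarrow> ('a \<times> 'v) list \<Rightarrow> ('a option list \<times> ('v, 'd) dlet) list" where
  "node_word G w = map (\<lambda>(a, v). ([Some a], node_letter G v)) w"

lemma node_word_simps [simp]:
  "node_word G [] = []" "node_word G ((a, v) # w) = ([Some a], node_letter G v) # node_word G w"
  by (simp_all add: node_word_def)

lemma conv_single:
  "conv [u] = (([Some (fst (fst u))], [Some (snd (fst u))]),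
     map (\<lambda>(a, d). ([Some a], ([Some (fst d)], [Some (snd d)]))) (snd u))"
proof -
  have "map (\<lambda>i. (map (\<lambda>u. if i \<le> dlen u then Some (dlab u i) else None) [u],
      map (\<lambda>u. if i \<le> dlen u then Some (fst (ddata u i)) else None) [u],
      map (\<lambda>u. if i \<le> dlen u then Some (snd (ddata u i)) else None) [u])) [1..<Suc (dlen u)]
    = map (\<lambda>(a, d). ([Some a], ([Some (fst d)], [Some (snd d)]))) (snd u)"
    by (rule nth_equalityI) (simp_all add: dlen_def ddata_def dlab_def case_prod_beta del: upt_Suc)
  then show ?thesis by (simp add: conv_def Let_def ddata_def del: upt_Suc)
qed

lemma ieval_map_inj:
  assumes "iterm_ok A t" "arity A = 1"
  shows "ieval (\<lambda>k. map_option f (ri k)) ([Some (f i)], ds) t = map_option f (ieval ri ([Some i], ds') t)"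
  using assms by (cases t) auto

text \<open>Guards compare ids only for equality, and the only constant is \<open>ISharp\<close>, so
  an injective renaming of ids preserves every run. Injectivity is available on \<open>N\<close>
  alone, hence the invariant that registers hold values from \<open>N\<close>.\<close>

lemma rdpa_run_nodes:
  assumes wf: "rdpa_wf A" "arity A = 1" and inj: "inj_on f N"
  shows "i \<in> N \<Longrightarrow> snd ` set w \<subseteq> N \<Longrightarrow> \<forall>k v. ri k = Some v \<longrightarrow> v \<in> N \<Longrightarrow>
    rdpa_run A q (\<lambda>k. map_option f (ri k)) rd ([Some (f i)], [Some (D i)])
      (map (\<lambda>(a, v). ([Some a], ([Some (f v)], [Some (D v)]))) w) =
    rdpa_run A q ri rd ([Some i], [Some (D i)]) (map (\<lambda>(a, v). ([Some a], ([Some v], [Some (D v)]))) w)"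
proof (induction w arbitrary: q ri rd i)
  let ?l = "\<lambda>v. ([Some v], [Some (D v)])" and ?lf = "\<lambda>v. ([Some (f v)], [Some (D v)])" and ?m = "\<lambda>ri k. map_option f (ri k)"
  have mem: "v \<in> N" if "ieval ri ([Some i], [d]) t = Some v" "iterm_ok A t" "i \<in> N"
      "\<forall>k v. ri k = Some v \<longrightarrow> v \<in> N" for ri i d t v
    using that wf(2) by (cases t) auto
  have injo: "map_option f x = map_option f y \<longleftrightarrow> x = y" if "\<And>v. x = Some v \<Longrightarrow> v \<in> N" "\<And>v. y = Some v \<Longrightarrow> v \<in> N" for x y
    using that by (cases x; cases y) (simp_all add: inj_on_eq_iff[OF inj])
  have sat: "gatom_sat (?m ri) rd (?lf i) c = gatom_sat ri rd (?l i) c"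
    if c: "gatom_ok A c" and i: "i \<in> N" and r: "\<forall>k v. ri k = Some v \<longrightarrow> v \<in> N" for ri rd i c
  proof -
    let ?e = "ieval ri (?l i)"
    have ev: "ieval (?m ri) (?lf i) t = map_option f (?e t)"
      if "iterm_ok A t" for t by (rule ieval_map_inj[OF that wf(2)])
    have eq: "map_option f (?e s) = map_option f (?e t) \<longleftrightarrow> ?e s = ?e t"
      if "iterm_ok A s" "iterm_ok A t" for s t
      by (rule injo) (erule mem[OF _ that(1) i r], erule mem[OF _ that(2) i r])
    show ?thesis
  proof (cases c)
    case (IEq s t)
    then show ?thesis using c by (simp add: ev eq)
  next
    case (INeq s t)
    then show ?thesis using c by (simp add: ev eq)
  next
    case (DEq s t)
    then show ?thesis by (cases s; cases t) (use c wf(2) in auto)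
  next
    case (DNeq s t)
    then show ?thesis by (cases s; cases t) (use c wf(2) in auto)
  qed
  qed
  have guard: "(\<forall>c\<in>set g. gatom_sat (?m ri) rd (?lf i) c)
      \<longleftrightarrow> (\<forall>c\<in>set g. gatom_sat ri rd (?l i) c)"
    if "(q, g, iu, du, p) \<in> dtrans A" "i \<in> N" "\<forall>k v. ri k = Some v \<longrightarrow> v \<in> N" for q g iu du p ri rd i
    using that wf(1) sat[OF _ that(2,3)] unfolding rdpa_wf_def by fastforce
  {
    case Nil
    then show ?case unfolding list.map rdpa_run.simps
      by (intro ex_cong1 conj_cong refl guard)
  next
    case (Cons x w)
    obtain a v where x: "x = (a, v)" by fastforce
    have v: "v \<in> N" "snd ` set w \<subseteq> N" using Cons.prems x by auto
    have "rdpa_run A q' (iupdate (?m ri) (?lf i) iu)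
          (dupdate rd (?lf i) du) (?lf v)
          (map (\<lambda>(a, v). ([Some a], (?lf v))) w) =
        rdpa_run A q' (iupdate ri (?l i) iu)
          (dupdate rd (?l i) du) (?l v)
          (map (\<lambda>(a, v). ([Some a], (?l v))) w)"
      if t: "(q, g, iu, du, p) \<in> dtrans A" for g iu du p q'
    proof -
      have ok: "iterm_ok A t" if "iu k = Some t" for k t
      proof -
        have "\<forall>k. iu k \<noteq> None \<longrightarrow> k < nireg A \<and> iterm_ok A (the (iu k))"
          using wf(1) t unfolding rdpa_wf_def by blast
        then show ?thesis using that by force
      qed
      have 1: "iupdate (?m ri) (?lf i) iu =
          (\<lambda>k. map_option f (iupdate ri (?l i) iu k))"
      proof
        fix k
        show "iupdate (?m ri) (?lf i) iu k =
          map_option f (iupdate ri (?l i) iu k)"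
        proof (cases "iu k")
          case (Some t)
          from ieval_map_inj[OF ok[OF Some] wf(2), of f ri i "[Some (D i)]" "[Some (D i)]"]
          show ?thesis by (simp add: iupdate_def Some)
        qed (simp add: iupdate_def)
      qed
      have 2: "dupdate rd (?lf i) du = dupdate rd (?l i) du"
      proof
        fix k
        show "dupdate rd (?lf i) du k = dupdate rd (?l i) du k"
        proof (cases "du k")
          case (Some t)
          then show ?thesis by (cases t) (auto simp: dupdate_def)
        qed (simp add: dupdate_def)
      qed
      have 3: "\<forall>k w. iupdate ri (?l i) iu k = Some w \<longrightarrow> w \<in> N"
        using Cons.prems(3)
        by (auto simp: iupdate_def split: option.splits intro: mem[OF _ ok Cons.prems(1,3)])
      show ?thesis unfolding 1 2 by (rule Cons.IH[OF v 3])
    qed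
    then show ?case unfolding x list.map prod.case rdpa_run.simps
      by (intro ex_cong1 conj_cong refl guard[OF _ Cons.prems(1,3)])
  }
qed

lemma rdpa_accepts_path:
  assumes "rdpa_wf A" "arity A = 1" "dgraph_wf G" "is_path G \<rho>"
  shows "rdpa_accepts A (conv [dpath_of G \<rho>]) \<longleftrightarrow>
    rdpa_run A (init A) (\<lambda>_. None) (\<lambda>_. None) (node_letter G (fst \<rho>)) (node_word G (snd \<rho>))"
proof -
  obtain v w where r: "\<rho> = (v, w)" by fastforce
  have "inj_on (ident G) (nodes G)" using assms(3) by (simp add: dgraph_wf_def)
  from rdpa_run_nodes[OF assms(1,2) this, of v w "\<lambda>_. None" "init A" "\<lambda>_. None" "dataof G"]
  show ?thesis using is_path_nodes[OF assms(3), of v w] assms(4)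
    by (simp add: r conv_single rdpa_accepts_def dpath_of_def dletter_def node_letter_def node_word_def
        comp_def split_def)
qed

section \<open>Register automata in first-order logic with transitive closure\<close>

lemma rdpa_dtransD:
  assumes "rdpa_wf A" "(q, g, iu, du, p) \<in> dtrans A"
  shows "\<And>c. c \<in> set g \<Longrightarrow> gatom_ok A c"
    "\<And>k t. iu k = Some t \<Longrightarrow> k < nireg A \<and> iterm_ok A t"
    "\<And>k t. du k = Some t \<Longrightarrow> k < ndreg A \<and> dterm_ok A t"
    "q \<in> states A" "p \<in> wstates A"
proof -
  have *: "(\<forall>c \<in> set g. gatom_ok A c) \<and> (\<forall>k. iu k \<noteq> None \<longrightarrow> k < nireg A \<and> iterm_ok A (the (iu k))) \<and>
        (\<forall>k. du k \<noteq> None \<longrightarrow> k < ndreg A \<and> dterm_ok A (the (du k))) \<and> q \<in> states A \<and> p \<in> wstates A"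
    using assms(1)[unfolded rdpa_wf_def, THEN conjunct2, THEN conjunct2, THEN conjunct2, THEN conjunct2,
        THEN conjunct2, THEN conjunct2, THEN conjunct2, THEN conjunct2, THEN bspec, OF assms(2)] by simp
  show "\<And>c. c \<in> set g \<Longrightarrow> gatom_ok A c" "q \<in> states A" "p \<in> wstates A" using * by auto
  show "\<And>k t. iu k = Some t \<Longrightarrow> k < nireg A \<and> iterm_ok A t"
    "\<And>k t. du k = Some t \<Longrightarrow> k < ndreg A \<and> dterm_ok A t"
    using * by force+
qed

text \<open>A configuration of a unary automaton is a control, consisting of the state and the sets of id-registers
  and data-registers that are not \<open>\<sharp>\<close>, together with a tuple of nodes: the current node, then one node per
  id-register, then for each data-register some node carrying its value.\<close>

type_synonym control = "nat \<times> nat set \<times> nat set"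

locale unary_rdpa =
  fixes A :: "'a rdpa"
  assumes wf: "rdpa_wf A" and ar: "arity A = 1"
begin

definition ids_of :: "nat set \<Rightarrow> 'v list \<Rightarrow> nat \<Rightarrow> 'v option" where
  "ids_of I us j = (if j \<in> I then Some (us ! Suc j) else None)"

definition data_of :: "('a, 'v, 'i, 'd) dgraph \<Rightarrow> nat set \<Rightarrow> 'v list \<Rightarrow> nat \<Rightarrow> 'd option" where
  "data_of G J us j = (if j \<in> J then Some (dataof G (us ! Suc (nireg A + j))) else None)"

text \<open>Locates the value of a term inside the configuration tuple, with \<open>None\<close> for
  sharp; this is what turns guards and updates into equations between coordinates. Every input term
  goes to coordinate 0 because the automaton is unary.\<close>

fun id_index :: "nat set \<Rightarrow> iterm \<Rightarrow> nat option" where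
  "id_index I (IReg j) = (if j \<in> I then Some (Suc j) else None)"
| "id_index I (IIn j) = Some 0"
| "id_index I ISharp = None"

fun data_index :: "nat set \<Rightarrow> dterm \<Rightarrow> nat option" where
  "data_index J (DReg j) = (if j \<in> J then Some (Suc (nireg A + j)) else None)"
| "data_index J (DIn j) = Some 0"
| "data_index J DSharp = None"

definition width :: nat where "width = Suc (nireg A + ndreg A)"

lemma ieval_index:
  "iterm_ok A t \<Longrightarrow> ieval (ids_of I us) (node_letter G (us ! 0)) t = map_option (nth us) (id_index I t)"
  using ar by (cases t) (auto simp: ids_of_def node_letter_def)

lemma deval_index:
  "dterm_ok A t \<Longrightarrow> deval (data_of G J us) (node_letter G (us ! 0)) t =
     map_option (\<lambda>i. dataof G (us ! i)) (data_index J t)"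
  using ar by (cases t) (auto simp: data_of_def node_letter_def)

lemma id_index_less: "iterm_ok A t \<Longrightarrow> id_index I t = Some i \<Longrightarrow> i < width"
  by (cases t) (auto simp: width_def split: if_splits)

lemma data_index_less: "dterm_ok A t \<Longrightarrow> data_index J t = Some i \<Longrightarrow> i < width"
  by (cases t) (auto simp: width_def split: if_splits)

definition iterm_upd :: "(nat \<Rightarrow> iterm option) \<Rightarrow> nat \<Rightarrow> iterm" where
  "iterm_upd iu j = (case iu j of None \<Rightarrow> IReg j | Some t \<Rightarrow> t)"

definition dterm_upd :: "(nat \<Rightarrow> dterm option) \<Rightarrow> nat \<Rightarrow> dterm" where
  "dterm_upd du j = (case du j of None \<Rightarrow> DReg j | Some t \<Rightarrow> t)"

lemma iupdate_eq: "iupdate ri d iu j = ieval ri d (iterm_upd iu j)"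
  by (simp add: iupdate_def iterm_upd_def split: option.split)

lemma dupdate_eq: "dupdate rd d du j = deval rd d (dterm_upd du j)"
  by (simp add: dupdate_def dterm_upd_def split: option.split)

lemma upd_ok:
  assumes "(q, g, iu, du, p) \<in> dtrans A"
  shows "j < nireg A \<Longrightarrow> iterm_ok A (iterm_upd iu j)" "j < ndreg A \<Longrightarrow> dterm_ok A (dterm_upd du j)"
  using rdpa_dtransD[OF wf assms] by (auto simp: iterm_upd_def dterm_upd_def split: option.split)

lemma upd_out:
  assumes "(q, g, iu, du, p) \<in> dtrans A"
  shows "\<not> j < nireg A \<Longrightarrow> iterm_upd iu j = IReg j" "\<not> j < ndreg A \<Longrightarrow> dterm_upd du j = DReg j"
  using rdpa_dtransD[OF wf assms] by (auto simp: iterm_upd_def dterm_upd_def split: option.split)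

definition controls :: "control set" where
  "controls = states A \<times> Pow {..<nireg A} \<times> Pow {..<ndreg A}"

lemma finite_controls: "finite controls"
  using wf by (auto simp: controls_def rdpa_wf_def)

definition sat_guard :: "('a, 'v, 'i, 'd) dgraph \<Rightarrow> nat set \<times> nat set \<Rightarrow> 'v list \<Rightarrow> gatom list \<Rightarrow> bool" where
  "sat_guard G IJ us g \<longleftrightarrow>
     (\<forall>c\<in>set g. gatom_sat (ids_of (fst IJ) us) (data_of G (snd IJ) us) (node_letter G (us ! 0)) c)"

text \<open>A relation rather than a function: coordinates of empty registers are free, and a
  data-register admits any node with the right value.\<close>

definition updated :: "('a, 'v, 'i, 'd) dgraph \<Rightarrow> nat set \<times> nat set \<Rightarrow> 'v list \<Rightarrow>
    (nat \<Rightarrow> iterm option) \<Rightarrow> (nat \<Rightarrow> dterm option) \<Rightarrow> nat set \<times> nat set \<Rightarrow> 'v list \<Rightarrow> bool" where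
  "updated G IJ us iu du IJ' vs \<longleftrightarrow>
     ids_of (fst IJ') vs = iupdate (ids_of (fst IJ) us) (node_letter G (us ! 0)) iu \<and>
     data_of G (snd IJ') vs = dupdate (data_of G (snd IJ) us) (node_letter G (us ! 0)) du"

text \<open>Written with bounded quantifiers over the transition sets so that
  \<open>definable_bex\<close> turns them into finite disjunctions. The condition on
  \<open>a\<close> extracts the single label, which must be that of an edge between the two current
  nodes.\<close>

definition move :: "('a, 'v, 'i, 'd) dgraph \<Rightarrow> control \<Rightarrow> control \<Rightarrow> 'v list \<Rightarrow> 'v list \<Rightarrow> bool" where
  "move G c c' us vs \<longleftrightarrow> c \<in> controls \<and> c' \<in> controls \<and>
     (\<exists>(q, g, iu, du, p) \<in> dtrans A. \<exists>(p', a, q') \<in> wtrans A. (q = fst c \<and> p' = p \<and> q' = fst c') \<and>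
       sat_guard G (snd c) us g \<and> updated G (snd c) us iu du (snd c') vs \<and>
       (a = [Some (the (hd a))] \<and> (us ! 0, the (hd a), vs ! 0) \<in> edges G))"

definition moves :: "('a, 'v, 'i, 'd) dgraph \<Rightarrow> control \<Rightarrow> control \<Rightarrow> ('v list \<times> 'v list) set" where
  "moves G c c' = {(us, vs). us \<in> tuples width G \<and> vs \<in> tuples width G \<and> move G c c' us vs}"

definition accepting :: "('a, 'v, 'i, 'd) dgraph \<Rightarrow> control \<Rightarrow> 'v list \<Rightarrow> bool" where
  "accepting G c us \<longleftrightarrow> (\<exists>(q, g, iu, du, p) \<in> dtrans A. (q = fst c \<and> p \<in> final A) \<and> sat_guard G (snd c) us g)"

lemma definable_index_eq:
  assumes "\<And>i. s = Some i \<Longrightarrow> i < k" "\<And>i. t = Some i \<Longrightarrow> i < k"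
  shows "definable k (\<lambda>G us. map_option (nth us) s = map_option (nth us) t)"
    "definable k (\<lambda>G us. map_option (\<lambda>i. dataof G (us ! i)) s = map_option (\<lambda>i. dataof G (us ! i)) t)"
  using assms
  by (cases s; cases t; auto intro: definable_const definable_eq definable_data)+

lemma definable_gatom:
  assumes "gatom_ok A c"
  shows "definable width (\<lambda>G us. gatom_sat (ids_of I us) (data_of G J us) (node_letter G (us ! 0)) c)"
  using assms
  by (cases c) (auto simp: ieval_index deval_index
      intro!: definable_not definable_index_eq dest: id_index_less data_index_less)

lemma definable_guard:
  assumes "(q, g, iu, du, p) \<in> dtrans A"
  shows "definable width (\<lambda>G us. sat_guard G IJ us g)"
  unfolding sat_guard_def
  by (intro definable_ball definable_gatom rdpa_dtransD(1)[OF wf assms]) auto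

lemma definable_take:
  assumes "definable k R" "k \<le> n"
  shows "definable n (\<lambda>G us. R G (take k us))"
  by (rule definable_subst[OF assms(1), of n "take k"]) (use assms in \<open>auto simp: take_map\<close>)

lemma definable_accepting: "definable width (\<lambda>G us. accepting G c us)"
proof -
  have fin: "finite (dtrans A)" using wf by (simp add: rdpa_wf_def)
  show ?thesis unfolding accepting_def
    by (intro definable_bex fin)
      (auto simp: split_def intro!: definable_and definable_const definable_guard prod_eqI)
qed

text \<open>Equality of register contents as functions reduces to the finitely many existing
  registers: beyond them both sides are empty, since controls stay within range and transitions
  leave such registers alone.\<close>

lemma definable_updated:
  assumes t: "(q, g, iu, du, p) \<in> dtrans A" and c: "fst IJ \<subseteq> {..<nireg A}" "snd IJ \<subseteq> {..<ndreg A}"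
    "fst IJ' \<subseteq> {..<nireg A}" "snd IJ' \<subseteq> {..<ndreg A}"
  shows "definable (width + width) (\<lambda>G zs. updated G IJ (take width zs) iu du IJ' (drop width zs))"
proof -
  let ?s = "\<lambda>j. id_index (fst IJ') (IReg j)" and ?t = "\<lambda>j. id_index (fst IJ) (iterm_upd iu j)"
  let ?s' = "\<lambda>j. data_index (snd IJ') (DReg j)" and ?t' = "\<lambda>j. data_index (snd IJ) (dterm_upd du j)"
  have ls: "i < width" if "?s j = Some i" "j < nireg A" for i j using that id_index_less[of "IReg j"] by auto
  have lt: "i < width" if "?t j = Some i" "j < nireg A" for i j using that id_index_less upd_ok(1)[OF t] by blast
  have ls': "i < width" if "?s' j = Some i" "j < ndreg A" for i j using that data_index_less[of "DReg j"] by auto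
  have lt': "i < width" if "?t' j = Some i" "j < ndreg A" for i j using that data_index_less upd_ok(2)[OF t] by blast
  \<comment> \<open>Coordinates of the new tuple are shifted by \<open>width\<close>, since it forms
    the second half of \<open>zs\<close>.\<close>
  have "definable (width + width) (\<lambda>G zs.
     (\<forall>j\<in>{..<nireg A}. map_option (nth zs) (map_option ((+) width) (?s j)) = map_option (nth zs) (?t j)) \<and>
     (\<forall>j\<in>{..<ndreg A}. map_option (\<lambda>i. dataof G (zs ! i)) (map_option ((+) width) (?s' j)) =
        map_option (\<lambda>i. dataof G (zs ! i)) (?t' j)))"
    by (intro definable_and definable_ball definable_index_eq)
      (auto dest: ls lt ls' lt' simp del: id_index.simps data_index.simps)
  then show ?thesis
  proof (rule definable_cong, goal_cases)
    case (1 G zs)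
    then have l: "length zs = width + width" by simp
    let ?us = "take width zs" and ?vs = "drop width zs"
    have 1: "(ids_of (fst IJ') ?vs j = iupdate (ids_of (fst IJ) ?us) (node_letter G (?us ! 0)) iu j) \<longleftrightarrow>
        (j < nireg A \<longrightarrow> map_option (nth zs) (map_option ((+) width) (?s j)) = map_option (nth zs) (?t j))" for j
    proof (cases "j < nireg A")
      case True
      have "ids_of (fst IJ') ?vs j = map_option (nth zs) (map_option ((+) width) (?s j))"
        using l by (auto simp: ids_of_def)
      moreover have "map_option (nth ?us) (?t j) = map_option (nth zs) (?t j)"
        using lt[OF _ True] by (cases "?t j") auto
      ultimately show ?thesis using True by (simp add: iupdate_eq ieval_index upd_ok[OF t])
    next
      case False
      then show ?thesis using c by (auto simp: iupdate_eq upd_out[OF t] ids_of_def)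
    qed
    have 2: "(data_of G (snd IJ') ?vs j = dupdate (data_of G (snd IJ) ?us) (node_letter G (?us ! 0)) du j) \<longleftrightarrow>
        (j < ndreg A \<longrightarrow> map_option (\<lambda>i. dataof G (zs ! i)) (map_option ((+) width) (?s' j)) =
          map_option (\<lambda>i. dataof G (zs ! i)) (?t' j))" for j
    proof (cases "j < ndreg A")
      case True
      have "data_of G (snd IJ') ?vs j = map_option (\<lambda>i. dataof G (zs ! i)) (map_option ((+) width) (?s' j))"
        using l by (auto simp: data_of_def)
      moreover have "map_option (\<lambda>i. dataof G (?us ! i)) (?t' j) = map_option (\<lambda>i. dataof G (zs ! i)) (?t' j)"
        using lt'[OF _ True] by (cases "?t' j") auto
      ultimately show ?thesis using True by (simp add: dupdate_eq deval_index upd_ok[OF t])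
    next
      case False
      then show ?thesis using c by (auto simp: dupdate_eq upd_out[OF t] data_of_def)
    qed
    show ?case
      unfolding updated_def fun_eq_iff 1 2 by auto
  qed
qed

lemma width_pos: "0 < width"
  by (simp add: width_def)

lemma definable_head_edge:
  "definable (width + width) (\<lambda>G zs. (take width zs ! 0, a, drop width zs ! 0) \<in> edges G)"
proof -
  have "definable (width + width) (\<lambda>G zs. (zs ! 0, a, zs ! width) \<in> edges G)"
    using width_pos by (intro definable_edge) auto
  then show ?thesis by (rule definable_cong) (auto simp: width_def)
qed

lemma definable2_moves: "definable2 width (\<lambda>G. moves G c c')"
  unfolding moves_def
proof (rule definable2I)
  have fin: "finite (dtrans A)" "finite (wtrans A)" using wf by (simp_all add: rdpa_wf_def)
  show "definable (width + width) (\<lambda>G zs. move G c c' (take width zs) (drop width zs))"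
  proof (cases "c \<in> controls \<and> c' \<in> controls")
    case False
    then show ?thesis by (auto simp: move_def intro: definable_const)
  next
    case True
    then have c: "fst (snd c) \<subseteq> {..<nireg A}" "snd (snd c) \<subseteq> {..<ndreg A}"
      "fst (snd c') \<subseteq> {..<nireg A}" "snd (snd c') \<subseteq> {..<ndreg A}" by (auto simp: controls_def)
    have g: "definable (width + width) (\<lambda>G zs. sat_guard G (snd c) (take width zs) g)"
      if "(q, g, iu, du, p) \<in> dtrans A" for q g iu du p
      by (rule definable_take[OF definable_guard[OF that]]) simp
    show ?thesis unfolding move_def
      by (intro definable_and definable_const definable_bex fin)
        (auto simp: split_def intro!: definable_and definable_const definable_bex fin g
          definable_updated[OF _ c] definable_head_edge prod_eqI)
  qed
qed

lemma wtransD: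
  assumes "(p, a, q) \<in> wtrans A"
  shows "p \<in> wstates A" "q \<in> states A" "length a = 1"
proof -
  have "\<forall>(p, a, q) \<in> wtrans A. p \<in> wstates A \<and> q \<in> states A - wstates A \<and> length a = arity A"
    using wf by (simp add: rdpa_wf_def)
  from bspec[OF this assms] show "p \<in> wstates A" "q \<in> states A" "length a = 1" using ar by auto
qed

text \<open>Update terms only copy a register, the input node or sharp, so the new contents are
  carried by nodes already present in \<open>us\<close>.\<close>

lemma ex_updated:
  assumes t: "(q, g, iu, du, p) \<in> dtrans A" and us: "us \<in> tuples width G" and v: "v \<in> nodes G"
    and c: "fst IJ \<subseteq> {..<nireg A}" "snd IJ \<subseteq> {..<ndreg A}"
  obtains IJ' vs where "vs \<in> tuples width G" "vs ! 0 = v" "updated G IJ us iu du IJ' vs"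
    "fst IJ' \<subseteq> {..<nireg A}" "snd IJ' \<subseteq> {..<ndreg A}"
proof -
  let ?t = "\<lambda>j. id_index (fst IJ) (iterm_upd iu j)" and ?t' = "\<lambda>j. data_index (snd IJ) (dterm_upd du j)"
  \<comment> \<open>\<open>v\<close> merely fills the coordinates of registers that become empty;
    the control \<open>IJ'\<close> masks it.\<close>
  define sel where "sel = (\<lambda>i. case i of None \<Rightarrow> v | Some i \<Rightarrow> us ! i)"
  define vs where "vs = v # map (\<lambda>j. sel (?t j)) [0..<nireg A] @ map (\<lambda>j. sel (?t' j)) [0..<ndreg A]"
  define IJ' where "IJ' = ({j. j < nireg A \<and> ?t j \<noteq> None}, {j. j < ndreg A \<and> ?t' j \<noteq> None})"
  have nth: "us ! i \<in> nodes G" if "i < width" for i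
    using that us by (auto simp: tuples_def)
  have "sel (?t j) \<in> nodes G" if "j < nireg A" for j
    using id_index_less[OF upd_ok(1)[OF t that]] v nth by (cases "?t j") (auto simp: sel_def)
  moreover have "sel (?t' j) \<in> nodes G" if "j < ndreg A" for j
    using data_index_less[OF upd_ok(2)[OF t that]] v nth by (cases "?t' j") (auto simp: sel_def)
  ultimately have "vs \<in> tuples width G" using v by (auto simp: vs_def tuples_def width_def)
  moreover have "ids_of (fst IJ') vs j = iupdate (ids_of (fst IJ) us) (node_letter G (us ! 0)) iu j" for j
  proof (cases "j < nireg A")
    case True
    then show ?thesis
      by (cases "?t j") (auto simp: iupdate_eq ieval_index upd_ok[OF t] ids_of_def IJ'_def vs_def nth_append sel_def)
  next
    case False
    then show ?thesis using c by (auto simp: iupdate_eq upd_out[OF t] ids_of_def IJ'_def)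
  qed
  moreover have "data_of G (snd IJ') vs j = dupdate (data_of G (snd IJ) us) (node_letter G (us ! 0)) du j" for j
  proof (cases "j < ndreg A")
    case True
    then show ?thesis
      by (cases "?t' j") (auto simp: dupdate_eq deval_index upd_ok[OF t] data_of_def IJ'_def vs_def nth_append sel_def)
  next
    case False
    then show ?thesis using c by (auto simp: dupdate_eq upd_out[OF t] data_of_def IJ'_def)
  qed
  ultimately show thesis by (intro that[of vs IJ']) (auto simp: updated_def vs_def IJ'_def)
qed

abbreviation run_at :: "('a, 'v, 'i, 'd) dgraph \<Rightarrow> control \<Rightarrow> 'v list \<Rightarrow> ('a \<times> 'v) list \<Rightarrow> bool" where
  "run_at G c us w \<equiv> rdpa_run A (fst c) (ids_of (fst (snd c)) us) (data_of G (snd (snd c)) us)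
     (node_letter G (us ! 0)) (node_word G w)"

text \<open>Along the run the register contents are represented by tuples supplied by
  \<open>ex_updated\<close>. The last data letter is not followed by a word letter, so it becomes
  \<open>accepting\<close> instead of a move.\<close>

lemma run_imp_moves:
  assumes G: "dgraph_wf G"
  shows "run_at G c us w \<Longrightarrow> is_path G (us ! 0, w) \<Longrightarrow> c \<in> controls \<Longrightarrow> us \<in> tuples width G \<Longrightarrow>
    \<exists>c' vs. ((c, us), (c', vs)) \<in> (control_graph (moves G))\<^sup>* \<and> c' \<in> controls \<and> vs \<in> tuples width G \<and>
      vs ! 0 = plast (us ! 0, w) \<and> accepting G c' vs"
proof (induction w arbitrary: c us)
  case Nil
  then show ?case
    by (intro exI[of _ c] exI[of _ us]) (force simp: accepting_def sat_guard_def)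
next
  case (Cons x w)
  obtain a v where x: "x = (a, v)" by fastforce
  from Cons.prems(1) obtain g iu du p q' where t: "(fst c, g, iu, du, p) \<in> dtrans A"
    and g: "sat_guard G (snd c) us g" and w: "(p, [Some a], q') \<in> wtrans A"
    and r: "rdpa_run A q' (iupdate (ids_of (fst (snd c)) us) (node_letter G (us ! 0)) iu)
      (dupdate (data_of G (snd (snd c)) us) (node_letter G (us ! 0)) du) (node_letter G v) (node_word G w)"
    by (auto simp: x sat_guard_def)
  have p: "(us ! 0, a, v) \<in> edges G" "is_path G (v, w)" using Cons.prems(2) G by (auto simp: x)
  have v: "v \<in> nodes G" using is_path_nodes[OF G p(2)] by simp
  have c: "fst (snd c) \<subseteq> {..<nireg A}" "snd (snd c) \<subseteq> {..<ndreg A}"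
    using Cons.prems(3) by (auto simp: controls_def)
  obtain IJ' vs where vs: "vs \<in> tuples width G" "vs ! 0 = v" and u: "updated G (snd c) us iu du IJ' vs"
    and c': "fst IJ' \<subseteq> {..<nireg A}" "snd IJ' \<subseteq> {..<ndreg A}"
    by (rule ex_updated[OF t Cons.prems(4) v c])
  have c'': "(q', IJ') \<in> controls" using c' wtransD[OF w] by (cases IJ') (auto simp: controls_def)
  have "move G c (q', IJ') us vs" unfolding move_def
    using t w g u p(1) vs(2) Cons.prems(3) c'' by (auto intro!: bexI[OF _ t] bexI[OF _ w])
  then have 1: "((c, us), ((q', IJ'), vs)) \<in> control_graph (moves G)"
    using vs Cons.prems(4) by (auto simp: control_graph_def moves_def)
  have "run_at G (q', IJ') vs w" using r u vs(2) by (simp add: updated_def)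
  from Cons.IH[OF this _ c'' vs(1)] p(2) vs(2) obtain c3 ws where
    "(((q', IJ'), vs), (c3, ws)) \<in> (control_graph (moves G))\<^sup>*" "c3 \<in> controls" "ws \<in> tuples width G"
      "ws ! 0 = plast (v, w)" "accepting G c3 ws" by auto
  with 1 show ?case unfolding x plast_Cons by (meson converse_rtrancl_into_rtrancl)
qed

text \<open>The chain of moves is processed from its end; the successive coordinates 0, joined by
  the labels of the moves, spell the path.\<close>

lemma moves_imp_run:
  assumes G: "dgraph_wf G" and "((c, us), (c', vs)) \<in> (control_graph (moves G))\<^sup>*" "accepting G c' vs" "vs \<in> tuples width G"
  shows "\<exists>w. is_path G (us ! 0, w) \<and> plast (us ! 0, w) = vs ! 0 \<and> run_at G c us w"
proof -
  have "\<exists>w. is_path G (snd z ! 0, w) \<and> plast (snd z ! 0, w) = vs ! 0 \<and> run_at G (fst z) (snd z) w"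
    if "(z, (c', vs)) \<in> (control_graph (moves G))\<^sup>*" for z using that
  proof (induction rule: converse_rtrancl_induct)
    case base
    have "vs ! 0 \<in> nodes G" using assms(4) width_pos by (auto simp: tuples_def)
    then show ?case using assms(3) by (intro exI[of _ "[]"]) (auto simp: accepting_def sat_guard_def)
  next
    case (step z z')
    obtain w where w: "is_path G (snd z' ! 0, w)" "plast (snd z' ! 0, w) = vs ! 0" "run_at G (fst z') (snd z') w"
      using step.IH by blast
    from step.hyps(1) have "move G (fst z) (fst z') (snd z) (snd z')"
      by (auto simp: control_graph_def moves_def)
    then obtain g iu du p a where t: "(fst (fst z), g, iu, du, p) \<in> dtrans A" "(p, [Some a], fst (fst z')) \<in> wtrans A"
      "sat_guard G (snd (fst z)) (snd z) g" "updated G (snd (fst z)) (snd z) iu du (snd (fst z')) (snd z')"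
      and e: "(snd z ! 0, a, snd z' ! 0) \<in> edges G"
      unfolding move_def split_def by (metis prod.collapse)
    have "run_at G (fst z) (snd z) ((a, snd z' ! 0) # w)"
      using t w(3) by (auto simp: sat_guard_def updated_def intro!: exI)
    then show ?case using w e G by (intro exI[of _ "(a, snd z' ! 0) # w"]) auto
  qed
  from this[OF assms(2)] show ?thesis by simp
qed

text \<open>Start and end tuple are quantified, and only their coordinates 0 are tied to the two
  given nodes. In the initial control all registers are empty, so the other coordinates of the start
  tuple are arbitrary.\<close>

lemma definable_unary_rdpa:
  "definable 2 (\<lambda>(G :: ('a, 'v, 'i, 'd) dgraph) xs. \<exists>\<rho>. is_path G \<rho> \<and> pfirst \<rho> = xs ! 0 \<and> plast \<rho> = xs ! 1 \<and>
     rdpa_accepts A (conv [dpath_of G \<rho>]))"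
proof -
  obtain S where S: "set S = controls" using finite_list[OF finite_controls] by blast
  define c0 where "c0 = (init A, {} :: nat set, {} :: nat set)"
  have c0: "c0 \<in> controls" using wf by (auto simp: c0_def controls_def rdpa_wf_def)
  let ?w = width
  have e: "definable (?w + ?w) (\<lambda>(G :: ('a, 'v, 'i, 'd) dgraph) zs. take ?w zs = drop ?w zs)"
  proof (rule definable_cong)
    show "definable (?w + ?w) (\<lambda>(G :: ('a, 'v, 'i, 'd) dgraph) zs. \<forall>i\<in>{..<?w}. zs ! i = zs ! (?w + i))"
      by (intro definable_ball definable_eq) auto
  qed (auto simp: list_eq_iff_nth_eq)
  have via: "definable (?w + ?w) (\<lambda>(G :: ('a, 'v, 'i, 'd) dgraph) zs. (take ?w zs, drop ?w zs) \<in> via (moves G) S c0 c)" for c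
  proof -
    have "definable2 ?w (\<lambda>G :: ('a, 'v, 'i, 'd) dgraph. via (moves G) S c0 c)"
      by (rule definable2_via) (rule definable2_moves)
    then show ?thesis by (simp add: definable2_def)
  qed
  have acc: "definable (?w + ?w) (\<lambda>(G :: ('a, 'v, 'i, 'd) dgraph) zs. accepting G c (drop ?w zs))" for c
    by (rule definable_subst[OF definable_accepting, of _ "drop ?w"]) (auto simp: drop_map)
  \<comment> \<open>\<open>via\<close> covers runs with at least one move; the equality disjunct
    supplies the path of length 0.\<close>
  define R where "R = (\<lambda>(G :: ('a, 'v, 'i, 'd) dgraph) zs. \<exists>c\<in>controls.
      ((c = c0 \<and> take ?w zs = drop ?w zs) \<or> (take ?w zs, drop ?w zs) \<in> via (moves G) S c0 c) \<and> accepting G c (drop ?w zs))"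
  have "definable (?w + ?w) R" unfolding R_def
    by (intro definable_bex finite_controls definable_and definable_or definable_const e via acc)
  then have "definable ((?w + ?w) + 2) (\<lambda>G zs. R G (take (?w + ?w) zs))"
    by (rule definable_take) simp
  then have "definable 2 (\<lambda>(G :: ('a, 'v, 'i, 'd) dgraph) xs. \<exists>zs. length zs = ?w + ?w \<and> set zs \<subseteq> nodes G \<and>
      (\<lambda>G zs. R G (take (?w + ?w) zs) \<and> zs ! 0 = zs ! (?w + ?w) \<and> zs ! ?w = zs ! (?w + ?w + 1)) G (zs @ xs))"
    using width_pos by (intro definable_exs definable_and definable_eq) auto
  then show ?thesis
  proof (rule definable_cong, goal_cases)
    case (1 G xs)
    then have G: "dgraph_wf G" and xs: "length xs = 2" "set xs \<subseteq> nodes G" by auto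
    have reach: "((c0, us), (c, vs)) \<in> (control_graph (moves G))\<^sup>* \<longleftrightarrow> (c = c0 \<and> us = vs) \<or> (us, vs) \<in> via (moves G) S c0 c"
      for us vs c
    proof -
      have "c' \<in> set S" if "moves G c c' \<noteq> {}" for c c' using that S by (auto simp: moves_def move_def)
      then have "((c0, us), (c, vs)) \<in> (control_graph (moves G))\<^sup>+ \<longleftrightarrow> (us, vs) \<in> via (moves G) S c0 c"
        using via_sound via_complete by metis
      then show ?thesis by (auto simp: rtrancl_eq_or_trancl)
    qed
    have r0: "run_at G c0 us w \<longleftrightarrow> rdpa_run A (init A) (\<lambda>_. None) (\<lambda>_. None) (node_letter G (us ! 0)) (node_word G w)"
      for us w
    proof -
      have "ids_of {} us = (\<lambda>_. None)" "data_of G {} us = (\<lambda>_. None)"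
        by (auto simp: ids_of_def data_of_def)
      then show ?thesis by (simp add: c0_def)
    qed
    show ?case (is "?l = ?r")
    proof
      assume ?l
      then obtain zs where zs: "length zs = ?w + ?w" "set zs \<subseteq> nodes G" "R G zs" "zs ! 0 = xs ! 0" "zs ! ?w = xs ! 1"
        using width_pos by (auto simp: nth_append split: if_splits)
      define us vs where "us = take ?w zs" and "vs = drop ?w zs"
      have uv: "us \<in> tuples ?w G" "vs \<in> tuples ?w G" "us ! 0 = xs ! 0" "vs ! 0 = xs ! 1"
        using zs width_pos by (auto simp: us_def vs_def tuples_def dest: in_set_takeD in_set_dropD)
      from zs(3) obtain c where "((c0, us), (c, vs)) \<in> (control_graph (moves G))\<^sup>*" "accepting G c vs"
        unfolding R_def reach us_def[symmetric] vs_def[symmetric] by blast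
      from moves_imp_run[OF G this uv(2)] obtain w where w: "is_path G (xs ! 0, w)" "plast (xs ! 0, w) = xs ! 1" "run_at G c0 us w"
        using uv by auto
      then show ?r using rdpa_accepts_path[OF wf ar G w(1)] unfolding r0
        by (intro exI[of _ "(xs ! 0, w)"]) (simp add: pfirst_def uv)
    next
      assume ?r
      then obtain w where w: "is_path G (xs ! 0, w)" "plast (xs ! 0, w) = xs ! 1"
        "rdpa_accepts A (conv [dpath_of G (xs ! 0, w)])" by (auto simp: pfirst_def)
      \<comment> \<open>Any node tuple headed by the source would do, as all registers are empty at
        the start.\<close>
      define us where "us = replicate ?w (xs ! 0)"
      have us: "us \<in> tuples ?w G" "us ! 0 = xs ! 0"
        using xs width_pos by (auto simp: us_def tuples_def)
      have "run_at G c0 us w" using rdpa_accepts_path[OF wf ar G w(1)] w(3) unfolding r0 by (simp add: us)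
      from run_imp_moves[OF G this _ c0 us(1)] w obtain c vs where
        m: "((c0, us), (c, vs)) \<in> (control_graph (moves G))\<^sup>*" "c \<in> controls" "vs \<in> tuples ?w G"
          "vs ! 0 = xs ! 1" "accepting G c vs" by (auto simp: us)
      have l: "length us = ?w" "length vs = ?w" using us m by (auto simp: tuples_def)
      have "R G (us @ vs)" unfolding R_def using m l by (auto simp: reach)
      then show ?l using us m l width_pos
        by (intro exI[of _ "us @ vs"]) (auto simp: tuples_def nth_append)
    qed
  qed
qed

end

lemma RDPQ_subsumed_FOstar: "subsumed TYPE(('a, 'v, 'i, 'd) dgraph) RDPQ fo_sat FOstar fs_sat"
proof (rule subsumed_FOstarI)
  fix \<phi> :: "'a fo" assume "\<phi> \<in> RDPQ"
  then obtain x p y A where \<phi>: "\<phi> = FExP p (FAnd (FReach x p y) (FIn [p] A))" and "rdpa_wf A" "arity A = 1"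
    by (auto simp: RDPQ_def)
  then interpret unary_rdpa A by unfold_locales
  show "\<exists>k R xs. length xs = k \<and> definable k R \<and> (\<forall>(G :: ('a, 'v, 'i, 'd) dgraph) \<nu> \<pi>.
      dgraph_wf G \<longrightarrow> valid_asg G \<nu> \<pi> \<longrightarrow> fo_sat G \<nu> \<pi> \<phi> = R G (map \<nu> xs))"
    by (intro exI[of _ 2] exI[of _ "[x, y]"] exI conjI, simp, rule definable_unary_rdpa) (simp add: \<phi>)
qed

section \<open>Binary automata comparing two paths\<close>

definition letter2 :: "('a \<times> ('i \<times> 'd)) option \<Rightarrow> ('a \<times> ('i \<times> 'd)) option \<Rightarrow> 'a option list \<times> ('i, 'd) dlet" where
  "letter2 x y = ([map_option fst x, map_option fst y],
     [map_option (fst \<circ> snd) x, map_option (fst \<circ> snd) y], [map_option (snd \<circ> snd) x, map_option (snd \<circ> snd) y])"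

definition nth_opt :: "'x list \<Rightarrow> nat \<Rightarrow> 'x option" where
  "nth_opt xs i = (if i < length xs then Some (xs ! i) else None)"

definition zip2 :: "('a \<times> ('i \<times> 'd)) list \<Rightarrow> ('a \<times> ('i \<times> 'd)) list \<Rightarrow> ('a option list \<times> ('i, 'd) dlet) list" where
  "zip2 us vs = map (\<lambda>i. letter2 (nth_opt us i) (nth_opt vs i)) [0..<max (length us) (length vs)]"

lemma zip2_simps [simp]:
  "zip2 [] [] = []"
  "zip2 (x # us) (y # vs) = letter2 (Some x) (Some y) # zip2 us vs"
  "zip2 [] (y # vs) = letter2 None (Some y) # zip2 [] vs"
  "zip2 (x # us) [] = letter2 (Some x) None # zip2 us []"
  by (simp_all add: zip2_def nth_opt_def map_upt_Suc del: upt_Suc)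

lemma conv_pair:
  "conv [u, v] = (([Some (fst (fst u)), Some (fst (fst v))], [Some (snd (fst u)), Some (snd (fst v))]),
     zip2 (snd u) (snd v))"
proof -
  have "map (\<lambda>i. (map (\<lambda>u. if i \<le> dlen u then Some (dlab u i) else None) [u, v],
      map (\<lambda>u. if i \<le> dlen u then Some (fst (ddata u i)) else None) [u, v],
      map (\<lambda>u. if i \<le> dlen u then Some (snd (ddata u i)) else None) [u, v])) [1..<Suc (max (dlen u) (dlen v))]
    = zip2 (snd u) (snd v)"
    by (rule nth_equalityI)
      (auto simp: zip2_def letter2_def nth_opt_def dlen_def ddata_def dlab_def simp del: upt_Suc)
  then show ?thesis by (simp add: conv_def Let_def ddata_def max.commute del: upt_Suc)
qed

text \<open>States 0, 1 read positions of both words, states 2, 3 those where the first word has ended.\<close>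

definition bin_rdpa :: "gatom list \<Rightarrow> ('a \<times> 'a) set \<Rightarrow> 'a set \<Rightarrow> 'a set \<Rightarrow> nat set \<Rightarrow> 'a rdpa" where
  "bin_rdpa g W X Y F = \<lparr>arity = 2, states = {0, 1, 2, 3}, wstates = {1, 3}, init = 0, final = F,
     nireg = 0, ndreg = 0,
     wtrans = (\<lambda>(a, b). (1, [Some a, Some b], 0)) ` W \<union> (\<lambda>b. (1, [None, Some b], 2)) ` X \<union>
       (\<lambda>b. (3, [None, Some b], 2)) ` Y,
     dtrans = {(0, g, \<lambda>_. None, \<lambda>_. None, 1), (2, [], \<lambda>_. None, \<lambda>_. None, 3)}\<rparr>"

lemma bin_rdpa_wf:
  assumes "finite (UNIV :: 'a set)" "F \<subseteq> {1, 3}" "set g \<subseteq> {IEq (IIn 0) (IIn 1), DEq (DIn 0) (DIn 1)}"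
  shows "rdpa_wf (bin_rdpa g W X Y F :: 'a rdpa)"
proof -
  have f: "finite X" "finite Y" using finite_subset[OF subset_UNIV assms(1)] by auto
  have fW: "finite W" using finite_subset[OF subset_UNIV finite_Prod_UNIV[OF assms(1,1)]] .
  have "gatom_ok (bin_rdpa g W X Y F) c" if "c \<in> set g" for c
    using subsetD[OF assms(3) that] by (auto simp: bin_rdpa_def)
  then show ?thesis using assms(2) f fW by (auto simp: rdpa_wf_def bin_rdpa_def)
qed

lemma bin_rdpa_sel:
  "(q, g', iu, du, p) \<in> dtrans (bin_rdpa g W X Y F) \<longleftrightarrow> iu = (\<lambda>_. None) \<and> du = (\<lambda>_. None) \<and>
     (q = 0 \<and> g' = g \<and> p = 1 \<or> q = 2 \<and> g' = [] \<and> p = 3)"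
  "(p, l, q) \<in> wtrans (bin_rdpa g W X Y F) \<longleftrightarrow> (p = 1 \<and> q = 0 \<and> (\<exists>(a, b)\<in>W. l = [Some a, Some b])) \<or>
     (p = 1 \<and> q = 2 \<and> (\<exists>b\<in>X. l = [None, Some b])) \<or> (p = 3 \<and> q = 2 \<and> (\<exists>b\<in>Y. l = [None, Some b]))"
  "final (bin_rdpa g W X Y F) = F" "init (bin_rdpa g W X Y F) = 0" "arity (bin_rdpa g W X Y F) = 2"
  by (auto simp: bin_rdpa_def image_iff)

text \<open>State-free reading of \<open>bin_rdpa\<close>: \<open>P\<close> is tested as long as
  both words last, while \<open>X\<close> and \<open>Y\<close> restrict the first and the later
  surplus labels of the second word. The last clause fails because no word transition has a blank
  second component.\<close>

fun bin_acc :: "('x \<Rightarrow> 'x \<Rightarrow> bool) \<Rightarrow> ('a \<times> 'a) set \<Rightarrow> 'a set \<Rightarrow> 'a set \<Rightarrow> nat set \<Rightarrow>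
    'x \<Rightarrow> 'x \<Rightarrow> ('a \<times> 'x) list \<Rightarrow> ('a \<times> 'x) list \<Rightarrow> bool" where
  "bin_acc P W X Y F d e [] [] = (P d e \<and> 1 \<in> F)"
| "bin_acc P W X Y F d e ((a, d') # us) ((b, e') # vs) = (P d e \<and> (a, b) \<in> W \<and> bin_acc P W X Y F d' e' us vs)"
| "bin_acc P W X Y F d e [] ((b, e') # vs) = (P d e \<and> b \<in> X \<and> fst ` set vs \<subseteq> Y \<and> 3 \<in> F)"
| "bin_acc P W X Y F d e (x # us) [] = False"

definition bin_guard :: "gatom list \<Rightarrow> 'i \<times> 'd \<Rightarrow> 'i \<times> 'd \<Rightarrow> bool" where
  "bin_guard g d e \<longleftrightarrow> (\<forall>c\<in>set g. gatom_sat (\<lambda>_. None) (\<lambda>_. None)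
     ([Some (fst d), Some (fst e)], [Some (snd d), Some (snd e)]) c)"

lemma update_None [simp]: "iupdate ri d (\<lambda>_. None) = ri" "dupdate rd d (\<lambda>_. None) = rd"
  by (auto simp: iupdate_def dupdate_def)

lemma bin_rdpa_run2:
  "rdpa_run (bin_rdpa g W X Y F) 2 ri rd l (zip2 [] vs) \<longleftrightarrow> fst ` set vs \<subseteq> Y \<and> 3 \<in> F"
proof (induction vs arbitrary: l)
  case (Cons y vs)
  then show ?case by (cases y) (auto simp: letter2_def bin_rdpa_sel image_iff)
qed (simp add: bin_rdpa_sel)

lemma bin_rdpa_run0:
  "rdpa_run (bin_rdpa g W X Y F) 0 (\<lambda>_. None) (\<lambda>_. None)
     ([Some (fst d), Some (fst e)], [Some (snd d), Some (snd e)]) (zip2 us vs) \<longleftrightarrow>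
   bin_acc (bin_guard g) W X Y F d e us vs"
proof (induction "bin_guard g :: 'b \<times> 'c \<Rightarrow> _" W X Y F d e us vs rule: bin_acc.induct)
  case (1 W X Y F d e)
  show ?case by (auto simp: bin_rdpa_sel bin_guard_def)
next
  case (2 W X Y F d e a d' us b e' vs)
  then show ?case by (auto simp: letter2_def bin_guard_def bin_rdpa_sel)
next
  case (3 W X Y F d e b e' vs)
  show ?case by (auto simp: letter2_def bin_guard_def bin_rdpa_sel bin_rdpa_run2)
next
  case (4 W X Y F d e x us)
  show ?case by (cases x) (auto simp: letter2_def bin_rdpa_sel)
qed

lemma bin_rdpa_accepts:
  "rdpa_accepts (bin_rdpa g W X Y F) (conv [u, v]) \<longleftrightarrow>
   bin_acc (bin_guard g) W X Y F (fst u) (fst v) (snd u) (snd v)"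
  using bin_rdpa_run0[of g W X Y F "fst u" "fst v" "snd u" "snd v"]
  by (simp add: rdpa_accepts_def conv_pair bin_rdpa_sel)

definition prefix_rdpa :: "'a rdpa" where
  "prefix_rdpa = bin_rdpa [IEq (IIn 0) (IIn 1)] Id UNIV UNIV {1, 3}"

text \<open>State 3 is reached only after a surplus letter of the second word, and the empty
  \<open>Y\<close> forbids another one.\<close>

definition succ_rdpa :: "'a \<Rightarrow> 'a rdpa" where
  "succ_rdpa a = bin_rdpa [] UNIV {a} {} {3}"

definition less_rdpa :: "'a rdpa" where
  "less_rdpa = bin_rdpa [] UNIV UNIV UNIV {3}"

text \<open>Empty \<open>W\<close> and \<open>X\<close> admit no word letter at all, so only pairs
  of trivial paths can be accepted.\<close>

definition data_rdpa :: "'a rdpa" where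
  "data_rdpa = bin_rdpa [DEq (DIn 0) (DIn 1)] {} {} {} {1}"

lemmas rdpa_defs = prefix_rdpa_def succ_rdpa_def less_rdpa_def data_rdpa_def

lemma binary_rdpas_wf:
  assumes "finite (UNIV :: 'a set)"
  shows "rdpa_wf (prefix_rdpa :: 'a rdpa)" "rdpa_wf (succ_rdpa (a :: 'a))" "rdpa_wf (less_rdpa :: 'a rdpa)"
    "rdpa_wf (data_rdpa :: 'a rdpa)"
  unfolding rdpa_defs using assms by (intro bin_rdpa_wf; simp)+

lemma binary_rdpas_arity:
  "arity prefix_rdpa = 2" "arity (succ_rdpa a) = 2" "arity less_rdpa = 2" "arity data_rdpa = 2"
  by (simp_all add: rdpa_defs bin_rdpa_sel)

text \<open>Equal ids mean equal nodes by injectivity of \<open>ident\<close>, and \<open>Id\<close>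
  compares labels; the surplus of the second word is the suffix \<open>w\<close>.\<close>

lemma prefix_rdpa_accepts:
  assumes G: "dgraph_wf G" and "is_path G \<rho>" "is_path G \<rho>'"
  shows "rdpa_accepts prefix_rdpa (conv [dpath_of G \<rho>, dpath_of G \<rho>']) \<longleftrightarrow>
    (\<exists>w. \<rho>' = (fst \<rho>, snd \<rho> @ w))"
proof -
  let ?m = "map (\<lambda>(a, v). (a, dletter G v))"
  have "bin_acc (bin_guard [IEq (IIn 0) (IIn 1)]) Id UNIV UNIV {1, 3} (dletter G v) (dletter G v') (?m w) (?m w')
      \<longleftrightarrow> v' = v \<and> (\<exists>z. w' = w @ z)" if "is_path G (v, w)" "is_path G (v', w')" for v v' w w'
    using that
  proof (induction w arbitrary: v v' w')
    have inj: "ident G v = ident G v' \<longleftrightarrow> v' = v" if "v \<in> nodes G" "v' \<in> nodes G" for v v'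
      using G that by (auto simp: dgraph_wf_def inj_on_def)
    {
      case Nil
      have "v \<in> nodes G" "v' \<in> nodes G" using Nil is_path_nodes[OF G] by auto
      then show ?case by (cases w') (auto simp: bin_guard_def dletter_def inj)
    next
      case (Cons x w)
      have "v \<in> nodes G" "v' \<in> nodes G" using Cons.prems is_path_nodes[OF G] by auto
      note i = inj[OF this]
      obtain a u where x: "x = (a, u)" by fastforce
      show ?case
      proof (cases w')
        case (Cons y ws)
        obtain b u' where y: "y = (b, u')" by fastforce
        have "is_path G (u, w)" "is_path G (u', ws)" using Cons.prems G by (auto simp: x y Cons)
        from Cons.IH[OF this] show ?thesis
          by (auto simp: x y Cons bin_guard_def dletter_def i)
      qed (simp add: x)
    }
  qed
  from this[of "fst \<rho>" "snd \<rho>" "fst \<rho>'" "snd \<rho>'"] assms show ?thesis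
    by (auto simp: prefix_rdpa_def bin_rdpa_accepts dpath_of_def prod_eq_iff)
qed

lemma bin_acc_length:
  "bin_acc (\<lambda>_ _. True) UNIV UNIV UNIV {3} d e us vs \<longleftrightarrow> length us < length vs"
proof (induction us arbitrary: d e vs)
  case Nil then show ?case by (cases vs) auto
next
  case (Cons x us) then show ?case by (cases x; cases vs) auto
qed

lemma bin_acc_succ:
  "bin_acc (\<lambda>_ _. True) UNIV {a} {} {3} d e us vs \<longleftrightarrow> length vs = Suc (length us) \<and> fst (vs ! length us) = a"
proof (induction us arbitrary: d e vs)
  case Nil then show ?case by (cases vs) auto
next
  case (Cons x us) then show ?case by (cases x; cases vs) auto
qed

lemma bin_guard_Nil: "bin_guard [] = (\<lambda>_ _. True)"
  by (simp add: bin_guard_def fun_eq_iff)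

lemma less_rdpa_accepts:
  "rdpa_accepts less_rdpa (conv [dpath_of G \<rho>, dpath_of G \<rho>']) \<longleftrightarrow> plen \<rho> < plen \<rho>'"
  by (simp add: less_rdpa_def bin_rdpa_accepts dpath_of_def plen_def bin_guard_Nil bin_acc_length)

lemma succ_rdpa_accepts:
  "rdpa_accepts (succ_rdpa a) (conv [dpath_of G \<rho>, dpath_of G \<rho>']) \<longleftrightarrow>
    plen \<rho>' = Suc (plen \<rho>) \<and> plabel \<rho>' (plen \<rho>') = a"
  by (auto simp: succ_rdpa_def bin_rdpa_accepts dpath_of_def plen_def plabel_def split_def
      bin_guard_Nil bin_acc_succ)

lemma data_rdpa_accepts:
  "rdpa_accepts data_rdpa (conv [dpath_of G \<rho>, dpath_of G \<rho>']) \<longleftrightarrow>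
    snd \<rho> = [] \<and> snd \<rho>' = [] \<and> dataof G (fst \<rho>) = dataof G (fst \<rho>')"
  by (cases "snd \<rho>"; cases "snd \<rho>'")
    (auto simp: data_rdpa_def bin_rdpa_accepts dpath_of_def bin_guard_def dletter_def)

section \<open>First-order formulas comparing paths and testing simplicity\<close>

definition FPrefix :: "nat \<Rightarrow> nat \<Rightarrow> 'a fo" where
  "FPrefix p q = FIn [p, q] prefix_rdpa"

text \<open>\<open>FReach\<close> mentions both ends of a path, so 0 and 1 absorb the two starts.
  All three node variables are bound here, so the fixed choice cannot clash with a context.\<close>

definition FSameEnd :: "nat \<Rightarrow> nat \<Rightarrow> 'a fo" where
  "FSameEnd p q = FExN 0 (FExN 1 (FExN 2 (FAnd (FReach 0 p 2) (FReach 1 q 2))))"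

definition FSameStart :: "nat \<Rightarrow> nat \<Rightarrow> 'a fo" where
  "FSameStart p q = FExN 0 (FExN 1 (FExN 2 (FAnd (FReach 2 p 0) (FReach 2 q 1))))"

text \<open>Data values are compared on the trivial paths \<open>r\<close>, \<open>s\<close> at the two end nodes, so that a single letter
  of the convolution contains both.\<close>

definition FSameData :: "nat \<Rightarrow> nat \<Rightarrow> nat \<Rightarrow> nat \<Rightarrow> 'a fo" where
  "FSameData r s p q = FExP r (FExP s (FAnd (FSameEnd p r) (FAnd (FSameEnd q s) (FIn [r, s] data_rdpa))))"

text \<open>A walk visits some node twice exactly when two different prefixes of it have the same
  end.\<close>

definition FSimple :: "nat \<Rightarrow> nat \<Rightarrow> nat \<Rightarrow> 'a fo" where
  "FSimple r s p = FNot (FExP r (FExP s (FAnd (FAnd (FPrefix r p) (FPrefix s p))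
     (FAnd (FSameEnd r s) (FNot (FPEq r s))))))"

lemma FO_macros_wf:
  assumes "finite (UNIV :: 'a set)"
  shows "fo_wf (FPrefix p q :: 'a fo)" "fo_wf (FSameEnd p q :: 'a fo)" "fo_wf (FSameStart p q :: 'a fo)"
    "fo_wf (FSameData r s p q :: 'a fo)" "fo_wf (FSimple r s p :: 'a fo)"
  using binary_rdpas_wf[OF assms]
  by (auto simp: FPrefix_def FSameEnd_def FSameStart_def FSameData_def FSimple_def binary_rdpas_arity)

definition ptake :: "nat \<Rightarrow> ('a, 'v) path \<Rightarrow> ('a, 'v) path" where
  "ptake i \<rho> = (fst \<rho>, take i (snd \<rho>))"

lemma pnode_ptake: "i \<le> j \<Longrightarrow> j \<le> plen \<rho> \<Longrightarrow> pnode (ptake j \<rho>) i = pnode \<rho> i"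
  by (auto simp: pnode_def ptake_def plen_def)

lemma plabel_ptake: "0 < i \<Longrightarrow> i \<le> j \<Longrightarrow> j \<le> plen \<rho> \<Longrightarrow> plabel (ptake j \<rho>) i = plabel \<rho> i"
  by (auto simp: plabel_def ptake_def plen_def)

lemma plen_ptake [simp]: "i \<le> plen \<rho> \<Longrightarrow> plen (ptake i \<rho>) = i"
  by (auto simp: ptake_def plen_def)

lemma plast_ptake: "i \<le> plen \<rho> \<Longrightarrow> plast (ptake i \<rho>) = pnode \<rho> i"
  by (simp add: plast_def pnode_ptake)

lemma is_path_ptake:
  assumes "is_path G \<rho>" "i \<le> plen \<rho>" shows "is_path G (ptake i \<rho>)"
  using assms by (auto simp: is_path_def pnode_ptake plabel_ptake) (simp add: ptake_def)

lemma prefix_iff_ptake: "(\<exists>w. \<rho>' = (fst \<rho>, snd \<rho> @ w)) \<longleftrightarrow> (\<exists>i \<le> plen \<rho>'. \<rho> = ptake i \<rho>')" (is "?l = ?r")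
proof
  assume ?l
  then obtain w where "\<rho>' = (fst \<rho>, snd \<rho> @ w)" by blast
  then show ?r by (intro exI[of _ "plen \<rho>"]) (auto simp: ptake_def plen_def)
next
  assume ?r
  then obtain i where "\<rho> = ptake i \<rho>'" by blast
  then show ?l by (intro exI[of _ "drop i (snd \<rho>')"]) (auto simp: ptake_def)
qed

lemma is_path_ends:
  assumes "dgraph_wf G" "is_path G \<rho>"
  shows "pfirst \<rho> \<in> nodes G" "plast \<rho> \<in> nodes G"
proof -
  obtain v w where "\<rho> = (v, w)" by fastforce
  moreover have "plast (v, w) \<in> nodes G" if "is_path G (v, w)" for v w
    using that by (induction w arbitrary: v) (use assms(1) in auto)
  ultimately show "pfirst \<rho> \<in> nodes G" "plast \<rho> \<in> nodes G"
    using assms(2) by (auto simp: pfirst_def is_path_def)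
qed

lemma sat_FPrefix:
  assumes "dgraph_wf G" "is_path G (\<pi> p)" "is_path G (\<pi> q)"
  shows "fo_sat G \<nu> \<pi> (FPrefix p q) \<longleftrightarrow> (\<exists>i \<le> plen (\<pi> q). \<pi> p = ptake i (\<pi> q))"
  using prefix_rdpa_accepts[OF assms] by (simp add: FPrefix_def prefix_iff_ptake)

lemma sat_FSameEnd_FSameStart:
  assumes "dgraph_wf G" "is_path G (\<pi> p)" "is_path G (\<pi> q)"
  shows sat_FSameEnd: "fo_sat G \<nu> \<pi> (FSameEnd p q) \<longleftrightarrow> plast (\<pi> p) = plast (\<pi> q)"
    and sat_FSameStart: "fo_sat G \<nu> \<pi> (FSameStart p q) \<longleftrightarrow> pfirst (\<pi> p) = pfirst (\<pi> q)"
  using is_path_ends[OF assms(1,2)] is_path_ends[OF assms(1,3)] by (auto simp: FSameEnd_def FSameStart_def)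

text \<open>The two distinctness hypotheses keep the quantified paths from overwriting
  \<open>p\<close> and \<open>q\<close>, but leave \<open>p = q\<close> possible: that case arises
  when \<open>WData\<close> compares a position with itself.\<close>

lemma sat_FSameData:
  assumes G: "dgraph_wf G" and p: "is_path G (\<pi> p)" "is_path G (\<pi> q)" and d: "distinct [r, s, p]" "distinct [r, s, q]"
  shows "fo_sat G \<nu> \<pi> (FSameData r s p q) \<longleftrightarrow> dataof G (plast (\<pi> p)) = dataof G (plast (\<pi> q))"
proof -
  have "fo_sat G \<nu> \<pi> (FSameData r s p q) \<longleftrightarrow> (\<exists>\<rho>. is_path G \<rho> \<and> (\<exists>\<rho>'. is_path G \<rho>' \<and>
      plast (\<pi> p) = plast \<rho> \<and> plast (\<pi> q) = plast \<rho>' \<and>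
      snd \<rho> = [] \<and> snd \<rho>' = [] \<and> dataof G (fst \<rho>) = dataof G (fst \<rho>')))"
    unfolding FSameData_def fo_sat.simps using d p
    by (intro ex_cong1 conj_cong refl) (simp_all add: sat_FSameEnd[OF G] data_rdpa_accepts)
  also have "\<dots> \<longleftrightarrow> dataof G (plast (\<pi> p)) = dataof G (plast (\<pi> q))"
    using is_path_ends(2)[OF G p(1)] is_path_ends(2)[OF G p(2)]
    by auto
  finally show ?thesis .
qed

lemma sat_FSimple:
  assumes G: "dgraph_wf G" and p: "is_path G (\<pi> p)" and d: "distinct [r, s, p]"
  shows "fo_sat G \<nu> \<pi> (FSimple r s p) \<longleftrightarrow> simple_path (\<pi> p)"
proof -
  let ?\<rho> = "\<pi> p"
  have "fo_sat G \<nu> \<pi> (FSimple r s p) \<longleftrightarrow> \<not> (\<exists>\<rho>. is_path G \<rho> \<and> (\<exists>\<rho>'. is_path G \<rho>' \<and>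
     ((\<exists>i \<le> plen ?\<rho>. \<rho> = ptake i ?\<rho>) \<and> (\<exists>i \<le> plen ?\<rho>. \<rho>' = ptake i ?\<rho>)) \<and> plast \<rho> = plast \<rho>' \<and> \<rho> \<noteq> \<rho>'))"
    (is "_ \<longleftrightarrow> \<not> ?E") unfolding FSimple_def fo_sat.simps using d p
    by (intro arg_cong[where f = Not] ex_cong1 conj_cong refl) (simp_all add: sat_FSameEnd[OF G] sat_FPrefix[OF G])
  also have "\<dots> \<longleftrightarrow> (\<forall>i \<le> plen ?\<rho>. \<forall>j \<le> plen ?\<rho>. pnode ?\<rho> i = pnode ?\<rho> j \<longrightarrow> i = j)"
  proof (intro iffI allI impI notI)
    fix i j assume n: "\<not> ?E"
      and ij: "i \<le> plen ?\<rho>" "j \<le> plen ?\<rho>" "pnode ?\<rho> i = pnode ?\<rho> j"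
    have "plast (ptake i ?\<rho>) = plast (ptake j ?\<rho>)" using ij by (simp add: plast_ptake)
    then have "ptake i ?\<rho> = ptake j ?\<rho>" using n ij is_path_ptake[OF p] by blast
    from arg_cong[OF this, of plen] show "i = j" using ij by simp
  next
    assume u: "\<forall>i \<le> plen ?\<rho>. \<forall>j \<le> plen ?\<rho>. pnode ?\<rho> i = pnode ?\<rho> j \<longrightarrow> i = j"
      and ?E
    then obtain i j where "i \<le> plen ?\<rho>" "j \<le> plen ?\<rho>" "plast (ptake i ?\<rho>) = plast (ptake j ?\<rho>)"
      "ptake i ?\<rho> \<noteq> ptake j ?\<rho>" by blast
    moreover from this(1-3) have "i = j" using u by (simp add: plast_ptake)
    ultimately show False by simp
  qed
  also have "\<dots> \<longleftrightarrow> simple_path ?\<rho>"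
    unfolding simple_path_def distinct_map inj_on_def by (auto simp: less_Suc_eq_le simp del: upt_Suc)
  finally show ?thesis .
qed

section \<open>Walk logic\<close>

fun wl_paths :: "'a wl \<Rightarrow> nat set" where
  "wl_paths (WE a l m) = {snd l, snd m}"
| "wl_paths (WLess l m) = {snd l, snd m}"
| "wl_paths (WId l m) = {snd l, snd m}"
| "wl_paths (WData l m) = {snd l, snd m}"
| "wl_paths (WNot \<phi>) = wl_paths \<phi>"
| "wl_paths (WOr \<phi> \<psi>) = wl_paths \<phi> \<union> wl_paths \<psi>"
| "wl_paths (WExPos l \<phi>) = insert (snd l) (wl_paths \<phi>)"
| "wl_paths (WExP p \<phi>) = insert p (wl_paths \<phi>)"

lemma finite_wl_paths: "finite (wl_paths \<phi>)"
  by (induction \<phi>) auto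

text \<open>A position of a path is represented by the prefix ending there, stored in a path variable that exceeds
  the bound \<open>N\<close> on the path variables of the formula.\<close>

definition pos_path :: "nat \<Rightarrow> posvar \<Rightarrow> nat" where
  "pos_path N l = N + 2 + prod_encode l"

lemma pos_path_simps [simp]:
  "pos_path N l = pos_path N m \<longleftrightarrow> l = m" "pos_path N l \<noteq> N" "N \<noteq> pos_path N l"
  "pos_path N l \<noteq> Suc N" "Suc N \<noteq> pos_path N l"
  by (auto simp: pos_path_def)

text \<open>\<open>N\<close> and \<open>Suc N\<close> are scratch variables for comparing data,
  which is why \<open>pos_path\<close> starts at \<open>N + 2\<close>. The length of a prefix is the
  position it stands for and its last label is the one read by \<open>WE\<close>, so automata on
  prefixes settle the order atoms.\<close>

fun wl_fo :: "nat \<Rightarrow> 'a wl \<Rightarrow> 'a fo" where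
  "wl_fo N (WE a l m) = FIn [pos_path N l, pos_path N m] (succ_rdpa a)"
| "wl_fo N (WLess l m) = FIn [pos_path N l, pos_path N m] less_rdpa"
| "wl_fo N (WId l m) = FSameEnd (pos_path N l) (pos_path N m)"
| "wl_fo N (WData l m) = FSameData N (Suc N) (pos_path N l) (pos_path N m)"
| "wl_fo N (WNot \<phi>) = FNot (wl_fo N \<phi>)"
| "wl_fo N (WOr \<phi> \<psi>) = FNot (FAnd (FNot (wl_fo N \<phi>)) (FNot (wl_fo N \<psi>)))"
| "wl_fo N (WExPos l \<phi>) = FExP (pos_path N l) (FAnd (FPrefix (pos_path N l) (snd l)) (wl_fo N \<phi>))"
| "wl_fo N (WExP p \<phi>) = FExP p (wl_fo N \<phi>)"

lemma wl_fo_wf: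
  assumes "finite (UNIV :: 'a set)" shows "fo_wf (wl_fo N (\<phi> :: 'a wl))"
  by (induction \<phi>) (simp_all add: FO_macros_wf[OF assms] binary_rdpas_wf[OF assms] binary_rdpas_arity)

text \<open>Two assignments are kept in step: they agree below \<open>N\<close>, and each free
  position variable is mirrored by a prefix of its path. \<open>FPrefix\<close> makes the quantifier
  over a prefix variable range over exactly the positions of that path.\<close>

lemma sat_wl_fo:
  assumes G: "dgraph_wf G"
  shows "wl_wf \<phi> \<Longrightarrow> \<forall>p\<in>wl_paths \<phi>. p < N \<Longrightarrow> \<forall>p. is_path G (\<pi>' p) \<Longrightarrow> \<forall>p<N. \<pi>' p = \<pi> p \<Longrightarrow>
    \<forall>l\<in>wl_fpos \<phi>. pos l \<le> plen (\<pi> (snd l)) \<and> \<pi>' (pos_path N l) = ptake (pos l) (\<pi> (snd l)) \<Longrightarrow>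
    fo_sat G \<nu> \<pi>' (wl_fo N \<phi>) = wl_sat G \<pi> pos \<phi>"
proof (induction \<phi> arbitrary: \<pi> \<pi>' pos)
  case (WE a l m)
  then show ?case by (auto simp: succ_rdpa_accepts plabel_ptake)
next
  case (WLess l m)
  then show ?case by (auto simp: less_rdpa_accepts)
next
  case (WId l m)
  then have "is_path G (\<pi>' (pos_path N l))" "is_path G (\<pi>' (pos_path N m))" by blast+
  from sat_FSameEnd[OF G this] show ?case using WId.prems(5) by (simp add: plast_ptake)
next
  case (WData l m)
  then have "is_path G (\<pi>' (pos_path N l))" "is_path G (\<pi>' (pos_path N m))" by blast+
  from sat_FSameData[OF G this, of N "Suc N"] show ?case using WData.prems(5) by (simp add: plast_ptake)
next
  case (WNot \<phi>)
  then show ?case by simp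
next
  case (WOr \<phi> \<psi>)
  have "fo_sat G \<nu> \<pi>' (wl_fo N \<phi>) = wl_sat G \<pi> pos \<phi>" using WOr.prems by (intro WOr.IH(1)) auto
  moreover have "fo_sat G \<nu> \<pi>' (wl_fo N \<psi>) = wl_sat G \<pi> pos \<psi>" using WOr.prems by (intro WOr.IH(2)) auto
  ultimately show ?case by simp
next
  case (WExPos l \<phi>)
  have l: "snd l < N" "\<pi>' (snd l) = \<pi> (snd l)" "is_path G (\<pi> (snd l))" "pos_path N l \<noteq> snd l"
    using WExPos.prems(2,3,4) by (auto simp: pos_path_def) metis
  have "fo_sat G \<nu> (\<pi>'(pos_path N l := ptake i (\<pi> (snd l)))) (wl_fo N \<phi>) = wl_sat G \<pi> (pos(l := i)) \<phi>"
    if "i \<le> plen (\<pi> (snd l))" for i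
    using WExPos.prems that l is_path_ptake[OF l(3) that]
    by (intro WExPos.IH) (auto simp: pos_path_def)
  then have "(\<exists>i \<le> plen (\<pi> (snd l)). wl_sat G \<pi> (pos(l := i)) \<phi>) \<longleftrightarrow>
    (\<exists>\<rho>. is_path G \<rho> \<and> (\<exists>i \<le> plen (\<pi> (snd l)). \<rho> = ptake i (\<pi> (snd l))) \<and> fo_sat G \<nu> (\<pi>'(pos_path N l := \<rho>)) (wl_fo N \<phi>))"
    using is_path_ptake[OF l(3)] by metis
  then show ?case using l by (simp add: sat_FPrefix[OF G] cong: conj_cong)
next
  case (WExP p \<phi>)
  \<comment> \<open>Reassigning \<open>p\<close> keeps the mirrored prefixes correct:
    \<open>wl_wf\<close> excludes free position variables of sort \<open>p\<close>, and
    \<open>p < N\<close> differs from every variable \<open>pos_path N l\<close>.\<close>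
  have "fo_sat G \<nu> (\<pi>'(p := \<rho>)) (wl_fo N \<phi>) = wl_sat G (\<pi>(p := \<rho>)) pos \<phi>" if "is_path G \<rho>" for \<rho>
    using WExP.prems that by (intro WExP.IH) (auto simp: pos_path_def)
  then show ?case by auto
qed

lemma WL_subsumed_ERDPQ:
  assumes "finite (UNIV :: 'a set)"
  shows "subsumed TYPE(('a, 'v, 'i, 'd) dgraph) WL wl_query ERDPQ fo_sat"
  unfolding subsumed_def
proof
  fix \<phi> :: "'a wl" assume \<phi>: "\<phi> \<in> WL"
  obtain N where N: "\<forall>p\<in>wl_paths \<phi>. p < N"
    using finite_wl_paths finite_nat_set_iff_bounded by blast
  show "\<exists>\<psi>\<in>ERDPQ. \<forall>(G :: ('a, 'v, 'i, 'd) dgraph) \<nu> \<pi>. dgraph_wf G \<longrightarrow> valid_asg G \<nu> \<pi> \<longrightarrow> wl_query G \<nu> \<pi> \<phi> = fo_sat G \<nu> \<pi> \<psi>"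
  proof (intro bexI[of _ "wl_fo N \<phi>"] allI impI)
    fix G :: "('a, 'v, 'i, 'd) dgraph" and \<nu> \<pi> assume G: "dgraph_wf G" "valid_asg G \<nu> \<pi>"
    show "wl_query G \<nu> \<pi> \<phi> = fo_sat G \<nu> \<pi> (wl_fo N \<phi>)" unfolding wl_query_def
      by (rule sat_wl_fo[OF G(1), symmetric]) (use \<phi> N G(2) in \<open>auto simp: WL_def valid_asg_def\<close>)
  qed (simp add: ERDPQ_def wl_fo_wf[OF assms])
qed

section \<open>Regular expressions over register operations\<close>

text \<open>Updates are given for id-registers only: the data-register of the same number always carries the data value of
  the node in the id-register.\<close>

type_synonym reg_op = "gatom set \<times> (nat \<Rightarrow> iterm option)"

datatype 'a rx = Op reg_op | Step "'a set" | Seq "'a rx" "'a rx" | Alt "'a rx" "'a rx" | Star "'a rx"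

type_synonym ('a, 'v) conf = "(nat \<Rightarrow> 'v option) \<times> 'v \<times> ('a \<times> 'v) list"

definition data_regs :: "('a, 'v, 'i, 'd) dgraph \<Rightarrow> (nat \<Rightarrow> 'v option) \<Rightarrow> nat \<Rightarrow> 'd option" where
  "data_regs G m k = map_option (dataof G) (m k)"

definition op_rel :: "('a, 'v, 'i, 'd) dgraph \<Rightarrow> reg_op \<Rightarrow> (('a, 'v) conf \<times> ('a, 'v) conf) set" where
  "op_rel G p = {((m, v, w), (m', v', w')). v' = v \<and> w' = w \<and>
     (\<forall>c\<in>fst p. gatom_sat m (data_regs G m) (node_letter G v) c) \<and> m' = iupdate m (node_letter G v) (snd p)}"

text \<open>No edge is checked, because expressions are only run on words that continue a path of
  the graph, as \<open>captures\<close> and \<open>aut_accepts\<close> assume.\<close>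

definition step_rel :: "'a set \<Rightarrow> (('a, 'v) conf \<times> ('a, 'v) conf) set" where
  "step_rel X = {((m, v, w), (m', v', w')). m' = m \<and> (\<exists>a\<in>X. w = (a, v') # w')}"

primrec rx_sem :: "('a, 'v, 'i, 'd) dgraph \<Rightarrow> 'a rx \<Rightarrow> (('a, 'v) conf \<times> ('a, 'v) conf) set" where
  "rx_sem G (Op p) = op_rel G p"
| "rx_sem G (Step X) = step_rel X"
| "rx_sem G (Seq e f) = rx_sem G e O rx_sem G f"
| "rx_sem G (Alt e f) = rx_sem G e \<union> rx_sem G f"
| "rx_sem G (Star e) = (rx_sem G e)\<^sup>*"

section \<open>The stack machine running an expression\<close>

definition skip_op :: reg_op where "skip_op = ({}, \<lambda>_. None)"

lemma op_rel_skip [simp]: "op_rel G skip_op = Id"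
  by (auto simp: op_rel_def skip_op_def)

text \<open>The stack is the continuation, the expressions still to be matched in order. Structural
  steps perform \<open>skip_op\<close>; only a popped \<open>Op\<close> acts on the
  registers.\<close>

inductive silent :: "'a rx list \<Rightarrow> reg_op \<Rightarrow> 'a rx list \<Rightarrow> bool" where
  "silent (Op p # s) p s"
| "silent (Seq e f # s) skip_op (e # f # s)"
| "silent (Alt e f # s) skip_op (e # s)"
| "silent (Alt e f # s) skip_op (f # s)"
| "silent (Star e # s) skip_op s"
| "silent (Star e # s) skip_op (e # Star e # s)"

definition machine :: "('a, 'v, 'i, 'd) dgraph \<Rightarrow> (('a rx list \<times> ('a, 'v) conf) \<times> ('a rx list \<times> ('a, 'v) conf)) set" where
  "machine G = {((s, c), (s', c')). (\<exists>p. silent s p s' \<and> (c, c') \<in> op_rel G p) \<or>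
     (\<exists>X. s = Step X # s' \<and> (c, c') \<in> step_rel X)}"

lemma machine_silent: "silent s p s' \<Longrightarrow> (c, c') \<in> op_rel G p \<Longrightarrow> ((s, c), (s', c')) \<in> machine G"
  unfolding machine_def by blast

definition stack_sem :: "('a, 'v, 'i, 'd) dgraph \<Rightarrow> 'a rx list \<Rightarrow> (('a, 'v) conf \<times> ('a, 'v) conf) set" where
  "stack_sem G s = foldr (\<lambda>e R. rx_sem G e O R) s Id"

lemma stack_sem_simps [simp]:
  "stack_sem G [] = Id" "stack_sem G (e # s) = rx_sem G e O stack_sem G s"
  by (simp_all add: stack_sem_def)

lemma silent_sound: "silent s p s' \<Longrightarrow> op_rel G p O stack_sem G s' \<subseteq> stack_sem G s"
proof (induction rule: silent.induct)
  case (6 e s)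
  have "rx_sem G e O (rx_sem G e)\<^sup>* \<subseteq> (rx_sem G e)\<^sup>*" by (blast intro: converse_rtrancl_into_rtrancl)
  then have "(rx_sem G e O (rx_sem G e)\<^sup>*) O stack_sem G s \<subseteq> (rx_sem G e)\<^sup>* O stack_sem G s"
    by (rule relcomp_mono) simp
  then show ?case by (simp add: O_assoc)
next
  case (5 e s)
  have "Id O stack_sem G s \<subseteq> (rx_sem G e)\<^sup>* O stack_sem G s" by (rule relcomp_mono) auto
  then show ?case by simp
qed (simp_all add: O_assoc relcomp_distrib2)

lemma machine_sound:
  assumes "(z, ([], c')) \<in> (machine G)\<^sup>*" shows "(snd z, c') \<in> stack_sem G (fst z)"
  using assms
proof (induction rule: converse_rtrancl_induct)
  case base then show ?case by simp
next
  case (step z z')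
  from step.hyps(1) consider p where "silent (fst z) p (fst z')" "(snd z, snd z') \<in> op_rel G p"
    | X where "fst z = Step X # fst z'" "(snd z, snd z') \<in> step_rel X"
    unfolding machine_def by force
  then show ?case
  proof cases
    case 1
    show ?thesis using silent_sound[OF 1(1), of G] 1(2) step.IH by blast
  next
    case 2
    have "stack_sem G (fst z) = step_rel X O stack_sem G (fst z')" by (simp add: 2(1))
    then show ?thesis using step.IH 2(2) by blast
  qed
qed

text \<open>The rest \<open>s\<close> of the stack is arbitrary, because in the cases of sequence
  and star the inductive hypotheses are applied above further entries.\<close>

lemma machine_complete:
  "(c, c') \<in> rx_sem G e \<Longrightarrow> ((e # s, c), (s, c')) \<in> (machine G)\<^sup>*"
proof (induction e arbitrary: c c' s)
  case (Op p)
  then have "(c, c') \<in> op_rel G p" by simp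
  from machine_silent[OF silent.intros(1) this] show ?case by blast
next
  case (Step X)
  then have "(c, c') \<in> step_rel X" by simp
  then have "((Step X # s, c), (s, c')) \<in> machine G" unfolding machine_def by blast
  then show ?case by blast
next
  case (Seq e f)
  then obtain c1 where "(c, c1) \<in> rx_sem G e" "(c1, c') \<in> rx_sem G f" by auto
  with Seq.IH have "((e # f # s, c), (s, c')) \<in> (machine G)\<^sup>*" by (meson rtrancl_trans)
  moreover have "((Seq e f # s, c), (e # f # s, c)) \<in> machine G"
    by (rule machine_silent[OF silent.intros(2)]) simp
  ultimately show ?case by (rule converse_rtrancl_into_rtrancl[rotated])
next
  case (Alt e f)
  have "((Alt e f # s, c), (e # s, c)) \<in> machine G" "((Alt e f # s, c), (f # s, c)) \<in> machine G"
    by (rule machine_silent[OF silent.intros(3)], simp) (rule machine_silent[OF silent.intros(4)], simp)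
  moreover have "((e # s, c), (s, c')) \<in> (machine G)\<^sup>* \<or> ((f # s, c), (s, c')) \<in> (machine G)\<^sup>*"
    using Alt.prems Alt.IH unfolding rx_sem.simps by blast
  ultimately show ?case by (meson converse_rtrancl_into_rtrancl)
next
  case (Star e)
  from Star.prems have "(c, c') \<in> (rx_sem G e)\<^sup>*" by simp
  then show ?case
  proof (induction rule: converse_rtrancl_induct)
    case base
    show ?case by (rule r_into_rtrancl, rule machine_silent[OF silent.intros(5)]) simp
  next
    case (step c c1)
    have "((Star e # s, c), (e # Star e # s, c)) \<in> machine G"
      by (rule machine_silent[OF silent.intros(6)]) simp
    moreover have "((e # Star e # s, c), (Star e # s, c1)) \<in> (machine G)\<^sup>*" by (rule Star.IH[OF step.hyps(1)])
    ultimately show ?case using step.IH by (meson converse_rtrancl_into_rtrancl rtrancl_trans)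
  qed
qed

lemma machine_iff: "(([e], c), ([], c')) \<in> (machine G)\<^sup>* \<longleftrightarrow> (c, c') \<in> rx_sem G e"
  using machine_sound[of "([e], c)" c' G] machine_complete[of c c' G e "[]"] by auto

text \<open>The stacks reachable from \<open>[e]\<close>, apart from the empty one; this set is finite because a
  starred expression is only ever pushed below pieces of its own body.\<close>

fun stacks :: "'a rx \<Rightarrow> 'a rx list set" where
  "stacks (Op p) = {[Op p]}"
| "stacks (Step X) = {[Step X]}"
| "stacks (Seq e f) = {[Seq e f]} \<union> (\<lambda>t. t @ [f]) ` stacks e \<union> stacks f"
| "stacks (Alt e f) = {[Alt e f]} \<union> stacks e \<union> stacks f"
| "stacks (Star e) = {[Star e]} \<union> (\<lambda>t. t @ [Star e]) ` stacks e"

lemma finite_stacks: "finite (stacks e)"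
  by (induction e) auto

lemma stacks_self: "[e] \<in> stacks e"
  by (cases e) auto

lemma stacks_nonempty: "s \<in> stacks e \<Longrightarrow> s \<noteq> []"
  by (induction e arbitrary: s) auto

text \<open>A silent step inspects and changes only the top of the stack, so it does not notice
  entries below.\<close>

lemma silent_append: "silent (t @ r) p s' \<Longrightarrow> t \<noteq> [] \<Longrightarrow> \<exists>t'. s' = t' @ r \<and> silent t p t'"
  by (cases t; auto elim!: silent.cases intro: silent.intros)

lemma stacks_silent: "s \<in> stacks e \<Longrightarrow> silent s p s' \<Longrightarrow> s' \<in> insert [] (stacks e)"
proof (induction e arbitrary: s s')
  case (Seq e f)
  then consider "s = [Seq e f]" | t where "t \<in> stacks e" "s = t @ [f]" | "s \<in> stacks f" by auto
  then show ?case
  proof cases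
    case 1
    then show ?thesis using Seq.prems(2) stacks_self[of e] by (auto elim: silent.cases)
  next
    case 2
    then obtain t' where "s' = t' @ [f]" "silent t p t'"
      using silent_append[of t "[f]"] Seq.prems(2) stacks_nonempty by blast
    with 2 Seq.IH(1)[of t t'] show ?thesis using stacks_self[of f] by auto
  next
    case 3
    with Seq.IH(2) Seq.prems(2) show ?thesis by auto
  qed
next
  case (Alt e f)
  then consider "s = [Alt e f]" | "s \<in> stacks e" | "s \<in> stacks f" by auto
  then show ?case
  proof cases
    case 1
    then show ?thesis using Alt.prems(2) stacks_self[of e] stacks_self[of f] by (auto elim: silent.cases)
  qed (use Alt in auto)
next
  case (Star e)
  then consider "s = [Star e]" | t where "t \<in> stacks e" "s = t @ [Star e]" by auto
  then show ?case
  proof cases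
    case 1
    then show ?thesis using Star.prems(2) stacks_self[of e] by (auto elim: silent.cases)
  next
    case 2
    then obtain t' where "s' = t' @ [Star e]" "silent t p t'"
      using silent_append[of t "[Star e]"] Star.prems(2) stacks_nonempty by blast
    with 2 Star.IH[of t t'] show ?thesis by auto
  qed
qed (auto elim: silent.cases)

lemma stacks_step: "Step X # s' \<in> stacks e \<Longrightarrow> s' \<in> insert [] (stacks e)"
proof (induction e arbitrary: s')
  case (Seq e f)
  then consider t where "t \<in> stacks e" "Step X # s' = t @ [f]" | "Step X # s' \<in> stacks f" by auto
  then show ?case
  proof cases
    case 1
    then obtain t' where "t = Step X # t'" "s' = t' @ [f]" using stacks_nonempty by (cases t) auto
    with 1 Seq.IH(1)[of t'] show ?thesis using stacks_self[of f] by auto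
  qed (use Seq in auto)
next
  case (Star e)
  then obtain t where t: "t \<in> stacks e" "Step X # s' = t @ [Star e]" by auto
  then obtain t' where "t = Step X # t'" "s' = t' @ [Star e]" using stacks_nonempty by (cases t) auto
  with t Star.IH[of t'] show ?case by auto
qed auto

section \<open>From regular expressions to unary automata\<close>

definition iterms :: "nat \<Rightarrow> iterm set" where
  "iterms N = IReg ` {..<N} \<union> {IIn 0, ISharp}"

definition dterms :: "nat \<Rightarrow> dterm set" where
  "dterms N = DReg ` {..<N} \<union> {DIn 0, DSharp}"

definition gatoms :: "nat \<Rightarrow> gatom set" where
  "gatoms N = case_prod IEq ` (iterms N \<times> iterms N) \<union> case_prod INeq ` (iterms N \<times> iterms N) \<union>
     case_prod DEq ` (dterms N \<times> dterms N) \<union> case_prod DNeq ` (dterms N \<times> dterms N)"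

text \<open>The shape of the second component follows \<open>finite_set_of_finite_funs\<close>,
  which gives finiteness; \<open>reg_ops_iff\<close> is the working form.\<close>

definition reg_ops :: "nat \<Rightarrow> reg_op set" where
  "reg_ops N = Pow (gatoms N) \<times>
     {u. \<forall>k. (k \<in> {..<N} \<longrightarrow> u k \<in> insert None (Some ` iterms N)) \<and> (k \<notin> {..<N} \<longrightarrow> u k = None)}"

lemma gatoms_iff:
  "IEq s t \<in> gatoms N \<longleftrightarrow> s \<in> iterms N \<and> t \<in> iterms N" "INeq s t \<in> gatoms N \<longleftrightarrow> s \<in> iterms N \<and> t \<in> iterms N"
  "DEq x y \<in> gatoms N \<longleftrightarrow> x \<in> dterms N \<and> y \<in> dterms N" "DNeq x y \<in> gatoms N \<longleftrightarrow> x \<in> dterms N \<and> y \<in> dterms N"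
  by (auto simp: gatoms_def image_iff)

lemma finite_gatoms: "finite (gatoms N)"
  by (simp add: gatoms_def iterms_def dterms_def)

lemma finite_reg_ops: "finite (reg_ops N)"
  unfolding reg_ops_def
  by (intro finite_cartesian_product finite_set_of_finite_funs) (simp_all add: finite_gatoms iterms_def)

lemma reg_ops_iff:
  "(g, u) \<in> reg_ops N \<longleftrightarrow> g \<subseteq> gatoms N \<and> (\<forall>k t. u k = Some t \<longrightarrow> k < N \<and> t \<in> iterms N)"
proof -
  have "((k \<in> {..<N} \<longrightarrow> u k \<in> insert None (Some ` iterms N)) \<and> (k \<notin> {..<N} \<longrightarrow> u k = None)) \<longleftrightarrow>
      (\<forall>t. u k = Some t \<longrightarrow> k < N \<and> t \<in> iterms N)" for k
    by (cases "u k") auto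
  then show ?thesis unfolding reg_ops_def by simp
qed

lemma skip_op_in: "skip_op \<in> reg_ops N"
  by (simp add: skip_op_def reg_ops_iff)

section \<open>Composition of register operations\<close>

fun dterm_of :: "iterm \<Rightarrow> dterm" where
  "dterm_of (IReg k) = DReg k"
| "dterm_of (IIn j) = DIn j"
| "dterm_of ISharp = DSharp"

definition data_upd :: "(nat \<Rightarrow> iterm option) \<Rightarrow> nat \<Rightarrow> dterm option" where
  "data_upd u k = map_option dterm_of (u k)"

lemma deval_dterm_of:
  "t \<in> iterms N \<Longrightarrow> deval (data_regs G m) (node_letter G v) (dterm_of t) = map_option (dataof G) (ieval m (node_letter G v) t)"
  by (auto simp: iterms_def node_letter_def data_regs_def)

text \<open>If the data update mirrors the id update term by term, each data-register keeps the data
  value of the node in the id-register of the same number.\<close>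

lemma data_regs_update:
  assumes "(g, u) \<in> reg_ops N"
  shows "data_regs G (iupdate m (node_letter G v) u) = dupdate (data_regs G m) (node_letter G v) (data_upd u)"
proof
  fix k
  show "data_regs G (iupdate m (node_letter G v) u) k = dupdate (data_regs G m) (node_letter G v) (data_upd u) k"
    using assms deval_dterm_of[of _ N G m v]
    by (cases "u k") (auto simp: reg_ops_iff data_upd_def dupdate_def iupdate_def data_regs_def)
qed

fun isub :: "(nat \<Rightarrow> iterm option) \<Rightarrow> iterm \<Rightarrow> iterm" where
  "isub u (IReg k) = (case u k of None \<Rightarrow> IReg k | Some t \<Rightarrow> t)"
| "isub u t = t"

fun dsub :: "(nat \<Rightarrow> iterm option) \<Rightarrow> dterm \<Rightarrow> dterm" where
  "dsub u (DReg k) = (case u k of None \<Rightarrow> DReg k | Some t \<Rightarrow> dterm_of t)"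
| "dsub u t = t"

fun gsub :: "(nat \<Rightarrow> iterm option) \<Rightarrow> gatom \<Rightarrow> gatom" where
  "gsub u (IEq s t) = IEq (isub u s) (isub u t)"
| "gsub u (INeq s t) = INeq (isub u s) (isub u t)"
| "gsub u (DEq s t) = DEq (dsub u s) (dsub u t)"
| "gsub u (DNeq s t) = DNeq (dsub u s) (dsub u t)"

text \<open>Guards of the second operation are pulled back through the update of the first, as in a
  weakest precondition. Both operations read the same letter, so input terms are fixed by the
  substitution.\<close>

definition op_comp :: "reg_op \<Rightarrow> reg_op \<Rightarrow> reg_op" where
  "op_comp p q = (fst p \<union> gsub (snd p) ` fst q,
     \<lambda>k. case snd q k of None \<Rightarrow> snd p k | Some t \<Rightarrow> Some (isub (snd p) t))"

lemma isub_in: "(g, u) \<in> reg_ops N \<Longrightarrow> t \<in> iterms N \<Longrightarrow> isub u t \<in> iterms N"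
  by (cases t) (auto simp: reg_ops_iff iterms_def split: option.split)

lemma dterm_of_in: "t \<in> iterms N \<Longrightarrow> dterm_of t \<in> dterms N"
  by (auto simp: iterms_def dterms_def)

lemma dsub_in: "(g, u) \<in> reg_ops N \<Longrightarrow> t \<in> dterms N \<Longrightarrow> dsub u t \<in> dterms N"
proof (cases t)
  case (DReg k)
  assume "(g, u) \<in> reg_ops N" "t \<in> dterms N"
  then show ?thesis using dterm_of_in[of "the (u k)" N]
    by (cases "u k") (auto simp: DReg reg_ops_iff)
qed (auto simp: dterms_def)

lemma gsub_in: "(g, u) \<in> reg_ops N \<Longrightarrow> c \<in> gatoms N \<Longrightarrow> gsub u c \<in> gatoms N"
  by (cases c) (simp_all add: gatoms_iff isub_in dsub_in)

lemma op_comp_in: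
  assumes "p \<in> reg_ops N" "q \<in> reg_ops N" shows "op_comp p q \<in> reg_ops N"
proof -
  obtain g u h w where p: "p = (g, u)" "q = (h, w)" by fastforce
  have "isub u t \<in> iterms N" if "w k = Some t" for k t
    using assms that by (auto simp: p reg_ops_iff intro: isub_in[of g])
  moreover have "gsub u ` h \<subseteq> gatoms N" using assms gsub_in[of g u N] unfolding p reg_ops_iff by blast
  ultimately show ?thesis using assms by (auto simp: p op_comp_def reg_ops_iff split: option.splits)
qed

lemma ieval_isub: "ieval m l (isub u t) = ieval (iupdate m l u) l t"
  by (cases t) (auto simp: iupdate_def split: option.split)

lemma deval_dsub: "deval m l (dsub u t) = deval (dupdate m l (data_upd u)) l t"
  by (cases t) (auto simp: dupdate_def data_upd_def split: option.split)

text \<open>Evaluating a substituted term before the update equals evaluating the term after it. For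
  data terms this uses \<open>p \<in> reg_ops N\<close>, by which the data-registers follow the
  id-registers.\<close>

lemma op_rel_comp:
  assumes "p \<in> reg_ops N"
  shows "op_rel G (op_comp p q) = op_rel G p O op_rel G q"
proof -
  have sat: "gatom_sat m (data_regs G m) (node_letter G v) (gsub (snd p) c) =
      gatom_sat (iupdate m (node_letter G v) (snd p)) (data_regs G (iupdate m (node_letter G v) (snd p))) (node_letter G v) c" for m v c
    using data_regs_update[of "fst p" "snd p" N G m v] assms
    by (cases c) (simp_all add: ieval_isub deval_dsub)
  have upd: "iupdate m l (snd (op_comp p q)) = iupdate (iupdate m l (snd p)) l (snd q)" for m :: "nat \<Rightarrow> 'v option" and l :: "('v, 'd) dlet"
  proof
    fix k
    show "iupdate m l (snd (op_comp p q)) k = iupdate (iupdate m l (snd p)) l (snd q) k"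
    proof (cases "snd q k")
      case None
      then show ?thesis by (simp add: iupdate_def op_comp_def)
    next
      case (Some t)
      then have "iupdate m l (snd (op_comp p q)) k = ieval m l (isub (snd p) t)" by (simp add: iupdate_def op_comp_def)
      also have "\<dots> = iupdate (iupdate m l (snd p)) l (snd q) k" unfolding ieval_isub using Some by (simp add: iupdate_def)
      finally show ?thesis .
    qed
  qed
  show ?thesis
  proof (intro equalityI subrelI)
    fix c c' assume "(c, c') \<in> op_rel G (op_comp p q)"
    moreover obtain m v w where c: "c = (m, v, w)" by (cases c) auto
    ultimately have c': "c' = (iupdate (iupdate m (node_letter G v) (snd p)) (node_letter G v) (snd q), v, w)"
      and g: "\<forall>x\<in>fst (op_comp p q). gatom_sat m (data_regs G m) (node_letter G v) x" by (auto simp: op_rel_def upd)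
    show "(c, c') \<in> op_rel G p O op_rel G q"
      by (rule relcompI[of _ "(iupdate m (node_letter G v) (snd p), v, w)"])
        (use g in \<open>auto simp: c c' op_rel_def op_comp_def simp flip: sat\<close>)
  next
    fix c c' assume "(c, c') \<in> op_rel G p O op_rel G q"
    then show "(c, c') \<in> op_rel G (op_comp p q)" by (auto simp: op_rel_def upd) (auto simp: op_comp_def sat)
  qed
qed

section \<open>Silent closures and the automaton of an expression\<close>

inductive closure :: "'a rx list \<Rightarrow> reg_op \<Rightarrow> 'a rx list \<Rightarrow> bool" where
  closure_refl: "closure s skip_op s"
| closure_step: "silent s p s' \<Longrightarrow> closure s' q t \<Longrightarrow> closure s (op_comp p q) t"

primrec rx_ok :: "nat \<Rightarrow> 'a rx \<Rightarrow> bool" where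
  "rx_ok N (Op p) = (p \<in> reg_ops N)"
| "rx_ok N (Step X) = True"
| "rx_ok N (Seq e f) = (rx_ok N e \<and> rx_ok N f)"
| "rx_ok N (Alt e f) = (rx_ok N e \<and> rx_ok N f)"
| "rx_ok N (Star e) = rx_ok N e"

lemma stacks_ok: "rx_ok N e \<Longrightarrow> s \<in> stacks e \<Longrightarrow> list_all (rx_ok N) s"
  by (induction e arbitrary: s) auto

lemma silent_ok: "silent s p t \<Longrightarrow> list_all (rx_ok N) s \<Longrightarrow> p \<in> reg_ops N \<and> list_all (rx_ok N) t"
  by (induction rule: silent.induct) (auto simp: skip_op_in)

lemma closure_ok: "closure s p t \<Longrightarrow> list_all (rx_ok N) s \<Longrightarrow> p \<in> reg_ops N"
  by (induction rule: closure.induct) (auto simp: skip_op_in dest: silent_ok intro: op_comp_in)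

lemma closure_machine:
  "closure s p t \<Longrightarrow> list_all (rx_ok N) s \<Longrightarrow> (c, c') \<in> op_rel G p \<Longrightarrow> ((s, c), (t, c')) \<in> (machine G)\<^sup>*"
proof (induction arbitrary: c rule: closure.induct)
  case (closure_refl s)
  then show ?case by simp
next
  case (closure_step s p s' q t)
  note ok = silent_ok[OF closure_step.hyps(1) closure_step.prems(1)]
  from closure_step.prems(2) obtain c1 where c1: "(c, c1) \<in> op_rel G p" "(c1, c') \<in> op_rel G q"
    unfolding op_rel_comp[OF conjunct1[OF ok]] by blast
  show ?case
    by (rule converse_rtrancl_into_rtrancl[OF machine_silent[OF closure_step.hyps(1) c1(1)]])
      (rule closure_step.IH[OF conjunct2[OF ok] c1(2)])
qed

lemma silent_target: "silent s p t \<Longrightarrow> s \<in> insert [] (stacks e) \<Longrightarrow> t \<in> insert [] (stacks e)"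
  using stacks_silent[of s e p t] by (cases s) (auto elim: silent.cases)

lemma closure_target: "closure s p t \<Longrightarrow> s \<in> insert [] (stacks e) \<Longrightarrow> t \<in> insert [] (stacks e)"
  by (induction rule: closure.induct) (auto dest: silent_target)

text \<open>Operations keep their guards as sets, so that only finitely many exist over given
  registers, while transitions carry lists; some enumeration bridges the two.\<close>

definition atom_list :: "gatom set \<Rightarrow> gatom list" where
  "atom_list g = (SOME l. set l = g)"

lemma set_atom_list: "finite g \<Longrightarrow> set (atom_list g) = g"
  unfolding atom_list_def using finite_list[of g] by (rule someI_ex)

locale rx_automaton =
  fixes e :: "'a rx" and N :: nat and enc :: "'a rx list \<Rightarrow> nat"
  assumes ok: "rx_ok N e" and inj: "inj_on enc (insert [] (stacks e))" and fin: "finite (UNIV :: 'a set)"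
begin

abbreviation Q :: "'a rx list set" where "Q \<equiv> insert [] (stacks e)"

text \<open>Parity keeps data states and word states disjoint.\<close>

definition dst :: "'a rx list \<Rightarrow> nat" where "dst s = 2 * enc s"
definition wst :: "'a rx list \<Rightarrow> nat" where "wst s = 2 * enc s + 1"

definition aut :: "'a rdpa" where
  "aut = \<lparr>arity = 1, states = dst ` Q \<union> wst ` Q, wstates = wst ` Q, init = dst [e], final = {wst []},
     nireg = N, ndreg = N,
     wtrans = {(wst (Step X # t), [Some a], dst t) | X t a. Step X # t \<in> Q \<and> a \<in> X},
     dtrans = {(dst s, atom_list (fst p), snd p, data_upd (snd p), wst t) | s p t. s \<in> Q \<and> closure s p t}\<rparr>"

lemma Q_ok: "s \<in> Q \<Longrightarrow> list_all (rx_ok N) s"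
  using stacks_ok[OF ok] by auto

lemma aut_wf: "rdpa_wf aut"
proof -
  have Qf: "finite Q" by (simp add: finite_stacks)
  have "wtrans aut \<subseteq> wst ` Q \<times> ((\<lambda>a. [Some a]) ` UNIV) \<times> dst ` Q"
  proof
    fix x assume "x \<in> wtrans aut"
    then obtain X t a where x: "x = (wst (Step X # t), [Some a], dst t)" "Step X # t \<in> Q" unfolding aut_def by auto
    then have "t \<in> Q" using stacks_step by blast
    then show "x \<in> wst ` Q \<times> ((\<lambda>a. [Some a]) ` UNIV) \<times> dst ` Q" using x by blast
  qed
  then have 1: "finite (wtrans aut)"
    by (rule finite_subset) (use Qf fin in auto)
  \<comment> \<open>A closure can have infinitely many derivations, since a star may be unfolded
    again and again; finiteness comes from bounding the resulting operations and stacks.\<close>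
  have "dtrans aut \<subseteq> (\<lambda>(s, p, t). (dst s, atom_list (fst p), snd p, data_upd (snd p), wst t)) ` (Q \<times> reg_ops N \<times> Q)"
  proof
    fix x assume "x \<in> dtrans aut"
    then obtain s p t where x: "x = (dst s, atom_list (fst p), snd p, data_upd (snd p), wst t)" "s \<in> Q" "closure s p t"
      unfolding aut_def by auto
    then have "(s, p, t) \<in> Q \<times> reg_ops N \<times> Q" using closure_target closure_ok[OF _ Q_ok] by blast
    then show "x \<in> (\<lambda>(s, p, t). (dst s, atom_list (fst p), snd p, data_upd (snd p), wst t)) ` (Q \<times> reg_ops N \<times> Q)"
      by (rule image_eqI[rotated]) (simp add: x)
  qed
  then have 2: "finite (dtrans aut)"
    by (rule finite_subset) (use Qf finite_reg_ops in auto)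
  have 3: "\<forall>(p, a, q) \<in> wtrans aut. p \<in> wstates aut \<and> q \<in> states aut - wstates aut \<and> length a = arity aut"
  proof clarify
    fix p a q assume "(p, a, q) \<in> wtrans aut"
    then obtain X t b where t: "p = wst (Step X # t)" "a = [Some b]" "q = dst t" "Step X # t \<in> Q" by (auto simp: aut_def)
    have "t \<in> Q" using t(4) stacks_step by blast
    then show "p \<in> wstates aut \<and> q \<in> states aut - wstates aut \<and> length a = arity aut"
      using t by (auto simp: aut_def dst_def wst_def) presburger+
  qed
  have 4: "\<forall>(q, g, iu, du, p) \<in> dtrans aut. q \<in> states aut - wstates aut \<and> p \<in> wstates aut \<and>
        (\<forall>c \<in> set g. gatom_ok aut c) \<and>
        (\<forall>k. iu k \<noteq> None \<longrightarrow> k < nireg aut \<and> iterm_ok aut (the (iu k))) \<and>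
        (\<forall>k. du k \<noteq> None \<longrightarrow> k < ndreg aut \<and> dterm_ok aut (the (du k)))"
  proof (clarify, goal_cases)
    case (1 q g iu du p)
    then obtain s h t where t: "q = dst s" "g = atom_list h" "du = data_upd iu" "p = wst t" "s \<in> Q" "closure s (h, iu) t"
      by (auto simp: aut_def)
    have o: "(h, iu) \<in> reg_ops N" using closure_ok[OF t(6) Q_ok[OF t(5)]] .
    have tQ: "t \<in> Q" using closure_target[OF t(6,5)] .
    have i: "iterm_ok aut x" if "x \<in> iterms N" for x using that by (auto simp: iterms_def aut_def)
    have d: "dterm_ok aut x" if "x \<in> dterms N" for x using that by (auto simp: dterms_def aut_def)
    have "finite h" using o finite_subset[OF _ finite_gatoms] by (auto simp: reg_ops_iff)
    then have "set g \<subseteq> gatoms N" using o by (simp add: t set_atom_list reg_ops_iff)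
    moreover have "gatom_ok aut c" if "c \<in> gatoms N" for c using that by (cases c) (simp_all add: gatoms_iff i d)
    ultimately have "\<forall>c\<in>set g. gatom_ok aut c" by blast
    moreover have "\<forall>k. iu k \<noteq> None \<longrightarrow> k < nireg aut \<and> iterm_ok aut (the (iu k))"
      using o i by (auto simp: reg_ops_iff) (auto simp: aut_def)
    moreover have "\<forall>k. du k \<noteq> None \<longrightarrow> k < ndreg aut \<and> dterm_ok aut (the (du k))"
      using o d dterm_of_in by (auto simp: reg_ops_iff t data_upd_def) (auto simp: aut_def)
    moreover have "q \<in> states aut - wstates aut" "p \<in> wstates aut"
      using t tQ by (auto simp: aut_def dst_def wst_def) presburger+
    ultimately show ?case by blast
  qed
  have "dst [e] \<notin> wst ` Q" by (auto simp: dst_def wst_def) presburger+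
  then have "arity aut \<ge> 1" "finite (states aut)" "wstates aut \<subseteq> states aut" "init aut \<in> states aut - wstates aut"
    "final aut \<subseteq> wstates aut" using Qf stacks_self[of e] by (auto simp: aut_def)
  with 1 2 3 4 show ?thesis unfolding rdpa_wf_def by blast
qed

lemma state_eq:
  "s \<in> Q \<Longrightarrow> t \<in> Q \<Longrightarrow> dst s = dst t \<longleftrightarrow> s = t" "s \<in> Q \<Longrightarrow> t \<in> Q \<Longrightarrow> wst s = wst t \<longleftrightarrow> s = t"
  using inj_on_eq_iff[OF inj] by (auto simp: dst_def wst_def)

lemma aut_dtrans:
  assumes "s \<in> Q"
  shows "(dst s, g, iu, du, r) \<in> dtrans aut \<longleftrightarrow>
    (\<exists>h t. g = atom_list h \<and> du = data_upd iu \<and> r = wst t \<and> closure s (h, iu) t)"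
proof -
  have "(dst s, g, iu, du, r) \<in> dtrans aut \<longleftrightarrow>
    (\<exists>s' p t. dst s = dst s' \<and> g = atom_list (fst p) \<and> iu = snd p \<and> du = data_upd (snd p) \<and> r = wst t \<and> s' \<in> Q \<and> closure s' p t)"
    by (simp add: aut_def)
  also have "\<dots> \<longleftrightarrow> (\<exists>h t. g = atom_list h \<and> du = data_upd iu \<and> r = wst t \<and> closure s (h, iu) t)" (is "?l = ?r")
  proof
    assume ?l then show ?r using state_eq(1)[OF assms] by force
  next
    assume ?r
    then obtain h t where "g = atom_list h" "du = data_upd iu" "r = wst t" "closure s (h, iu) t" by blast
    with assms show ?l by (intro exI[of _ s] exI[of _ "(h, iu)"] exI[of _ t]) simp
  qed
  finally show ?thesis .
qed

lemma aut_wtrans: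
  assumes "t \<in> Q"
  shows "(wst t, l, q) \<in> wtrans aut \<longleftrightarrow> (\<exists>X t' a. t = Step X # t' \<and> a \<in> X \<and> l = [Some a] \<and> q = dst t')"
proof -
  have "(wst t, l, q) \<in> wtrans aut \<longleftrightarrow>
     (\<exists>X t' a. wst t = wst (Step X # t') \<and> l = [Some a] \<and> q = dst t' \<and> Step X # t' \<in> Q \<and> a \<in> X)"
    by (simp add: aut_def)
  then show ?thesis using state_eq(2)[OF assms] assms by blast
qed

lemma aut_final: "t \<in> Q \<Longrightarrow> wst t \<in> final aut \<longleftrightarrow> t = []"
  using state_eq(2)[of t "[]"] by (simp add: aut_def)

definition run :: "('a, 'v, 'i, 'd) dgraph \<Rightarrow> 'a rx list \<Rightarrow> ('a, 'v) conf \<Rightarrow> bool" where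
  "run G s c = (case c of (m, v, w) \<Rightarrow> rdpa_run aut (dst s) m (data_regs G m) (node_letter G v) (node_word G w))"

text \<open>From here on the transition relations need no further inspection: each data letter costs
  one closure, followed by the end of the word or by a \<open>Step\<close>.\<close>

lemma run_unfold:
  assumes "s \<in> Q"
  shows "run G s c \<longleftrightarrow> (\<exists>p t c'. closure s p t \<and> (c, c') \<in> op_rel G p \<and>
     (snd (snd c) = [] \<and> t = [] \<or> (\<exists>X t' c''. t = Step X # t' \<and> (c', c'') \<in> step_rel X \<and> run G t' c'')))"
proof -
  obtain m v w where c: "c = (m, v, w)" by (cases c) auto
  let ?l = "node_letter G v"
  let ?sat = "\<lambda>h. \<forall>x\<in>h. gatom_sat m (data_regs G m) ?l x"
  have tQ: "t \<in> Q" if "closure s p t" for p t using closure_target[OF that assms] .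
  have set: "set (atom_list h) = h" if "closure s (h, u) t" for h u t
  proof -
    have "h \<subseteq> gatoms N" using closure_ok[OF that Q_ok[OF assms]] by (simp add: reg_ops_iff)
    then show ?thesis using finite_subset[OF _ finite_gatoms] set_atom_list by blast
  qed
  have upd: "data_regs G (iupdate m ?l u) = dupdate (data_regs G m) ?l (data_upd u)" if "closure s (h, u) t" for h u t
    by (rule data_regs_update[OF closure_ok[OF that Q_ok[OF assms]]])
  have op: "(c, c') \<in> op_rel G p \<longleftrightarrow> ?sat (fst p) \<and> c' = (iupdate m ?l (snd p), v, w)" for c' p
    by (auto simp: op_rel_def c)
  show ?thesis
  proof (cases w)
    case Nil
    have "run G s c \<longleftrightarrow> (\<exists>h u t. closure s (h, u) t \<and> ?sat (set (atom_list h)) \<and> wst t \<in> final aut)"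
      unfolding run_def c Nil prod.case node_word_simps rdpa_run.simps aut_dtrans[OF assms] by fast
    also have "\<dots> \<longleftrightarrow> (\<exists>h u t. closure s (h, u) t \<and> ?sat h \<and> t = [])"
      using set aut_final[OF tQ] by metis
    also have "\<dots> \<longleftrightarrow> (\<exists>p t. closure s p t \<and> ?sat (fst p) \<and> t = [])" by simp
    finally show ?thesis unfolding op by (auto simp: c Nil step_rel_def)
  next
    case (Cons x w')
    obtain a v' where x: "x = (a, v')" by fastforce
    have "run G s c \<longleftrightarrow> (\<exists>h u t q. closure s (h, u) t \<and> ?sat (set (atom_list h)) \<and> (wst t, [Some a], q) \<in> wtrans aut \<and>
        rdpa_run aut q (iupdate m ?l u) (dupdate (data_regs G m) ?l (data_upd u)) (node_letter G v') (node_word G w'))"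
      unfolding run_def c Cons x prod.case node_word_simps rdpa_run.simps aut_dtrans[OF assms] by fast
    also have "\<dots> \<longleftrightarrow> (\<exists>h u t q. closure s (h, u) t \<and> ?sat h \<and> (\<exists>X t' b. t = Step X # t' \<and> b \<in> X \<and> [Some a] = [Some b] \<and> q = dst t') \<and>
        rdpa_run aut q (iupdate m ?l u) (data_regs G (iupdate m ?l u)) (node_letter G v') (node_word G w'))"
      by (intro ex_cong1 conj_cong refl) (simp_all add: set upd aut_wtrans[OF tQ])
    also have "\<dots> \<longleftrightarrow> (\<exists>h u t. closure s (h, u) t \<and> ?sat h \<and> (\<exists>X t'. t = Step X # t' \<and> a \<in> X \<and> run G t' (iupdate m ?l u, v', w')))"
      unfolding run_def prod.case by fast
    also have "\<dots> \<longleftrightarrow> (\<exists>p t. closure s p t \<and> ?sat (fst p) \<and> (\<exists>X t'. t = Step X # t' \<and> a \<in> X \<and> run G t' (iupdate m ?l (snd p), v', w')))"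
      by simp
    finally show ?thesis unfolding op by (auto simp: c Cons x step_rel_def)
  qed
qed

lemma run_imp_machine:
  "run G s (m, v, w) \<Longrightarrow> s \<in> Q \<Longrightarrow> \<exists>m' v'. ((s, (m, v, w)), ([], (m', v', []))) \<in> (machine G)\<^sup>*"
proof (induction w arbitrary: s m v)
  case Nil
  from Nil.prems(1) obtain p c' where c: "closure s p []" "((m, v, []), c') \<in> op_rel G p"
    unfolding run_unfold[OF Nil.prems(2)] by (auto simp: op_rel_def step_rel_def)
  moreover obtain m' v' where "c' = (m', v', [])" using c(2) by (auto simp: op_rel_def)
  ultimately show ?case using closure_machine[OF c(1) Q_ok[OF Nil.prems(2)] c(2)] by blast
next
  case (Cons x w)
  from Cons.prems(1) obtain p X t' c' c'' where c: "closure s p (Step X # t')" "((m, v, x # w), c') \<in> op_rel G p"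
    "(c', c'') \<in> step_rel X" "run G t' c''"
    unfolding run_unfold[OF Cons.prems(2)] by auto
  then obtain m'' v'' where c'': "c'' = (m'', v'', w)" by (auto simp: op_rel_def step_rel_def)
  have t': "t' \<in> Q" using closure_target[OF c(1) Cons.prems(2)] stacks_step by blast
  have "((Step X # t', c'), (t', c'')) \<in> machine G" using c(3) unfolding machine_def by blast
  with closure_machine[OF c(1) Q_ok[OF Cons.prems(2)] c(2)]
  have "((s, (m, v, x # w)), (t', c'')) \<in> (machine G)\<^sup>*" by (rule rtrancl_into_rtrancl)
  then show ?case using Cons.IH[OF c(4)[unfolded c''] t'] unfolding c'' by (meson rtrancl_trans)
qed

text \<open>Induction from the end of the machine run. A silent step is composed in front of the
  closure already used for the same data letter; a \<open>Step\<close> is preceded by the trivial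
  closure with \<open>skip_op\<close>.\<close>

lemma machine_imp_run:
  assumes "(z, ([], (m', v', []))) \<in> (machine G)\<^sup>*"
  shows "fst z \<in> Q \<Longrightarrow> run G (fst z) (snd z)"
  using assms
proof (induction rule: converse_rtrancl_induct)
  case base
  have "([] :: 'a rx list) \<in> Q" by simp
  then show ?case unfolding fst_conv snd_conv
    by (subst run_unfold, assumption, intro exI[of _ skip_op] exI[of _ "[]"] exI[of _ "(m', v', [])"])
      (simp add: closure_refl)
next
  case (step z z')
  from step.hyps(1) consider p where "silent (fst z) p (fst z')" "(snd z, snd z') \<in> op_rel G p"
    | X where "fst z = Step X # fst z'" "(snd z, snd z') \<in> step_rel X"
    unfolding machine_def by force
  then show ?case
  proof cases
    case 1
    have z': "fst z' \<in> Q" using silent_target[OF 1(1) step.prems] .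
    have p: "p \<in> reg_ops N" using silent_ok[OF 1(1) Q_ok[OF step.prems]] by simp
    from step.IH[OF z'] obtain q t c' where q: "closure (fst z') q t" "(snd z', c') \<in> op_rel G q" and
      r: "snd (snd (snd z')) = [] \<and> t = [] \<or> (\<exists>X t' c''. t = Step X # t' \<and> (c', c'') \<in> step_rel X \<and> run G t' c'')"
      unfolding run_unfold[OF z'] by blast
    have "snd (snd (snd z)) = snd (snd (snd z'))" using 1(2) by (auto simp: op_rel_def)
    moreover have "(snd z, c') \<in> op_rel G (op_comp p q)" unfolding op_rel_comp[OF p] using 1(2) q(2) by blast
    moreover have "closure (fst z) (op_comp p q) t" by (rule closure_step[OF 1(1) q(1)])
    ultimately show ?thesis unfolding run_unfold[OF step.prems] using r by metis
  next
    case 2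
    have "fst z' \<in> Q" using step.prems stacks_step unfolding 2(1) by blast
    from step.IH[OF this] 2 have "\<exists>X t' c''. fst z = Step X # t' \<and> (snd z, c'') \<in> step_rel X \<and> run G t' c''" by blast
    then show ?thesis unfolding run_unfold[OF step.prems]
      by (intro exI[of _ skip_op] exI[of _ "fst z"] exI[of _ "snd z"] conjI disjI2) (simp_all add: closure_refl)
  qed
qed

lemma aut_accepts:
  assumes "dgraph_wf G" "is_path G \<rho>"
  shows "rdpa_accepts aut (conv [dpath_of G \<rho>]) \<longleftrightarrow>
    (\<exists>m v. ((\<lambda>_. None, fst \<rho>, snd \<rho>), (m, v, [])) \<in> rx_sem G e)"
proof -
  have d: "data_regs G (\<lambda>_. None) = (\<lambda>_. None)" by (simp add: data_regs_def fun_eq_iff)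
  have "arity aut = 1" "init aut = dst [e]" by (simp_all add: aut_def)
  from rdpa_accepts_path[OF aut_wf this(1) assms] this(2)
  have "rdpa_accepts aut (conv [dpath_of G \<rho>]) \<longleftrightarrow> run G [e] (\<lambda>_. None, fst \<rho>, snd \<rho>)" by (simp add: run_def d split_beta)
  also have "\<dots> \<longleftrightarrow> (\<exists>m v. (([e], (\<lambda>_. None, fst \<rho>, snd \<rho>)), ([], (m, v, []))) \<in> (machine G)\<^sup>*)"
    using run_imp_machine[of G "[e]" "\<lambda>_. None" "fst \<rho>" "snd \<rho>"] stacks_self[of e]
      machine_imp_run[of "([e], (\<lambda>_. None, fst \<rho>, snd \<rho>))" _ _ G] by auto
  finally show ?thesis by (simp add: machine_iff)
qed

end

lemma rx_to_rdpa:
  fixes e :: "'a rx"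
  assumes "finite (UNIV :: 'a set)" "rx_ok N e"
  obtains A where "rdpa_wf A" "arity A = 1"
    "\<And>(G :: ('a, 'v, 'i, 'd) dgraph) \<rho>. dgraph_wf G \<Longrightarrow> is_path G \<rho> \<Longrightarrow> rdpa_accepts A (conv [dpath_of G \<rho>]) \<longleftrightarrow>
      (\<exists>m v. ((\<lambda>_. None, fst \<rho>, snd \<rho>), (m, v, [])) \<in> rx_sem G e)"
proof -
  have "finite (insert [] (stacks e))" by (simp add: finite_stacks)
  from finite_imp_inj_to_nat_seg[OF this] obtain enc :: "'a rx list \<Rightarrow> nat"
    where "inj_on enc (insert [] (stacks e))" by blast
  then interpret rx_automaton e N enc using assms by unfold_locales
  show thesis by (rule that[OF aut_wf _ aut_accepts]) (simp add: aut_def)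
qed

section \<open>Graph patterns as regular expressions\<close>

text \<open>Sharp and unbound are merged into \<open>None\<close>, since joins and conditions look
  only at genuine nodes.\<close>

definition node_part :: "'v gasg \<Rightarrow> nat \<Rightarrow> 'v option" where
  "node_part \<mu> x = (case \<mu> x of Some (Some u) \<Rightarrow> Some u | _ \<Rightarrow> None)"

definition psem :: "('a, 'v, 'i, 'd) dgraph \<Rightarrow> 'a pat \<Rightarrow> (('a, 'v) path \<times> (nat \<Rightarrow> 'v option)) set" where
  "psem G p = (\<lambda>(\<rho>, \<mu>). (\<rho>, node_part \<mu>)) ` pat_sem G p"

definition agree :: "(nat \<Rightarrow> 'v option) \<Rightarrow> (nat \<Rightarrow> 'v option) \<Rightarrow> bool" where
  "agree m n \<longleftrightarrow> (\<forall>x u u'. m x = Some u \<longrightarrow> n x = Some u' \<longrightarrow> u = u')"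

fun csat_part :: "('a, 'v, 'i, 'd) dgraph \<Rightarrow> (nat \<Rightarrow> 'v option) \<Rightarrow> cond \<Rightarrow> bool" where
  "csat_part G n (CData x y) = (\<exists>u w. n x = Some u \<and> n y = Some w \<and> dataof G u = dataof G w)"
| "csat_part G n (CNot \<theta>) = (\<not> csat_part G n \<theta>)"
| "csat_part G n (CAnd \<theta> \<theta>') = (csat_part G n \<theta> \<and> csat_part G n \<theta>')"

lemma node_part_Some: "node_part \<mu> x = Some u \<longleftrightarrow> \<mu> x = Some (Some u)"
  by (auto simp: node_part_def split: option.splits)

lemma csat_node_part: "csat G \<mu> \<theta> = csat_part G (node_part \<mu>) \<theta>"
  by (induction \<theta>) (auto simp: node_part_Some)

lemma node_part_empty [simp]: "node_part Map.empty = Map.empty"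
  by (auto simp: node_part_def)

lemma node_part_single [simp]: "node_part [x \<mapsto> Some v] = [x \<mapsto> v]"
  by (auto simp: node_part_def)

lemma node_part_ext [simp]: "node_part (ext_sharp \<mu> X) = node_part \<mu>"
  by (auto simp: node_part_def ext_sharp_def split: option.splits)

lemma compat_node_part: "compat \<mu> \<mu>' \<longleftrightarrow> agree (node_part \<mu>) (node_part \<mu>')"
  by (auto simp: compat_def agree_def node_part_Some)

text \<open>\<open>++\<close> prefers the right side and \<open>gunion\<close> the left;
  compatibility makes the difference vanish.\<close>

lemma node_part_gunion:
  assumes "compat \<mu> \<mu>'"
  shows "node_part (gunion \<mu> \<mu>') = node_part \<mu> ++ node_part \<mu>'"
proof
  fix x
  show "node_part (gunion \<mu> \<mu>') x = (node_part \<mu> ++ node_part \<mu>') x"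
    using assms[unfolded compat_def, rule_format, of x]
    by (auto simp: node_part_def gunion_def map_add_def split: option.splits)
qed

lemma plast_append: "plast (v, w1 @ w2) = plast (plast (v, w1), w2)"
  by (induction w1 arbitrary: v) auto

lemma is_path_append:
  assumes "dgraph_wf G"
  shows "is_path G (v, w1 @ w2) \<longleftrightarrow> is_path G (v, w1) \<and> is_path G (plast (v, w1), w2)"
proof (induction w1 arbitrary: v)
  case Nil
  then show ?case using is_path_nodes(1)[OF assms] by auto
next
  case (Cons x w1)
  then show ?case using assms by (cases x) auto
qed

lemma psem_Empty: "psem G PEmpty = {((v, []), Map.empty) | v. v \<in> nodes G}"
  by (force simp: psem_def)

lemma psem_Var: "psem G (PVar x) = {((v, []), [x \<mapsto> v]) | v. v \<in> nodes G}"
  by (force simp: psem_def)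

lemma psem_Any: "psem G PAny = {((v, [(a, v')]), Map.empty) | v a v'. (v, a, v') \<in> edges G}"
  by (force simp: psem_def)

lemma psem_Lab: "psem G (PLab b) = {((v, [(b, v')]), Map.empty) | v v'. (v, b, v') \<in> edges G}"
  by (force simp: psem_def)

lemma psem_iff: "(\<rho>, n) \<in> psem G p \<longleftrightarrow> (\<exists>\<mu>. (\<rho>, \<mu>) \<in> pat_sem G p \<and> n = node_part \<mu>)"
  by (auto simp: psem_def)

lemma psem_Union: "(\<rho>, n) \<in> psem G (PUnion p q) \<longleftrightarrow> (\<rho>, n) \<in> psem G p \<or> (\<rho>, n) \<in> psem G q"
proof -
  have "(\<rho>, n) \<in> psem G (PUnion p q) \<longleftrightarrow> (\<exists>\<mu>. (\<rho>, \<mu>) \<in> pat_sem G p \<union> pat_sem G q \<and>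
      n = node_part (ext_sharp \<mu> (pfv p \<union> pfv q)))"
    unfolding psem_iff pat_sem.simps by blast
  then show ?thesis unfolding psem_iff node_part_ext by blast
qed

lemma psem_Cond: "(\<rho>, n) \<in> psem G (PCond p \<theta>) \<longleftrightarrow> (\<rho>, n) \<in> psem G p \<and> csat_part G n \<theta>"
  unfolding psem_iff by (auto simp: csat_node_part)

lemma psem_Concat:
  "((v, w), n) \<in> psem G (PConcat p q) \<longleftrightarrow> (\<exists>w1 w2 n1 n2. w = w1 @ w2 \<and> n = n1 ++ n2 \<and>
     ((v, w1), n1) \<in> psem G p \<and> ((plast (v, w1), w2), n2) \<in> psem G q \<and> agree n1 n2)" (is "?l = ?r")
proof
  assume ?l
  then obtain \<rho> \<mu> \<rho>' \<mu>' where "(v, w) = pcat \<rho> \<rho>'" "n = node_part (gunion \<mu> \<mu>')" "(\<rho>, \<mu>) \<in> pat_sem G p"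
    "(\<rho>', \<mu>') \<in> pat_sem G q" "plast \<rho> = pfirst \<rho>'" "compat \<mu> \<mu>'"
    unfolding psem_def by auto
  then show ?r
    by (intro exI[of _ "snd \<rho>"] exI[of _ "snd \<rho>'"] exI[of _ "node_part \<mu>"] exI[of _ "node_part \<mu>'"])
      (cases \<rho>; cases \<rho>'; auto simp: pcat_def node_part_gunion pfirst_def psem_iff simp flip: compat_node_part)
next
  assume ?r
  then obtain w1 w2 \<mu> \<mu>' where "w = w1 @ w2" "n = node_part \<mu> ++ node_part \<mu>'"
     "((v, w1), \<mu>) \<in> pat_sem G p" "((plast (v, w1), w2), \<mu>') \<in> pat_sem G q" "agree (node_part \<mu>) (node_part \<mu>')"
    unfolding psem_def by auto
  moreover from this have c: "compat \<mu> \<mu>'" by (simp add: compat_node_part)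
  moreover have "(v, w) = pcat (v, w1) (plast (v, w1), w2)" "plast (v, w1) = pfirst (plast (v, w1), w2)"
    using calculation(1) by (simp_all add: pcat_def pfirst_def)
  ultimately have "((v, w), gunion \<mu> \<mu>') \<in> pat_sem G (PConcat p q)" unfolding pat_sem.simps by blast
  moreover have "n = node_part (gunion \<mu> \<mu>')" using node_part_gunion[OF c] \<open>n = _\<close> by simp
  ultimately show ?l unfolding psem_iff by blast
qed

section \<open>Repetition as iterated cutting of the word\<close>

definition chain :: "('a, 'v) path list \<Rightarrow> bool" where
  "chain \<rho>s \<longleftrightarrow> (\<forall>j. Suc j < length \<rho>s \<longrightarrow> plast (\<rho>s ! j) = pfirst (\<rho>s ! Suc j))"

lemma chain_Cons: "\<rho>s \<noteq> [] \<Longrightarrow> chain (\<rho> # \<rho>s) \<longleftrightarrow> plast \<rho> = pfirst (hd \<rho>s) \<and> chain \<rho>s"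
  unfolding chain_def by (cases \<rho>s) (auto simp: nth_Cons split: nat.splits)

lemma foldl_pcat: "foldl pcat \<rho> \<rho>s = (fst \<rho>, snd \<rho> @ concat (map snd \<rho>s))"
  by (induction \<rho>s arbitrary: \<rho>) (auto simp: pcat_def)

lemma plast_chain:
  "\<rho>s \<noteq> [] \<Longrightarrow> chain \<rho>s \<Longrightarrow> plast (fst (hd \<rho>s), concat (map snd \<rho>s)) = plast (last \<rho>s)"
proof (induction \<rho>s)
  case (Cons \<rho> \<rho>s)
  show ?case
  proof (cases "\<rho>s = []")
    case False
    then have "plast \<rho> = fst (hd \<rho>s)" "chain \<rho>s" using Cons.prems by (simp_all add: chain_Cons pfirst_def)
    then show ?thesis using Cons.IH False by (simp add: plast_append)
  qed simp
qed simp

text \<open>One match of a language \<open>L\<close> seen as a step between pairs of current node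
  and remaining word, so that repetition becomes a power of a relation.\<close>

definition cuts :: "('a, 'v) path set \<Rightarrow> (('a, 'v) path \<times> ('a, 'v) path) set" where
  "cuts L = {((v, w1 @ w2), (plast (v, w1), w2)) | v w1 w2. (v, w1) \<in> L}"

text \<open>Each factor of the power contributes one path of the list, and consecutive paths fit by
  construction. The condition \<open>0 < i\<close> makes \<open>hd\<close> and \<open>last\<close>
  meaningful.\<close>

lemma cuts_pow:
  assumes "0 < i"
  shows "((v, w), (v', w')) \<in> cuts L ^^ i \<longleftrightarrow> (\<exists>\<rho>s. length \<rho>s = i \<and> set \<rho>s \<subseteq> L \<and> chain \<rho>s \<and>
     v = fst (hd \<rho>s) \<and> w = concat (map snd \<rho>s) @ w' \<and> v' = plast (last \<rho>s))"
  using assms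
proof (induction i arbitrary: v w rule: nat_induct_non_zero)
  case 1
  show ?case (is "?l = ?r")
  proof
    assume ?l
    then obtain w1 where "(v, w1) \<in> L" "w = w1 @ w'" "v' = plast (v, w1)" by (auto simp: cuts_def)
    then show ?r by (intro exI[of _ "[(v, w1)]"]) (auto simp: chain_def)
  next
    assume ?r
    then obtain \<rho> where "\<rho> \<in> L" "v = fst \<rho>" "w = snd \<rho> @ w'" "v' = plast \<rho>" by (auto simp: length_Suc_conv)
    then show ?l unfolding cuts_def by (cases \<rho>) auto
  qed
next
  case (Suc i)
  show ?case (is "?l = ?r")
  proof
    assume ?l
    then obtain v1 w1 where 1: "((v, w), (v1, w1)) \<in> cuts L" "((v1, w1), (v', w')) \<in> cuts L ^^ i"
      by (metis relpow_Suc_D2 surj_pair)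
    from 1(1) obtain u where u: "(v, u) \<in> L" "w = u @ w1" "v1 = plast (v, u)" by (auto simp: cuts_def)
    from 1(2) obtain \<rho>s where r: "length \<rho>s = i" "set \<rho>s \<subseteq> L" "chain \<rho>s" "v1 = fst (hd \<rho>s)"
      "w1 = concat (map snd \<rho>s) @ w'" "v' = plast (last \<rho>s)" unfolding Suc.IH by blast
    have "\<rho>s \<noteq> []" using r(1) Suc.hyps by auto
    then show ?r using u r by (intro exI[of _ "(v, u) # \<rho>s"]) (auto simp: chain_Cons pfirst_def)
  next
    assume ?r
    then obtain \<rho> \<rho>s where r: "length \<rho>s = i" "set (\<rho> # \<rho>s) \<subseteq> L" "chain (\<rho> # \<rho>s)" "v = fst \<rho>"
      "w = snd \<rho> @ concat (map snd \<rho>s) @ w'" "v' = plast (last (\<rho> # \<rho>s))" by (auto simp: length_Suc_conv)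
    have ne: "\<rho>s \<noteq> []" using r(1) Suc.hyps by auto
    then have c: "plast \<rho> = fst (hd \<rho>s)" "chain \<rho>s" using r(3) by (simp_all add: chain_Cons pfirst_def)
    have "((plast \<rho>, concat (map snd \<rho>s) @ w'), (v', w')) \<in> cuts L ^^ i"
      unfolding Suc.IH using r c ne by (intro exI[of _ \<rho>s]) auto
    moreover have "((v, w), (plast \<rho>, concat (map snd \<rho>s) @ w')) \<in> cuts L"
      unfolding cuts_def using r(2,4,5) by (cases \<rho>) auto
    ultimately show ?l by (rule relpow_Suc_I2[rotated])
  qed
qed

lemma psem_Rep:
  "((v, w), n) \<in> psem G (PRep p k M) \<longleftrightarrow> n = Map.empty \<and> (k = 0 \<and> w = [] \<and> v \<in> nodes G \<or>
     (\<exists>\<rho>s. \<rho>s \<noteq> [] \<and> k \<le> length \<rho>s \<and> enat (length \<rho>s) \<le> M \<and> set \<rho>s \<subseteq> fst ` psem G p \<and> chain \<rho>s \<and>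
        v = fst (hd \<rho>s) \<and> w = concat (map snd \<rho>s)))"
proof -
  have "fst ` psem G p = fst ` pat_sem G p" by (force simp: psem_def)
  then have *: "set \<rho>s \<subseteq> fst ` psem G p \<longleftrightarrow> (\<forall>\<rho>\<in>set \<rho>s. \<exists>\<mu>. (\<rho>, \<mu>) \<in> pat_sem G p)" for \<rho>s by force
  have f: "(v, w) = foldl pcat (hd \<rho>s) (tl \<rho>s) \<longleftrightarrow> v = fst (hd \<rho>s) \<and> w = concat (map snd \<rho>s)" if "\<rho>s \<noteq> []" for \<rho>s
    using that by (cases \<rho>s) (auto simp: foldl_pcat)
  have "((v, w), n) \<in> psem G (PRep p k M) \<longleftrightarrow> n = Map.empty \<and> (\<exists>\<mu>. ((v, w), \<mu>) \<in> pat_sem G (PRep p k M))"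
  proof -
    have "\<mu> = Map.empty" if "((v, w), \<mu>) \<in> pat_sem G (PRep p k M)" for \<mu> using that by auto
    then have *: "node_part \<mu> = Map.empty" if "((v, w), \<mu>) \<in> pat_sem G (PRep p k M)" for \<mu>
      using that node_part_empty by blast
    show ?thesis unfolding psem_iff
    proof (intro iffI; elim exE conjE)
      fix \<mu> assume "((v, w), \<mu>) \<in> pat_sem G (PRep p k M)" "n = node_part \<mu>"
      with * show "n = Map.empty \<and> (\<exists>\<mu>. ((v, w), \<mu>) \<in> pat_sem G (PRep p k M))" by blast
    next
      fix \<mu> assume "((v, w), \<mu>) \<in> pat_sem G (PRep p k M)" "n = Map.empty"
      with *[of \<mu>] show "\<exists>\<mu>. ((v, w), \<mu>) \<in> pat_sem G (PRep p k M) \<and> n = node_part \<mu>"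
        by (intro exI[of _ \<mu>]) simp
    qed
  qed
  also have "(\<exists>\<mu>. ((v, w), \<mu>) \<in> pat_sem G (PRep p k M)) \<longleftrightarrow> k = 0 \<and> w = [] \<and> v \<in> nodes G \<or>
     (\<exists>\<rho>s. \<rho>s \<noteq> [] \<and> k \<le> length \<rho>s \<and> enat (length \<rho>s) \<le> M \<and> set \<rho>s \<subseteq> fst ` psem G p \<and> chain \<rho>s \<and>
        (v, w) = foldl pcat (hd \<rho>s) (tl \<rho>s))" (is "_ = (_ \<or> ?E)")
    unfolding pat_sem.simps chain_def * by blast
  also have "?E \<longleftrightarrow> (\<exists>\<rho>s. \<rho>s \<noteq> [] \<and> k \<le> length \<rho>s \<and> enat (length \<rho>s) \<le> M \<and> set \<rho>s \<subseteq> fst ` psem G p \<and>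
        chain \<rho>s \<and> v = fst (hd \<rho>s) \<and> w = concat (map snd \<rho>s))"
    by (intro ex_cong1 conj_cong refl f)
  finally show ?thesis .
qed

text \<open>Brings repetition into the form that regular expressions can express. The zeroth power
  relates every pair to itself, whereas zero repetitions require a node;
  \<open>v \<in> nodes G\<close> reconciles the two.\<close>

lemma psem_Rep_cuts:
  assumes "v \<in> nodes G"
  shows "(\<exists>w1. w = w1 @ w' \<and> ((v, w1), Map.empty) \<in> psem G (PRep p k M) \<and> plast (v, w1) = v') \<longleftrightarrow>
    (\<exists>i. k \<le> i \<and> enat i \<le> M \<and> ((v, w), (v', w')) \<in> cuts (fst ` psem G p) ^^ i)" (is "?l = ?r")
proof
  let ?L = "fst ` psem G p"
  assume ?l
  then obtain w1 where w1: "w = w1 @ w'" "((v, w1), Map.empty) \<in> psem G (PRep p k M)" "plast (v, w1) = v'" by blast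
  from w1(2) consider "k = 0" "w1 = []" | \<rho>s where "\<rho>s \<noteq> []" "k \<le> length \<rho>s" "enat (length \<rho>s) \<le> M" "set \<rho>s \<subseteq> ?L" "chain \<rho>s"
    "v = fst (hd \<rho>s)" "w1 = concat (map snd \<rho>s)" unfolding psem_Rep by blast
  then show ?r
  proof cases
    case 1
    then show ?thesis using w1 by (intro exI[of _ 0]) (auto simp: zero_enat_def[symmetric])
  next
    case 2
    then have "((v, w), (v', w')) \<in> cuts ?L ^^ length \<rho>s"
      using w1 plast_chain[of \<rho>s] by (subst cuts_pow) auto
    then show ?thesis using 2 by blast
  qed
next
  let ?L = "fst ` psem G p"
  assume ?r
  then obtain i where i: "k \<le> i" "enat i \<le> M" "((v, w), (v', w')) \<in> cuts ?L ^^ i" by blast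
  show ?l
  proof (cases "i = 0")
    case True
    then show ?thesis using i assms by (auto simp: psem_Rep)
  next
    case False
    then have "0 < i" by simp
    from i(3)[unfolded cuts_pow[OF this]] obtain \<rho>s where r: "length \<rho>s = i" "set \<rho>s \<subseteq> ?L" "chain \<rho>s" "v = fst (hd \<rho>s)"
      "w = concat (map snd \<rho>s) @ w'" "v' = plast (last \<rho>s)" by blast
    have "\<rho>s \<noteq> []" using False r(1) by auto
    with r i plast_chain[of \<rho>s] show ?thesis
      by (intro exI[of _ "concat (map snd \<rho>s)"]) (auto simp: psem_Rep)
  qed
qed

lemma pfv_pbv_pvars: "pfv p \<subseteq> pvars p" "pbv p \<subseteq> pvars p"
  by (induction p) auto

lemma finite_pvars: "finite (pvars p)"
proof -
  have "finite (cvars \<theta>)" for \<theta> by (induction \<theta>) auto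
  then show ?thesis by (induction p) auto
qed

lemma psem_dom: "(\<rho>, n) \<in> psem G p \<Longrightarrow> dom n \<subseteq> pfv p"
proof (induction p arbitrary: \<rho> n)
  case (PConcat p q)
  obtain v w where "\<rho> = (v, w)" by fastforce
  with PConcat.prems obtain n1 n2 \<rho>1 \<rho>2 where "n = n1 ++ n2" "(\<rho>1, n1) \<in> psem G p" "(\<rho>2, n2) \<in> psem G q"
    by (auto simp: psem_Concat)
  then show ?case using PConcat.IH by fastforce
next
  case (PRep p k M)
  then show ?case by (cases \<rho>) (auto simp: psem_Rep)
next
  case (PUnion p q)
  then have "dom n \<subseteq> pfv p \<or> dom n \<subseteq> pfv q" unfolding psem_Union by blast
  then show ?case by auto
next
  case (PCond p \<theta>)
  then show ?case unfolding psem_Cond pfv.simps by blast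
qed (auto simp: psem_Empty psem_Var psem_Any psem_Lab split: if_splits)

lemma edge_target: "dgraph_wf G \<Longrightarrow> (v, a, v') \<in> edges G \<Longrightarrow> v' \<in> nodes G"
  by (auto simp: dgraph_wf_def)

lemma psem_is_path:
  assumes G: "dgraph_wf G"
  shows "(\<rho>, n) \<in> psem G p \<Longrightarrow> is_path G \<rho>"
proof (induction p arbitrary: \<rho> n)
  case (PConcat p q)
  obtain v w where "\<rho> = (v, w)" by fastforce
  with PConcat show ?case by (fastforce simp: psem_Concat is_path_append[OF G])
next
  case (PRep p k M)
  have ch: "is_path G (fst (hd \<rho>s), concat (map snd \<rho>s))" if "\<rho>s \<noteq> []" "chain \<rho>s" "set \<rho>s \<subseteq> fst ` psem G p" for \<rho>s
    using that
  proof (induction \<rho>s)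
    case (Cons \<rho> \<rho>s)
    have p: "is_path G \<rho>" using Cons.prems PRep.IH by auto
    show ?case
    proof (cases "\<rho>s = []")
      case True
      then show ?thesis using p by simp
    next
      case False
      then have "plast \<rho> = fst (hd \<rho>s)" "chain \<rho>s" using Cons.prems by (simp_all add: chain_Cons pfirst_def)
      then show ?thesis using Cons False p by (simp add: is_path_append[OF G])
    qed
  qed simp
  obtain v w where "\<rho> = (v, w)" by fastforce
  with PRep.prems ch show ?case by (auto simp: psem_Rep)
next
  case PAny
  then show ?case by (auto simp: psem_Any is_path_Cons[OF G] dest: edge_target[OF G])
next
  case (PLab b)
  then show ?case by (auto simp: psem_Lab is_path_Cons[OF G] dest: edge_target[OF G])
next
  case (PUnion p q)
  then show ?case unfolding psem_Union by blast
next
  case (PCond p \<theta>)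
  then show ?case unfolding psem_Cond by blast
qed (auto simp: psem_Empty psem_Var)

section \<open>Building expressions that capture patterns\<close>

definition fail_op :: reg_op where "fail_op = ({INeq ISharp ISharp}, \<lambda>_. None)"

lemma op_rel_fail [simp]: "op_rel G fail_op = {}"
  by (auto simp: op_rel_def fail_op_def)

lemma fail_op_in: "fail_op \<in> reg_ops N"
  by (simp add: fail_op_def reg_ops_iff gatoms_iff iterms_def)

text \<open>The empty union is realised by \<open>fail_op\<close>, whose guard
  \<open>INeq ISharp ISharp\<close> cannot hold.\<close>

lemma rx_finite_union:
  assumes "finite S" "\<And>s. s \<in> S \<Longrightarrow> rx_ok N (f s)"
  obtains e where "rx_ok N e" "\<And>G :: ('a, 'v, 'i, 'd) dgraph. rx_sem G e = (\<Union>s\<in>S. rx_sem G (f s))"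
proof -
  have "\<exists>e. rx_ok N e \<and> (\<forall>G :: ('a, 'v, 'i, 'd) dgraph. rx_sem G e = (\<Union>s\<in>S. rx_sem G (f s)))"
    using assms
  proof (induction S rule: finite_induct)
    case empty
    show ?case by (intro exI[of _ "Op fail_op"]) (simp add: fail_op_in)
  next
    case (insert s S)
    then obtain e where "rx_ok N e" "\<forall>G :: ('a, 'v, 'i, 'd) dgraph. rx_sem G e = (\<Union>s\<in>S. rx_sem G (f s))" by auto
    with insert.prems show ?case by (intro exI[of _ "Alt (f s) e"]) simp
  qed
  then show thesis using that by blast
qed

text \<open>The flag \<open>b\<close> stands for the wanted truth value: negation flips it, and a
  conjunction becomes \<open>Seq\<close> or, dually, \<open>Alt\<close>. With \<open>D\<close> fixed
  it is known beforehand whether an atom has both values; if not, it is false, so the expression is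
  constantly failing or skipping.\<close>

lemma rx_cond:
  assumes "cvars \<theta> \<subseteq> {..<N}"
  shows "\<exists>e. rx_ok N e \<and> (\<forall>(G :: ('a, 'v, 'i, 'd) dgraph) m v w c'. D \<subseteq> dom m \<longrightarrow>
    ((m, v, w), c') \<in> rx_sem G e \<longleftrightarrow> c' = (m, v, w) \<and> csat_part G (m |` D) \<theta> = b)"
  using assms
proof (induction \<theta> arbitrary: b)
  case (CData x y)
  show ?case
  proof (cases "x \<in> D \<and> y \<in> D")
    case True
    define c where "c = (if b then DEq (DReg x) (DReg y) else DNeq (DReg x) (DReg y))"
    have "((m, v, w), c') \<in> rx_sem G (Op ({c}, \<lambda>_. None)) \<longleftrightarrow> c' = (m, v, w) \<and> csat_part G (m |` D) (CData x y) = b"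
      if D: "D \<subseteq> dom m" for G :: "('a, 'v, 'i, 'd) dgraph" and m v w c'
    proof -
      obtain u u' where "m x = Some u" "m y = Some u'" using D True by blast
      then show ?thesis using True by (auto simp: op_rel_def c_def data_regs_def)
    qed
    moreover have "rx_ok N (Op ({c}, \<lambda>_. None))"
      using CData by (auto simp: reg_ops_iff gatoms_iff c_def dterms_def)
    ultimately show ?thesis by blast
  next
    case False
    then have f: "\<not> csat_part G (m |` D) (CData x y)" for G :: "('a, 'v, 'i, 'd) dgraph" and m
      by (auto simp: restrict_map_def)
    show ?thesis
      by (intro exI[of _ "Op (if b then fail_op else skip_op)"])
        (use f in \<open>auto simp: fail_op_in skip_op_in simp del: csat_part.simps\<close>)
  qed
next
  case (CNot \<theta>)
  from CNot.IH[of "\<not> b"] CNot.prems show ?case by auto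
next
  case (CAnd \<theta> \<theta>')
  let ?P = "\<lambda>e \<theta> b. rx_ok N e \<and> (\<forall>(G :: ('a, 'v, 'i, 'd) dgraph) m v w c'. D \<subseteq> dom m \<longrightarrow>
    ((m, v, w), c') \<in> rx_sem G e \<longleftrightarrow> c' = (m, v, w) \<and> csat_part G (m |` D) \<theta> = b)"
  have c: "cvars \<theta> \<subseteq> {..<N}" "cvars \<theta>' \<subseteq> {..<N}" using CAnd.prems by auto
  from CAnd.IH(1)[OF c(1), of b] obtain e1 where e1: "?P e1 \<theta> b" ..
  from CAnd.IH(2)[OF c(2), of b] obtain e2 where e2: "?P e2 \<theta>' b" ..
  have s1: "((m, v, w), c') \<in> rx_sem G e1 \<longleftrightarrow> c' = (m, v, w) \<and> csat_part G (m |` D) \<theta> = b"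
    and s2: "((m, v, w), c') \<in> rx_sem G e2 \<longleftrightarrow> c' = (m, v, w) \<and> csat_part G (m |` D) \<theta>' = b"
    if "D \<subseteq> dom m" for G :: "('a, 'v, 'i, 'd) dgraph" and m v w c'
    using e1[THEN conjunct2, rule_format, OF that] e2[THEN conjunct2, rule_format, OF that] .
  have ok: "rx_ok N e1" "rx_ok N e2" by (rule conjunct1[OF e1], rule conjunct1[OF e2])
  show ?case
  proof (cases b)
    case True
    have "((m, v, w), c') \<in> rx_sem G e1 O rx_sem G e2 \<longleftrightarrow> c' = (m, v, w) \<and> csat_part G (m |` D) (CAnd \<theta> \<theta>') = b"
      if "D \<subseteq> dom m" for G :: "('a, 'v, 'i, 'd) dgraph" and m v w c'
    proof -
      have "((m, v, w), c') \<in> rx_sem G e1 O rx_sem G e2 \<longleftrightarrow> (\<exists>c1. ((m, v, w), c1) \<in> rx_sem G e1 \<and> (c1, c') \<in> rx_sem G e2)" by blast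
      then show ?thesis using True by (simp add: s1[OF that] s2[OF that]) blast
    qed
    then show ?thesis by (intro exI[of _ "Seq e1 e2"]) (simp add: ok)
  next
    case False
    then show ?thesis by (intro exI[of _ "Alt e1 e2"]) (auto simp: ok s1 s2)
  qed
qed

text \<open>\<open>agree m n\<close> is the join with variables bound earlier. \<open>D\<close> has
  to be recorded separately, because \<open>m ++ n\<close> does not reveal which of its variables
  this match bound again.\<close>

definition matches :: "('a, 'v, 'i, 'd) dgraph \<Rightarrow> 'a pat \<Rightarrow> nat set \<Rightarrow> ('a, 'v) conf \<Rightarrow> ('a, 'v) conf \<Rightarrow> bool" where
  "matches G p D = (\<lambda>(m, v, w) (m', v', w'). \<exists>w1 n. w = w1 @ w' \<and> ((v, w1), n) \<in> psem G p \<and>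
     plast (v, w1) = v' \<and> dom n = D \<and> agree m n \<and> m' = m ++ n)"

text \<open>Registers hold the values of the variables bound so far. A condition refers to the assignment of its own
  pattern only, so one expression is needed for each set \<open>D\<close> of variables assigned a node by that pattern.\<close>

definition captures :: "('a, 'v, 'i, 'd) dgraph \<Rightarrow> 'a pat \<Rightarrow> nat set \<Rightarrow> 'a rx \<Rightarrow> bool" where
  "captures G p D e \<longleftrightarrow> (\<forall>m v w c'. is_path G (v, w) \<longrightarrow> (\<forall>x\<in>pbv p. m x = None) \<longrightarrow>
     ((m, v, w), c') \<in> rx_sem G e \<longleftrightarrow> matches G p D (m, v, w) c')"

lemma captures_iff:
  "captures G p D e \<Longrightarrow> is_path G (v, w) \<Longrightarrow> (\<forall>x\<in>pbv p. m x = None) \<Longrightarrow>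
     ((m, v, w), c') \<in> rx_sem G e \<longleftrightarrow> matches G p D (m, v, w) c'"
  unfolding captures_def by blast

text \<open>Checking a joined assignment against the registers splits into two successive checks,
  which is how a left-to-right reader meets them.\<close>

lemma agree_map_add:
  "agree n1 n2 \<and> agree m (n1 ++ n2) \<longleftrightarrow> agree m n1 \<and> agree (m ++ n1) n2"
proof -
  define P where "P a b \<longleftrightarrow> (\<forall>u u'. a = Some u \<longrightarrow> b = Some u' \<longrightarrow> u = u')" for a b :: "'a option"
  have P: "P a b \<longleftrightarrow> a = None \<or> b = None \<or> a = b" for a b by (cases a; cases b) (auto simp: P_def)
  have agree: "agree a b \<longleftrightarrow> (\<forall>x. P (a x) (b x))" for a b by (simp add: agree_def P_def)
  have "P (n1 x) (n2 x) \<and> P (m x) ((n1 ++ n2) x) \<longleftrightarrow> P (m x) (n1 x) \<and> P ((m ++ n1) x) (n2 x)" for x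
    unfolding P by (cases "n1 x"; cases "n2 x") (auto simp: map_add_def)
  then show ?thesis unfolding agree by blast
qed

text \<open>\<open>D1\<close> and \<open>D2\<close> may overlap, as a variable may occur on both
  sides; the join then is the check of \<open>q\<close> against registers already written by
  \<open>p\<close>.\<close>

lemma matches_Concat:
  "matches G (PConcat p q) D c c'' \<longleftrightarrow>
     (\<exists>D1 D2 c'. D1 \<union> D2 = D \<and> matches G p D1 c c' \<and> matches G q D2 c' c'')"
proof -
  obtain m v w where c: "c = (m, v, w)" by (cases c) auto
  obtain m'' v'' w'' where c'': "c'' = (m'', v'', w'')" by (cases c'') auto
  show ?thesis (is "?l = ?r")
  proof
    assume ?l
    then obtain w1 w2 n1 n2 where *: "w = (w1 @ w2) @ w''" "((v, w1), n1) \<in> psem G p"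
      "((plast (v, w1), w2), n2) \<in> psem G q" "agree n1 n2" "plast (v, w1 @ w2) = v''" "dom (n1 ++ n2) = D"
      "agree m (n1 ++ n2)" "m'' = m ++ (n1 ++ n2)"
      unfolding c c'' matches_def prod.case psem_Concat by blast
    have "agree m n1" "agree (m ++ n1) n2" using * agree_map_add by blast+
    with * have "matches G p (dom n1) c (m ++ n1, plast (v, w1), w2 @ w'')"
      "matches G q (dom n2) (m ++ n1, plast (v, w1), w2 @ w'') c''"
      unfolding c c'' matches_def prod.case by (auto simp: plast_append)
    then show ?r using *(6) by (intro exI[of _ "dom n1"] exI[of _ "dom n2"]) auto
  next
    assume ?r
    then obtain D1 D2 c' where D: "D1 \<union> D2 = D" "matches G p D1 c c'" "matches G q D2 c' c''" by blast
    from D(2) obtain w1 n1 w' where 1: "c' = (m ++ n1, plast (v, w1), w')" "w = w1 @ w'" "((v, w1), n1) \<in> psem G p"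
      "dom n1 = D1" "agree m n1" unfolding c matches_def by (cases c') auto
    from D(3) obtain w2 n2 where 2: "w' = w2 @ w''" "((plast (v, w1), w2), n2) \<in> psem G q" "plast (plast (v, w1), w2) = v''"
      "dom n2 = D2" "agree (m ++ n1) n2" "m'' = m ++ n1 ++ n2" unfolding c'' 1(1) matches_def by auto
    have a: "agree n1 n2" "agree m (n1 ++ n2)" using 1(5) 2(5) agree_map_add by blast+
    have "((v, w1 @ w2), n1 ++ n2) \<in> psem G (PConcat p q)" unfolding psem_Concat using 1 2 a by blast
    moreover have "dom (n1 ++ n2) = D" using D(1) 1(4) 2(4) by auto
    ultimately show ?l unfolding c c'' matches_def prod.case using 1 2 a
      by (intro exI[of _ "w1 @ w2"] exI[of _ "n1 ++ n2"]) (simp add: plast_append)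
  qed
qed

lemma matches_dom: "matches G p D c c' \<Longrightarrow> D \<subseteq> pfv p"
  unfolding matches_def using psem_dom[of _ _ G p] by (cases c; cases c') blast

lemma matches_path:
  assumes "dgraph_wf G" "is_path G (v, w)" "matches G p D (m, v, w) (m', v', w')"
  shows "is_path G (v', w')"
  using assms(2,3) unfolding matches_def by (auto simp: is_path_append[OF assms(1)])

lemma matches_None:
  assumes "matches G p D (m, v, w) (m', v', w')" "m x = None" "x \<notin> pfv p"
  shows "m' x = None"
proof -
  obtain w1 n where n: "((v, w1), n) \<in> psem G p" "m' = m ++ n" using assms(1) unfolding matches_def by auto
  with psem_dom[OF n(1)] assms(2,3) show ?thesis by (auto simp: map_add_None)
qed

text \<open>Each step leaves the registers at \<open>m\<close>, so the iteration of \<open>R\<close>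
  takes place in the word component alone. Suffixes of a path are paths, so the hypothesis on
  \<open>R\<close> stays applicable.\<close>

lemma relpow_rx_cuts:
  assumes G: "dgraph_wf G" and F: "\<And>v w c'. is_path G (v, w) \<Longrightarrow>
    ((m, v, w), c') \<in> R \<longleftrightarrow> (\<exists>\<rho>'. c' = (m, \<rho>') \<and> ((v, w), \<rho>') \<in> cuts L)"
  shows "is_path G (v, w) \<Longrightarrow> ((m, v, w), c') \<in> R ^^ i \<longleftrightarrow> (\<exists>\<rho>'. c' = (m, \<rho>') \<and> ((v, w), \<rho>') \<in> cuts L ^^ i)"
proof (induction i arbitrary: v w)
  case 0
  then show ?case by auto
next
  case (Suc i)
  have front: "S ^^ Suc i = S O S ^^ i" for S :: "('x \<times> 'x) set" by (simp add: relpow_commute)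
  have path: "is_path G \<rho>'" if "((v, w), \<rho>') \<in> cuts L" for \<rho>'
    using that Suc.prems by (auto simp: cuts_def is_path_append[OF G])
  have "((m, v, w), c') \<in> R ^^ Suc i \<longleftrightarrow> (\<exists>c1. ((m, v, w), c1) \<in> R \<and> (c1, c') \<in> R ^^ i)"
    unfolding front by blast
  also have "\<dots> \<longleftrightarrow> (\<exists>\<rho>1. ((v, w), \<rho>1) \<in> cuts L \<and> ((m, \<rho>1), c') \<in> R ^^ i)"
    unfolding F[OF Suc.prems] by blast
  also have "\<dots> \<longleftrightarrow> (\<exists>\<rho>1. ((v, w), \<rho>1) \<in> cuts L \<and> (\<exists>\<rho>'. c' = (m, \<rho>') \<and> (\<rho>1, \<rho>') \<in> cuts L ^^ i))"
  proof (intro ex_cong1 conj_cong refl)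
    fix \<rho>1 assume "((v, w), \<rho>1) \<in> cuts L"
    from path[OF this] Suc.IH[of "fst \<rho>1" "snd \<rho>1"]
    show "((m, \<rho>1), c') \<in> R ^^ i \<longleftrightarrow> (\<exists>\<rho>'. c' = (m, \<rho>') \<and> (\<rho>1, \<rho>') \<in> cuts L ^^ i)" by simp
  qed
  also have "\<dots> \<longleftrightarrow> (\<exists>\<rho>'. c' = (m, \<rho>') \<and> (\<exists>\<rho>1. ((v, w), \<rho>1) \<in> cuts L \<and> (\<rho>1, \<rho>') \<in> cuts L ^^ i))" by blast
  also have "\<dots> \<longleftrightarrow> (\<exists>\<rho>'. c' = (m, \<rho>') \<and> ((v, w), \<rho>') \<in> cuts L ^^ Suc i)"
    unfolding front by blast
  finally show ?case .
qed

text \<open>A finite bound gives a finite union of powers, possibly empty; without a bound,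
  \<open>k\<close> copies of \<open>F\<close> followed by its star reach every exponent from
  \<open>k\<close> on.\<close>

lemma rx_repeat:
  assumes "rx_ok N F"
  obtains e where "rx_ok N e" "\<And>(G :: ('a, 'v, 'i, 'd) dgraph) c c'. (c, c') \<in> rx_sem G e \<longleftrightarrow>
    (\<exists>i. k \<le> i \<and> enat i \<le> M \<and> (c, c') \<in> rx_sem G F ^^ i)"
proof -
  define pow where "pow = rec_nat (Op skip_op) (\<lambda>_. Seq F)"
  have pow: "rx_ok N (pow i)" "rx_sem G (pow i) = rx_sem G F ^^ i" for i and G :: "('a, 'v, 'i, 'd) dgraph"
    by (induction i) (auto simp: pow_def assms skip_op_in relpow_commute)
  show thesis
  proof (cases M)
    case (enat j)
    obtain e where "rx_ok N e" "\<And>G :: ('a, 'v, 'i, 'd) dgraph. rx_sem G e = (\<Union>i\<in>{k..j}. rx_sem G (pow i))"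
      by (rule rx_finite_union[of "{k..j}" N pow]) (simp, rule pow, blast)
    then show thesis by (intro that[of e]) (auto simp: pow enat)
  next
    case infinity
    show thesis
    proof (rule that[of "Seq (pow k) (Star F)"])
      fix G :: "('a, 'v, 'i, 'd) dgraph" and c c'
      have "(c, c') \<in> rx_sem G F ^^ k O (rx_sem G F)\<^sup>* \<longleftrightarrow> (\<exists>j. (c, c') \<in> rx_sem G F ^^ (k + j))"
        unfolding relpow_add by (blast dest: rtrancl_imp_relpow intro: relpow_imp_rtrancl)
      also have "\<dots> \<longleftrightarrow> (\<exists>i. k \<le> i \<and> (c, c') \<in> rx_sem G F ^^ i)" by (metis le_iff_add)
      finally show "(c, c') \<in> rx_sem G (Seq (pow k) (Star F)) \<longleftrightarrow> (\<exists>i. k \<le> i \<and> enat i \<le> M \<and> (c, c') \<in> rx_sem G F ^^ i)"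
        by (simp add: pow infinity)
    qed (use pow assms in auto)
  qed
qed

text \<open>The first alternative binds a variable whose register is still empty; the second tests a
  further occurrence against the node stored before.\<close>

lemma captures_Var:
  "captures G (PVar x) {x} (Alt (Op ({IEq (IReg x) ISharp}, [x \<mapsto> IIn 0])) (Op ({IEq (IReg x) (IIn 0)}, Map.empty)))"
  (is "captures _ _ _ ?e")
  unfolding captures_def
proof (intro allI impI)
  fix m :: "nat \<Rightarrow> 'b option" and v w c' assume "is_path G (v, w)"
  then have v: "v \<in> nodes G" by (simp add: is_path_def)
  have u1: "iupdate m (node_letter G v) [x \<mapsto> IIn 0] = m(x \<mapsto> v)" by (auto simp: iupdate_def node_letter_def)
  have a: "agree m [x \<mapsto> v] \<longleftrightarrow> m x = None \<or> m x = Some v" by (cases "m x") (auto simp: agree_def)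
  have "((m, v, w), c') \<in> rx_sem G ?e \<longleftrightarrow> m x = None \<and> c' = (m(x \<mapsto> v), v, w) \<or> m x = Some v \<and> c' = (m, v, w)"
    by (auto simp: op_rel_def u1[unfolded node_letter_def] node_letter_def)
  also have "\<dots> \<longleftrightarrow> agree m [x \<mapsto> v] \<and> c' = (m(x \<mapsto> v), v, w)"
    unfolding a by (auto simp: fun_upd_idem)
  also have "\<dots> \<longleftrightarrow> matches G (PVar x) {x} (m, v, w) c'"
    unfolding matches_def psem_Var using v by (cases c') auto
  finally show "((m, v, w), c') \<in> rx_sem G ?e \<longleftrightarrow> matches G (PVar x) {x} (m, v, w) c'" .
qed

lemma captures_Step:
  assumes "dgraph_wf G" "\<And>v w n. ((v, w), n) \<in> psem G p \<longleftrightarrow> n = Map.empty \<and> (\<exists>a v'. a \<in> X \<and> w = [(a, v')] \<and> (v, a, v') \<in> edges G)"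
  shows "captures G p {} (Step X)"
  unfolding captures_def
proof (intro allI impI)
  fix m :: "nat \<Rightarrow> 'b option" and v w c' assume p: "is_path G (v, w)"
  have "((m, v, w), c') \<in> rx_sem G (Step X) \<longleftrightarrow> (\<exists>a v' w'. a \<in> X \<and> w = (a, v') # w' \<and> c' = (m, v', w'))"
    by (auto simp: step_rel_def)
  also have "\<dots> \<longleftrightarrow> matches G p {} (m, v, w) c'"
    unfolding matches_def assms(2) using p by (cases c') (auto simp: agree_def is_path_Cons[OF assms(1)])
  finally show "((m, v, w), c') \<in> rx_sem G (Step X) \<longleftrightarrow> matches G p {} (m, v, w) c'" .
qed

lemma captures_Union:
  assumes "captures G p D e" "captures G q D f"
  shows "captures G (PUnion p q) D (Alt e f)"
  using assms unfolding captures_def matches_def by (auto simp: psem_Union split_beta)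

text \<open>All splittings of \<open>D\<close> are tried. The expression for \<open>q\<close> may
  start because \<open>pat_wf\<close> separates \<open>pbv q\<close> from the variables of
  \<open>p\<close>, so \<open>p\<close> leaves the registers of repetitions in \<open>q\<close>
  empty.\<close>

lemma captures_Concat:
  assumes G: "dgraph_wf G" and wf: "pat_wf (PConcat p q)"
    and f: "\<And>D. captures G p D (f D)" and g: "\<And>D. captures G q D (g D)"
    and e: "rx_sem G e = (\<Union>(D1, D2)\<in>{(D1, D2). D1 \<subseteq> pfv p \<and> D2 \<subseteq> pfv q \<and> D1 \<union> D2 = D}. rx_sem G (Seq (f D1) (g D2)))"
  shows "captures G (PConcat p q) D e"
  unfolding captures_def
proof (intro allI impI)
  fix m :: "nat \<Rightarrow> 'b option" and v w c'' assume p: "is_path G (v, w)" and m: "\<forall>x\<in>pbv (PConcat p q). m x = None"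
  have 1: "((m, v, w), c') \<in> rx_sem G (f D1) \<longleftrightarrow> matches G p D1 (m, v, w) c'" for c' D1
    by (rule captures_iff[OF f p]) (use m in auto)
  have 2: "(c', c'') \<in> rx_sem G (g D2) \<longleftrightarrow> matches G q D2 c' c''" if "matches G p D1 (m, v, w) c'" for c' D1 D2
  proof -
    obtain m' v' w' where c': "c' = (m', v', w')" by (cases c') auto
    have "pbv q \<inter> pfv p = {}" using wf pfv_pbv_pvars(1)[of p] by auto
    then have "\<forall>x\<in>pbv q. m' x = None" using m matches_None[OF that[unfolded c']] by auto
    then show ?thesis unfolding c' by (rule captures_iff[OF g matches_path[OF G p that[unfolded c']]])
  qed
  have "((m, v, w), c'') \<in> rx_sem G e \<longleftrightarrow> (\<exists>D1 D2 c'. D1 \<subseteq> pfv p \<and> D2 \<subseteq> pfv q \<and> D1 \<union> D2 = D \<and>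
      ((m, v, w), c') \<in> rx_sem G (f D1) \<and> (c', c'') \<in> rx_sem G (g D2))" unfolding e rx_sem.simps by blast
  also have "\<dots> \<longleftrightarrow> (\<exists>D1 D2 c'. D1 \<subseteq> pfv p \<and> D2 \<subseteq> pfv q \<and> D1 \<union> D2 = D \<and>
      matches G p D1 (m, v, w) c' \<and> matches G q D2 c' c'')"
    unfolding 1 by (intro ex_cong1 conj_cong refl 2)
  also have "\<dots> \<longleftrightarrow> (\<exists>D1 D2 c'. D1 \<union> D2 = D \<and> matches G p D1 (m, v, w) c' \<and> matches G q D2 c' c'')"
    by (intro ex_cong1 iffI conjI; elim conjE; assumption?; elim matches_dom)
  finally show "((m, v, w), c'') \<in> rx_sem G e \<longleftrightarrow> matches G (PConcat p q) D (m, v, w) c''" unfolding matches_Concat .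
qed

lemma captures_Cond:
  assumes "captures G p D e"
    and f: "\<And>m v w c'. D \<subseteq> dom m \<Longrightarrow> ((m, v, w), c') \<in> rx_sem G f \<longleftrightarrow> c' = (m, v, w) \<and> csat_part G (m |` D) \<theta>"
  shows "captures G (PCond p \<theta>) D (Seq e f)"
  unfolding captures_def
proof (intro allI impI)
  fix m :: "nat \<Rightarrow> 'b option" and v w c'' assume p: "is_path G (v, w)" and m: "\<forall>x\<in>pbv (PCond p \<theta>). m x = None"
  \<comment> \<open>\<open>n\<close> overrides \<open>m\<close> on its domain \<open>D\<close>, so
    restricting the registers to \<open>D\<close> recovers the assignment of this pattern
    alone.\<close>
  have res: "(m ++ n) |` dom n = n" for n :: "nat \<Rightarrow> 'b option" by (auto simp: restrict_map_def map_add_def fun_eq_iff split: option.splits)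
  have "((m, v, w), c'') \<in> rx_sem G (Seq e f) \<longleftrightarrow> (\<exists>c'. matches G p D (m, v, w) c' \<and> (c', c'') \<in> rx_sem G f)"
  proof -
    have "((m, v, w), c') \<in> rx_sem G e \<longleftrightarrow> matches G p D (m, v, w) c'" for c'
      by (rule captures_iff[OF assms(1) p]) (use m in simp)
    then show ?thesis unfolding rx_sem.simps by blast
  qed
  also have "\<dots> \<longleftrightarrow> matches G p D (m, v, w) c'' \<and> csat_part G (fst c'' |` D) \<theta>"
  proof -
    have "D \<subseteq> dom (fst c')" if "matches G p D (m, v, w) c'" for c'
      using that unfolding matches_def by (cases c') auto
    then have "(c', c'') \<in> rx_sem G f \<longleftrightarrow> c'' = c' \<and> csat_part G (fst c' |` D) \<theta>" if "matches G p D (m, v, w) c'" for c'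
      using that f[of "fst c'" "fst (snd c')" "snd (snd c')" c''] by simp
    then show ?thesis by blast
  qed
  also have "\<dots> \<longleftrightarrow> matches G (PCond p \<theta>) D (m, v, w) c''"
    unfolding matches_def psem_Cond by (cases c'') (auto simp: res)
  finally show "((m, v, w), c'') \<in> rx_sem G (Seq e f) \<longleftrightarrow> matches G (PCond p \<theta>) D (m, v, w) c''" .
qed

definition clear_op :: "nat set \<Rightarrow> reg_op" where
  "clear_op V = ({}, \<lambda>x. if x \<in> V then Some ISharp else None)"

text \<open>All registers of \<open>p\<close> are empty on entry, so the join with \<open>m\<close>
  always succeeds, and clearing them afterwards gives back exactly \<open>m\<close>. Iterations thus
  do not influence each other, as the semantics requires, and any \<open>D\<close> may occur in each
  of them.\<close>

lemma captures_Rep: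
  assumes G: "dgraph_wf G"
    and f: "\<And>D. captures G p D (f D)"
    and E: "rx_sem G E = (\<Union>D\<in>Pow (pfv p). rx_sem G (f D))"
    and e: "\<And>c c'. (c, c') \<in> rx_sem G e \<longleftrightarrow> (\<exists>i. k \<le> i \<and> enat i \<le> M \<and> (c, c') \<in> rx_sem G (Seq E (Op (clear_op (pvars p)))) ^^ i)"
  shows "captures G (PRep p k M) {} e"
  unfolding captures_def
proof (intro allI impI)
  fix m :: "nat \<Rightarrow> 'b option" and v w and c' :: "('a, 'b) conf" assume p: "is_path G (v, w)" and m: "\<forall>x\<in>pbv (PRep p k M). m x = None"
  let ?L = "fst ` psem G p"
  have m1: "\<forall>x\<in>pbv p. m x = None" "\<And>x. x \<in> pvars p \<Longrightarrow> m x = None" using m pfv_pbv_pvars(2)[of p] by auto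
  have step: "((m, v, w), c') \<in> rx_sem G (Seq E (Op (clear_op (pvars p)))) \<longleftrightarrow> (\<exists>\<rho>'. c' = (m, \<rho>') \<and> ((v, w), \<rho>') \<in> cuts ?L)"
    if p: "is_path G (v, w)" for v w c'
  proof -
    let ?V = "pvars p"
    have clear: "((m1, v1, w1), c') \<in> op_rel G (clear_op V) \<longleftrightarrow> c' = ((\<lambda>x. if x \<in> V then None else m1 x), v1, w1)" for m1 v1 w1 V
      by (cases c') (auto simp: op_rel_def clear_op_def iupdate_def fun_eq_iff)
    have ci: "((m, v, w), c1) \<in> rx_sem G (f D) \<longleftrightarrow> matches G p D (m, v, w) c1" for c1 D
      by (rule captures_iff[OF f p m1(1)])
    have E1: "((m, v, w), c1) \<in> rx_sem G E \<longleftrightarrow> (\<exists>D. matches G p D (m, v, w) c1)" for c1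
      unfolding E UN_iff ci Pow_iff Bex_def by (intro ex_cong1 iffI conjI; (elim conjE)?; assumption?; elim matches_dom)
    have n: "n x = None" if "((v, w1), n) \<in> psem G p" "x \<notin> ?V" for w1 n x
      using psem_dom[OF that(1)] pfv_pbv_pvars(1)[of p] that(2) by blast
    have ag: "agree m n" if "((v, w1), n) \<in> psem G p" for w1 n
      unfolding agree_def
    proof (intro allI impI)
      fix x u u' assume "m x = Some u" "n x = Some u'"
      then show "u = u'" using n[OF that, of x] m1(2)[of x] by (cases "x \<in> ?V") auto
    qed
    have E2: "((m, v, w), (m1, v1, w')) \<in> rx_sem G E \<longleftrightarrow> (\<exists>w1 n. w = w1 @ w' \<and> ((v, w1), n) \<in> psem G p \<and>
      v1 = plast (v, w1) \<and> m1 = m ++ n)" for m1 v1 w'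
      unfolding E1 matches_def prod.case using ag by blast
    have cl: "(\<lambda>x. if x \<in> ?V then None else (m ++ n) x) = m" if "((v, w1), n) \<in> psem G p" for w1 n
    proof
      fix x
      show "(if x \<in> ?V then None else (m ++ n) x) = m x"
        using n[OF that, of x] m1(2)[of x] by (simp add: map_add_def)
    qed
    have "((m, v, w), c') \<in> rx_sem G (Seq E (Op (clear_op ?V))) \<longleftrightarrow>
      (\<exists>m1 v1 w'. ((m, v, w), (m1, v1, w')) \<in> rx_sem G E \<and> ((m1, v1, w'), c') \<in> op_rel G (clear_op ?V))"
      unfolding rx_sem.simps by (auto simp: relcomp_unfold)
    also have "\<dots> \<longleftrightarrow> (\<exists>w1 n w'. w = w1 @ w' \<and> ((v, w1), n) \<in> psem G p \<and>
        c' = ((\<lambda>x. if x \<in> ?V then None else (m ++ n) x), plast (v, w1), w'))"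
      unfolding E2 clear by blast
    also have "\<dots> \<longleftrightarrow> (\<exists>w1 n w'. w = w1 @ w' \<and> ((v, w1), n) \<in> psem G p \<and> c' = (m, plast (v, w1), w'))"
      by (intro ex_cong1 conj_cong refl) (simp only: cl)
    also have "\<dots> \<longleftrightarrow> (\<exists>\<rho>'. c' = (m, \<rho>') \<and> ((v, w), \<rho>') \<in> cuts ?L)"
      unfolding cuts_def by force
    finally show ?thesis .
  qed
  obtain m' v' w' where c': "c' = (m', v', w')" by (cases c') auto
  have v: "v \<in> nodes G" using is_path_nodes(1)[OF G p] .
  have "((m, v, w), c') \<in> rx_sem G e \<longleftrightarrow> m' = m \<and> (\<exists>i. k \<le> i \<and> enat i \<le> M \<and> ((v, w), (v', w')) \<in> cuts ?L ^^ i)"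
  proof -
    have "((m, v, w), c') \<in> rx_sem G (Seq E (Op (clear_op (pvars p)))) ^^ i \<longleftrightarrow> (\<exists>\<rho>'. c' = (m, \<rho>') \<and> ((v, w), \<rho>') \<in> cuts ?L ^^ i)" for i
      by (rule relpow_rx_cuts[OF G _ p]) (rule step)
    then show ?thesis unfolding e c' by blast
  qed
  also have "\<dots> \<longleftrightarrow> m' = m \<and> (\<exists>w1. w = w1 @ w' \<and> ((v, w1), Map.empty) \<in> psem G (PRep p k M) \<and> plast (v, w1) = v')"
    unfolding psem_Rep_cuts[OF v] ..
  also have "\<dots> \<longleftrightarrow> matches G (PRep p k M) {} (m, v, w) c'"
    unfolding matches_def c' by (auto simp: agree_def)
  finally show "((m, v, w), c') \<in> rx_sem G e \<longleftrightarrow> matches G (PRep p k M) {} (m, v, w) c'" .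
qed

text \<open>For patterns whose matches all bind the same set \<open>D'\<close>: any other
  \<open>D\<close> has no match and is served by \<open>fail_op\<close>.\<close>

lemma ex_captures_only:
  assumes "rx_ok N e" "\<And>G :: ('a, 'v, 'i, 'd) dgraph. dgraph_wf G \<Longrightarrow> captures G p D' e"
    and "\<And>(G :: ('a, 'v, 'i, 'd) dgraph) \<rho> n. (\<rho>, n) \<in> psem G p \<Longrightarrow> dom n = D'"
  shows "\<exists>e. rx_ok N e \<and> (\<forall>G :: ('a, 'v, 'i, 'd) dgraph. dgraph_wf G \<longrightarrow> captures G p D e)"
proof (cases "D = D'")
  case True
  with assms show ?thesis by blast
next
  case False
  have "\<not> matches G p D c c'" for G :: "('a, 'v, 'i, 'd) dgraph" and c c'
    using assms(3)[of _ _ G] False unfolding matches_def by (cases c; cases c') blast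
  then show ?thesis by (intro exI[of _ "Op fail_op"]) (simp add: captures_def fail_op_in)
qed

lemma captures_Empty: "captures G PEmpty {} (Op skip_op)"
  unfolding captures_def
proof (intro allI impI)
  fix m :: "nat \<Rightarrow> 'b option" and v w and c' :: "('a, 'b) conf" assume "is_path G (v, w)"
  then have "v \<in> nodes G" by (simp add: is_path_def)
  then show "((m, v, w), c') \<in> rx_sem G (Op skip_op) \<longleftrightarrow> matches G PEmpty {} (m, v, w) c'"
    unfolding matches_def psem_Empty by (cases c') (auto simp: agree_def)
qed

text \<open>The expression is chosen before the graph, as one automaton has to serve all graphs. All
  sets \<open>D\<close> are covered at once, since concatenation and repetition call on several of
  them.\<close>

lemma ex_captures:
  assumes "pat_wf p" "pvars p \<subseteq> {..<N}"
  shows "\<exists>e. rx_ok N e \<and> (\<forall>G :: ('a, 'v, 'i, 'd) dgraph. dgraph_wf G \<longrightarrow> captures G p D e)"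
proof -
  let ?C = "\<lambda>p D e. rx_ok N e \<and> (\<forall>G :: ('a, 'v, 'i, 'd) dgraph. dgraph_wf G \<longrightarrow> captures G p D e)"
  show ?thesis using assms
  proof (induction p arbitrary: D)
    case PEmpty
    show ?case by (rule ex_captures_only[of N "Op skip_op"]) (auto simp: skip_op_in captures_Empty psem_Empty)
  next
    case (PVar x)
    have "rx_ok N (Alt (Op ({IEq (IReg x) ISharp}, [x \<mapsto> IIn 0])) (Op ({IEq (IReg x) (IIn 0)}, Map.empty)) :: 'a rx)"
      using PVar.prems by (auto simp: reg_ops_iff gatoms_iff iterms_def split: if_splits)
    then show ?case by (rule ex_captures_only[OF _ captures_Var]) (auto simp: psem_Var split: if_splits)
  next
    case PAny
    show ?case by (rule ex_captures_only[of N "Step UNIV"], simp, rule captures_Step) (auto simp: psem_Any)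
  next
    case (PLab b)
    show ?case by (rule ex_captures_only[of N "Step {b}"], simp, rule captures_Step) (auto simp: psem_Lab)
  next
    case (PUnion p q)
    have "pat_wf p" "pvars p \<subseteq> {..<N}" "pat_wf q" "pvars q \<subseteq> {..<N}" using PUnion.prems by auto
    then obtain e f where "rx_ok N e" "rx_ok N f"
      "\<And>G :: ('a, 'v, 'i, 'd) dgraph. dgraph_wf G \<Longrightarrow> captures G p D e"
      "\<And>G :: ('a, 'v, 'i, 'd) dgraph. dgraph_wf G \<Longrightarrow> captures G q D f"
      using PUnion.IH(1)[of D] PUnion.IH(2)[of D] by blast
    then show ?case by (intro exI[of _ "Alt e f"]) (simp add: captures_Union)
  next
    case (PConcat p q)
    have "pat_wf p" "pvars p \<subseteq> {..<N}" "pat_wf q" "pvars q \<subseteq> {..<N}" using PConcat.prems by auto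
    with PConcat.IH have "\<forall>D. \<exists>e. ?C p D e"
      "\<forall>D. \<exists>e. ?C q D e" by blast+
    from this[THEN choice] obtain f g where fg:
      "\<forall>D. ?C p D (f D)"
      "\<forall>D. ?C q D (g D)" by blast
    let ?S = "{(D1, D2). D1 \<subseteq> pfv p \<and> D2 \<subseteq> pfv q \<and> D1 \<union> D2 = D}"
    have "finite (pfv p)" "finite (pfv q)" using finite_subset[OF pfv_pbv_pvars(1) finite_pvars] by auto
    then have "finite ?S" by (intro finite_subset[of ?S "Pow (pfv p) \<times> Pow (pfv q)"]) auto
    then obtain e where "rx_ok N e" and e: "\<And>G :: ('a, 'v, 'i, 'd) dgraph. rx_sem G e = (\<Union>s\<in>?S. rx_sem G ((\<lambda>(D1, D2). Seq (f D1) (g D2)) s))"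
      by (rule rx_finite_union[of ?S N "\<lambda>(D1, D2). Seq (f D1) (g D2)"]) (use fg in auto)
    moreover have "captures G (PConcat p q) D e" if "dgraph_wf G" for G :: "('a, 'v, 'i, 'd) dgraph"
      by (rule captures_Concat[OF that PConcat.prems(1), of f g]) (use fg that e in \<open>auto simp: split_beta\<close>)
    ultimately show ?case by blast
  next
    case (PRep p k M)
    have "pat_wf p" "pvars p \<subseteq> {..<N}" using PRep.prems by auto
    with PRep.IH have "\<forall>D. \<exists>e. ?C p D e" by blast
    from choice[OF this] obtain f where f:
      "\<forall>D. ?C p D (f D)" by blast
    have "finite (Pow (pfv p))" using finite_subset[OF pfv_pbv_pvars(1) finite_pvars, of p] by simp
    then obtain E where E: "rx_ok N E" "\<And>G :: ('a, 'v, 'i, 'd) dgraph. rx_sem G E = (\<Union>D\<in>Pow (pfv p). rx_sem G (f D))"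
      by (rule rx_finite_union[of "Pow (pfv p)" N f]) (use f in auto)
    let ?F = "Seq E (Op (clear_op (pvars p)))"
    have "rx_ok N ?F" using E(1) \<open>pvars p \<subseteq> {..<N}\<close> by (auto simp: clear_op_def reg_ops_iff iterms_def split: if_splits)
    then obtain e where ok: "rx_ok N e" and e: "\<And>(G :: ('a, 'v, 'i, 'd) dgraph) c c'. (c, c') \<in> rx_sem G e \<longleftrightarrow>
        (\<exists>i. k \<le> i \<and> enat i \<le> M \<and> (c, c') \<in> rx_sem G ?F ^^ i)"
      by (rule rx_repeat[of N ?F k M]) blast
    have "captures G (PRep p k M) {} e" if "dgraph_wf G" for G :: "('a, 'v, 'i, 'd) dgraph"
      using f that by (intro captures_Rep[OF that _ E(2) e]) blast
    from ex_captures_only[OF ok this] show ?case by (auto simp: psem_Rep)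
  next
    case (PCond p \<theta>)
    have "pat_wf p" "pvars p \<subseteq> {..<N}" and c: "cvars \<theta> \<subseteq> {..<N}" using PCond.prems by auto
    then obtain e where e: "rx_ok N e" "\<And>G :: ('a, 'v, 'i, 'd) dgraph. dgraph_wf G \<Longrightarrow> captures G p D e"
      using PCond.IH[of D] by blast
    from rx_cond[OF c, of D True] obtain f where f: "rx_ok N f" "\<forall>(G :: ('a, 'v, 'i, 'd) dgraph) m v w c'. D \<subseteq> dom m \<longrightarrow>
      ((m, v, w), c') \<in> rx_sem G f \<longleftrightarrow> c' = (m, v, w) \<and> csat_part G (m |` D) \<theta> = True" by (elim exE conjE)
    have f2: "((m, v, w), c') \<in> rx_sem G f \<longleftrightarrow> c' = (m, v, w) \<and> csat_part G (m |` D) \<theta>" if "D \<subseteq> dom m"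
      for G :: "('a, 'v, 'i, 'd) dgraph" and m v w c'
      using f(2)[rule_format, OF that] by (simp only: simp_thms)
    have "captures G (PCond p \<theta>) D (Seq e f)" if "dgraph_wf G" for G :: "('a, 'v, 'i, 'd) dgraph"
      by (rule captures_Cond[OF e(2)[OF that] f2])
    then show ?case using e(1) f(1) by (intro exI[of _ "Seq e f"]) simp
  qed
qed

section \<open>Restrictors and queries over patterns\<close>

lemma pattern_rdpa:
  fixes p :: "'a pat"
  assumes "finite (UNIV :: 'a set)" "pat_wf p"
  obtains A where "rdpa_wf A" "arity A = 1"
    "\<And>(G :: ('a, 'v, 'i, 'd) dgraph) \<rho>. dgraph_wf G \<Longrightarrow> is_path G \<rho> \<Longrightarrow>
      rdpa_accepts A (conv [dpath_of G \<rho>]) \<longleftrightarrow> \<rho> \<in> fst ` pat_sem G p"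
proof -
  obtain N where N: "pvars p \<subseteq> {..<N}"
    using finite_pvars[of p] finite_nat_set_iff_bounded[of "pvars p"] by (auto simp: subset_iff)
  from ex_captures[OF assms(2) N] have "\<forall>D. \<exists>e. rx_ok N e \<and> (\<forall>G :: ('a, 'v, 'i, 'd) dgraph. dgraph_wf G \<longrightarrow> captures G p D e)" by blast
  from choice[OF this] obtain f where f:
      "\<forall>D. rx_ok N (f D) \<and> (\<forall>G :: ('a, 'v, 'i, 'd) dgraph. dgraph_wf G \<longrightarrow> captures G p D (f D))" by blast
  have "finite (Pow (pfv p))" using finite_subset[OF pfv_pbv_pvars(1) finite_pvars, of p] by simp
  \<comment> \<open>An answer only asks for the existence of some assignment, so the union over all
    possible domains is taken.\<close>
  then obtain E where E: "rx_ok N E" "\<And>G :: ('a, 'v, 'i, 'd) dgraph. rx_sem G E = (\<Union>D\<in>Pow (pfv p). rx_sem G (f D))"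
    by (rule rx_finite_union[of "Pow (pfv p)" N f]) (use f in auto)
  have sem: "(\<exists>m v. ((\<lambda>_. None, fst \<rho>, snd \<rho>), (m, v, [])) \<in> rx_sem G E) \<longleftrightarrow> \<rho> \<in> fst ` pat_sem G p"
    if G: "dgraph_wf G" and p: "is_path G \<rho>" for G :: "('a, 'v, 'i, 'd) dgraph" and \<rho>
  proof -
    obtain v w where r: "\<rho> = (v, w)" by fastforce
    have ci: "((\<lambda>_. None, v, w), c') \<in> rx_sem G (f D) \<longleftrightarrow> matches G p D (\<lambda>_. None, v, w) c'" for c' D
      by (rule captures_iff) (use f G p r in auto)
    have "((\<lambda>_. None, v, w), c') \<in> rx_sem G E \<longleftrightarrow> (\<exists>D. matches G p D (\<lambda>_. None, v, w) c')" for c'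
      unfolding E(2) UN_iff ci Pow_iff Bex_def by (intro ex_cong1 iffI conjI; (elim conjE)?; assumption?; elim matches_dom)
    then have "(\<exists>m v'. ((\<lambda>_. None, v, w), (m, v', [])) \<in> rx_sem G E) \<longleftrightarrow> (\<exists>n. ((v, w), n) \<in> psem G p)"
      unfolding matches_def by (auto simp: agree_def)
    also have "\<dots> \<longleftrightarrow> \<rho> \<in> fst ` pat_sem G p" unfolding psem_iff r by force
    finally show ?thesis by (simp add: r)
  qed
  show thesis
  proof (rule rx_to_rdpa[OF assms(1) E(1)])
    fix A assume "rdpa_wf A" "arity A = 1"
      "\<And>(G :: ('a, 'v, 'i, 'd) dgraph) \<rho>. dgraph_wf G \<Longrightarrow> is_path G \<rho> \<Longrightarrow> rdpa_accepts A (conv [dpath_of G \<rho>]) \<longleftrightarrow>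
        (\<exists>m v. ((\<lambda>_. None, fst \<rho>, snd \<rho>), (m, v, [])) \<in> rx_sem G E)"
    then show thesis using sem by (intro that[of A]) simp_all
  qed
qed

lemma GPC_subsumed_ERDPQ:
  assumes fin: "finite (UNIV :: 'a set)"
  shows "subsumed TYPE(('a, 'v, 'i, 'd) dgraph) GPC gpc_path_query ERDPQ fo_sat"
    "subsumed TYPE(('a, 'v, 'i, 'd) dgraph) GPC gpc_bool_query ERDPQ fo_sat"
proof -
  show path_query: "subsumed TYPE(('a, 'v, 'i, 'd) dgraph) GPC gpc_path_query ERDPQ fo_sat"
    unfolding subsumed_def
  proof
    fix Q :: "restrictor \<times> 'a pat" assume GPC: "Q \<in> GPC"
    obtain t p where Q: "Q = (t, p)" by fastforce
    have "pat_wf p" using GPC by (simp add: GPC_def Q)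
    then obtain A where A: "rdpa_wf A" "arity A = 1" and acc:
      "\<And>(G :: ('a, 'v, 'i, 'd) dgraph) \<rho>. dgraph_wf G \<Longrightarrow> is_path G \<rho> \<Longrightarrow>
        rdpa_accepts A (conv [dpath_of G \<rho>]) \<longleftrightarrow> \<rho> \<in> fst ` pat_sem G p"
      by (rule pattern_rdpa[OF fin]) blast
    have path: "is_path G \<rho>" if "dgraph_wf G" "\<rho> \<in> fst ` pat_sem G p" for G :: "('a, 'v, 'i, 'd) dgraph" and \<rho>
      using that psem_is_path[OF that(1)] by (fastforce simp: psem_iff)
    \<comment> \<open>Path variable 0 holds the output and 1 a competitor with the same ends:
      \<open>B\<close> excludes a strictly shorter matching competitor that satisfies
      \<open>\<phi>\<close>.\<close>
    define B :: "'a fo \<Rightarrow> 'a fo" where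
      "B \<phi> = FNot (FExP 1 (FAnd (FAnd (FIn [1] A) \<phi>) (FAnd (FAnd (FSameStart 1 0) (FSameEnd 1 0)) (FIn [1, 0] less_rdpa))))" for \<phi>
    define T :: "'a fo" where "T = FNEq 0 0"
    have B: "fo_sat G \<nu> \<pi> (B \<phi>) \<longleftrightarrow> (\<forall>\<rho>\<in>fst ` pat_sem G p. P \<rho> \<and> pfirst \<rho> = pfirst (\<pi> 0) \<and> plast \<rho> = plast (\<pi> 0) \<longrightarrow> plen (\<pi> 0) \<le> plen \<rho>)"
      if G: "dgraph_wf G" and \<pi>: "\<forall>p. is_path G (\<pi> p)"
        and \<phi>: "\<And>\<rho>. is_path G \<rho> \<Longrightarrow> fo_sat G \<nu> (\<pi>(1 := \<rho>)) \<phi> = P \<rho>"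
      for G :: "('a, 'v, 'i, 'd) dgraph" and \<nu> \<pi> \<phi> P
    proof -
      have "fo_sat G \<nu> \<pi> (B \<phi>) \<longleftrightarrow> \<not> (\<exists>\<rho>. is_path G \<rho> \<and> (\<rho> \<in> fst ` pat_sem G p \<and> P \<rho>) \<and>
         (pfirst \<rho> = pfirst (\<pi> 0) \<and> plast \<rho> = plast (\<pi> 0)) \<and> plen \<rho> < plen (\<pi> 0))"
        unfolding B_def fo_sat.simps using \<pi>
        by (intro arg_cong[where f = Not] ex_cong1 conj_cong refl)
          (simp_all add: sat_FSameStart[OF G] sat_FSameEnd[OF G] acc[OF G] less_rdpa_accepts \<phi>[simplified])
      then show ?thesis using path[OF G] not_less by blast
    qed
    have wf: "fo_wf (B \<phi>) \<longleftrightarrow> fo_wf \<phi>" for \<phi>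
      by (simp add: B_def FO_macros_wf[OF fin] binary_rdpas_wf[OF fin] binary_rdpas_arity A)
    \<comment> \<open>In \<open>FSimple 1 2 0\<close> the variable 1 is bound and so free for reuse,
      whereas inside \<open>B\<close> it holds the competitor, hence the scratch variables 2 and 3
      there.\<close>
    define \<psi> where "\<psi> = FAnd (FIn [0] A) (case t of SIMPLE \<Rightarrow> FSimple 1 2 0 | SHORTEST \<Rightarrow> B T
        | SHORTESTSIMPLE \<Rightarrow> FAnd (FSimple 1 2 0) (B (FSimple 2 3 1)))"
    have "fo_wf \<psi>"
      by (cases t) (simp_all add: \<psi>_def wf T_def FO_macros_wf[OF fin] A)
    moreover have "fo_sat G \<nu> \<pi> \<psi> = (\<pi> 0 \<in> gpc_ans G Q)" if G: "dgraph_wf G" and \<pi>: "\<forall>p. is_path G (\<pi> p)"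
      for G :: "('a, 'v, 'i, 'd) dgraph" and \<nu> \<pi>
    proof -
      have \<pi>0: "is_path G (\<pi> 0)" using \<pi> by blast
      have T: "fo_sat G \<nu> (\<pi>(1 := \<rho>)) T = True" for \<rho> by (simp add: T_def)
      have S: "fo_sat G \<nu> (\<pi>(1 := \<rho>)) (FSimple 2 3 1) = simple_path \<rho>" if "is_path G \<rho>" for \<rho>
        using sat_FSimple[OF G, of "\<pi>(1 := \<rho>)" 1 2 3 \<nu>] that by simp
      have S0: "fo_sat G \<nu> \<pi> (FSimple 1 2 0) = simple_path (\<pi> 0)"
        using sat_FSimple[OF G, of \<pi> 0 1 2 \<nu>] \<pi>0 by simp
      have a: "fo_sat G \<nu> \<pi> (FIn [0] A) \<longleftrightarrow> \<pi> 0 \<in> fst ` pat_sem G p" by (simp add: acc[OF G \<pi>0])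
      show ?thesis
      proof (cases t)
        case SIMPLE
        then show ?thesis using a S0 by (force simp: \<psi>_def gpc_ans_def Q simp del: fo_sat.simps(4))
      next
        case SHORTEST
        then show ?thesis using a B[OF G \<pi>, of \<nu> T "\<lambda>_. True", OF T]
          by (force simp: \<psi>_def gpc_ans_def Q simp del: fo_sat.simps(4))
      next
        case SHORTESTSIMPLE
        then show ?thesis using a S0 B[OF G \<pi>, of \<nu> "FSimple 2 3 1" simple_path, OF S]
          by (force simp: \<psi>_def gpc_ans_def Q simp del: fo_sat.simps(4))
      qed
    qed
    ultimately show "\<exists>\<psi>\<in>ERDPQ. \<forall>(G :: ('a, 'v, 'i, 'd) dgraph) \<nu> \<pi>. dgraph_wf G \<longrightarrow> valid_asg G \<nu> \<pi> \<longrightarrow>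
        gpc_path_query G \<nu> \<pi> Q = fo_sat G \<nu> \<pi> \<psi>"
      by (intro bexI[of _ \<psi>]) (simp_all add: ERDPQ_def valid_asg_def gpc_path_query_def)
  qed
  show "subsumed TYPE(('a, 'v, 'i, 'd) dgraph) GPC gpc_bool_query ERDPQ fo_sat"
    unfolding subsumed_def
  proof
    fix Q :: "restrictor \<times> 'a pat" assume "Q \<in> GPC"
    with path_query obtain \<psi> where w: "\<psi> \<in> ERDPQ" and s: "\<And>(G :: ('a, 'v, 'i, 'd) dgraph) \<nu> \<pi>. dgraph_wf G \<Longrightarrow>
      valid_asg G \<nu> \<pi> \<Longrightarrow> gpc_path_query G \<nu> \<pi> Q = fo_sat G \<nu> \<pi> \<psi>" unfolding subsumed_def by blast
    show "\<exists>\<psi>\<in>ERDPQ. \<forall>(G :: ('a, 'v, 'i, 'd) dgraph) \<nu> \<pi>. dgraph_wf G \<longrightarrow> valid_asg G \<nu> \<pi> \<longrightarrow> gpc_bool_query G \<nu> \<pi> Q = fo_sat G \<nu> \<pi> \<psi>"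
    proof (intro bexI[of _ "FExP 0 \<psi>"] allI impI)
      fix G :: "('a, 'v, 'i, 'd) dgraph" and \<nu> \<pi> assume G: "dgraph_wf G" and v: "valid_asg G \<nu> \<pi>"
      have "fo_sat G \<nu> (\<pi>(0 := \<rho>)) \<psi> = (\<rho> \<in> gpc_ans G Q)" if "is_path G \<rho>" for \<rho>
        using s[OF G, of \<nu> "\<pi>(0 := \<rho>)"] v that by (simp add: valid_asg_def gpc_path_query_def)
      \<comment> \<open>Answers are paths of the graph, so the quantifier \<open>FExP\<close>
        reaches all of them.\<close>
      moreover have "is_path G \<rho>" if r: "\<rho> \<in> gpc_ans G Q" for \<rho>
      proof -
        obtain \<mu> where "(\<rho>, \<mu>) \<in> pat_sem G (snd Q)" using r unfolding gpc_ans_def by (cases "fst Q") auto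
        then show ?thesis using psem_is_path[OF G] psem_iff by metis
      qed
      ultimately show "gpc_bool_query G \<nu> \<pi> Q = fo_sat G \<nu> \<pi> (FExP 0 \<psi>)"
        unfolding gpc_bool_query_def fo_sat.simps by blast
    qed (use w in \<open>simp add: ERDPQ_def\<close>)
  qed
qed

section \<open>Inclusions between syntactic fragments, and the combined result\<close>

lemma RDPQ_subsumed_FO_RDPQ: "subsumed TYPE(('a, 'v, 'i, 'd) dgraph) RDPQ fo_sat FO_RDPQ fo_sat"
  unfolding subsumed_def RDPQ_def FO_RDPQ_def by fastforce

lemma FO_RDPQ_subsumed_ERDPQ: "subsumed TYPE(('a, 'v, 'i, 'd) dgraph) FO_RDPQ fo_sat ERDPQ fo_sat"
  unfolding subsumed_def ERDPQ_def FO_RDPQ_def by blast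

theorem theorem4p1:
  assumes "finite (UNIV :: 'a set)"
    and "infinite (UNIV :: 'i set)"
    and "infinite (UNIV :: 'd set)"
  shows "subsumed TYPE(('a, 'v, 'i, 'd) dgraph) RDPQ fo_sat FO_RDPQ fo_sat
       \<and> subsumed TYPE(('a, 'v, 'i, 'd) dgraph) FO_RDPQ fo_sat ERDPQ fo_sat
       \<and> subsumed TYPE(('a, 'v, 'i, 'd) dgraph) GPC gpc_path_query ERDPQ fo_sat
       \<and> subsumed TYPE(('a, 'v, 'i, 'd) dgraph) GPC gpc_bool_query ERDPQ fo_sat
       \<and> subsumed TYPE(('a, 'v, 'i, 'd) dgraph) WL wl_query ERDPQ fo_sat
       \<and> subsumed TYPE(('a, 'v, 'i, 'd) dgraph) RDPQ fo_sat FOstar fs_sat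
       \<and> subsumed TYPE(('a, 'v, 'i, 'd) dgraph) UNIV gx_node_query FOstar fs_sat
       \<and> subsumed TYPE(('a, 'v, 'i, 'd) dgraph) UNIV gx_path_query FOstar fs_sat"
  using RDPQ_subsumed_FO_RDPQ FO_RDPQ_subsumed_ERDPQ GPC_subsumed_ERDPQ[OF assms(1)] WL_subsumed_ERDPQ[OF assms(1)]
    RDPQ_subsumed_FOstar gx_subsumed_FOstar[OF assms(1)]
  by (intro conjI)

end
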